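(* Let $q$ be a power of an odd prime and let $H=\mathbb{F}_{q^2}(x,y)$ be the Hermitian function field over $\mathbb{F}_{q^2}$, defined by $y^q+y=x^{q+1}$. Let $a\in\mathbb{F}_{q^2}$ be a primitive $(q^2-1)$-th root of unity, $\delta=a^{(q+1)/2}$ and $c=\delta-a^{q+1}\delta^{-1}$. Let $\sigma$ be the $\mathbb{F}_{q^2}$-automorphism of $H$ given by $\sigma(x)=\frac{ax}{a^{q+1}y+c}$, $\sigma(y)=\frac{1}{a^{q+1}y+c}$ (it has order $2(q+1)$). Let $m$ be a positive divisor of $2(q+1)$ and let $\mathcal G=\langle\sigma^{\frac{2(q+1)}{m}}\rangle$. If $m\mid (q+1)$, then $g(H^{\mathcal G})=\frac{(q-1)(q+1-m)}{2m}$; otherwise $g(H^{\mathcal G})=\frac{(q-1)(q+1-\frac m2)}{2m}$.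
   Context: $H^{\mathcal G}$ denotes the subfield of $H$ fixed by every element of $\mathcal G$, regarded as a function field over $\mathbb{F}_{q^2}$. *)

theory Defs
  imports
    "HOL-Computational_Algebra.Computational_Algebra"
    "HOL-Library.Cardinality"
    "HOL-Algebra.Free_Abelian_Groups"
begin

text \<open>
  A field extension of \<open>K\<close> is given by a type \<open>'k\<close> for the ground field \<open>K\<close>, a type \<open>'f\<close> for
  the ambient field, and a homomorphism \<open>\<iota>\<close> from \<open>'k\<close> to \<open>'f\<close> (automatically injective).
  The fields between \<open>\<iota>(K)\<close> and the ambient field are sets of elements of \<open>'f\<close>, so that a function
  field and its subfields, such as fixed fields, are treated by the same definitions.
\<close>

definition field_homomorphism :: "('k::field \<Rightarrow> 'f::field) \<Rightarrow> bool" where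
  "field_homomorphism h \<longleftrightarrow>
     h 1 = 1 \<and> (\<forall>u v. h (u + v) = h u + h v) \<and> (\<forall>u v. h (u * v) = h u * h v)"

definition scale_via :: "('k::field \<Rightarrow> 'f::field) \<Rightarrow> 'k \<Rightarrow> 'f \<Rightarrow> 'f" where
  "scale_via \<iota> k z = \<iota> k * z"

definition intermediate_field :: "('k::field \<Rightarrow> 'f::field) \<Rightarrow> 'f set \<Rightarrow> bool" where
  "intermediate_field \<iota> F \<longleftrightarrow> range \<iota> \<subseteq> F \<and>
     (\<forall>u\<in>F. \<forall>v\<in>F. u - v \<in> F \<and> u * v \<in> F) \<and> (\<forall>u\<in>F. inverse u \<in> F)"

definition adjoin :: "('k::field \<Rightarrow> 'f::field) \<Rightarrow> 'f set \<Rightarrow> 'f set" where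
  "adjoin \<iota> S = \<Inter>{F. intermediate_field \<iota> F \<and> S \<subseteq> F}"

definition transcendental_via :: "('k::field \<Rightarrow> 'f::field) \<Rightarrow> 'f \<Rightarrow> bool" where
  "transcendental_via \<iota> z \<longleftrightarrow> (\<forall>p. p \<noteq> 0 \<longrightarrow> poly (map_poly \<iota> p) z \<noteq> 0)"


section \<open>Places, divisors and the genus\<close>

definition valuation_ring :: "('k::field \<Rightarrow> 'f::field) \<Rightarrow> 'f set \<Rightarrow> 'f set \<Rightarrow> bool" where
  "valuation_ring \<iota> F R \<longleftrightarrow> range \<iota> \<subset> R \<and> R \<subset> F \<and>
     (\<forall>u\<in>R. \<forall>v\<in>R. u - v \<in> R \<and> u * v \<in> R) \<and> (\<forall>z\<in>F. z \<in> R \<or> inverse z \<in> R)"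

text \<open>
  A place is the maximal ideal of a valuation ring, that is, its set of non-units. The ring is
  recovered from the place by \<open>place_ring\<close>; zero is listed separately there because
  \<^term>\<open>inverse 0 = 0\<close> lies in every place.
\<close>

definition places :: "('k::field \<Rightarrow> 'f::field) \<Rightarrow> 'f set \<Rightarrow> 'f set set" where
  "places \<iota> F =
     {P. \<exists>R. valuation_ring \<iota> F R \<and> P = R - {u\<in>R. u \<noteq> 0 \<and> inverse u \<in> R}}"

definition place_ring :: "'f::field set \<Rightarrow> 'f set \<Rightarrow> 'f set" where
  "place_ring F P = {z\<in>F. z = 0 \<or> inverse z \<notin> P}"

definition prime_element :: "'f::field set \<Rightarrow> 'f set \<Rightarrow> 'f \<Rightarrow> bool" where
  "prime_element F P t \<longleftrightarrow> P = (\<lambda>z. t * z) ` place_ring F P"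

text \<open>
  Only meaningful for \<open>z \<noteq> 0\<close>; the convention \<open>v_P(0) = \<infinity>\<close> is built into \<open>riemann_roch_space\<close>.
  The units of the valuation ring of \<open>P\<close> are the elements of \<open>place_ring F P - P\<close>.
\<close>

definition place_valuation :: "'f::field set \<Rightarrow> 'f set \<Rightarrow> 'f \<Rightarrow> int" where
  "place_valuation F P z =
     (THE n. \<exists>t u. prime_element F P t \<and> u \<in> place_ring F P - P \<and> z = t powi n * u)"

text \<open>
  \<open>basis_modulo scale V W B\<close>: the classes of the elements of \<open>B\<close> are pairwise distinct and form
  a basis of the quotient space \<open>V / W\<close>. As for \<^const>\<open>vector_space.dim\<close>, an infinite dimension is
  represented by \<open>0\<close>.
\<close>

definition basis_modulo ::
    "('k::field \<Rightarrow> 'v::ab_group_add \<Rightarrow> 'v) \<Rightarrow> 'v set \<Rightarrow> 'v set \<Rightarrow> 'v set \<Rightarrow> bool" where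
  "basis_modulo scale V W B \<longleftrightarrow> B \<subseteq> V \<and>
     (\<forall>S c. finite S \<and> S \<subseteq> B \<and> (\<Sum>b\<in>S. scale (c b) b) \<in> W \<longrightarrow> (\<forall>b\<in>S. c b = 0)) \<and>
     (\<forall>v\<in>V. \<exists>w\<in>W. v - w \<in> module.span scale B)"

definition quotient_dim ::
    "('k::field \<Rightarrow> 'v::ab_group_add \<Rightarrow> 'v) \<Rightarrow> 'v set \<Rightarrow> 'v set \<Rightarrow> nat" where
  "quotient_dim scale V W = card (SOME B. basis_modulo scale V W B)"

definition place_degree :: "('k::field \<Rightarrow> 'f::field) \<Rightarrow> 'f set \<Rightarrow> 'f set \<Rightarrow> nat" where
  "place_degree \<iota> F P = quotient_dim (scale_via \<iota>) (place_ring F P) P"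

definition divisors :: "('k::field \<Rightarrow> 'f::field) \<Rightarrow> 'f set \<Rightarrow> ('f set \<Rightarrow>\<^sub>0 int) set" where
  "divisors \<iota> F = {D. Poly_Mapping.keys D \<subseteq> places \<iota> F}"

definition divisor_degree ::
    "('k::field \<Rightarrow> 'f::field) \<Rightarrow> 'f set \<Rightarrow> ('f set \<Rightarrow>\<^sub>0 int) \<Rightarrow> int" where
  "divisor_degree \<iota> F D =
     (\<Sum>P\<in>Poly_Mapping.keys D. Poly_Mapping.lookup D P * int (place_degree \<iota> F P))"

definition riemann_roch_space ::
    "('k::field \<Rightarrow> 'f::field) \<Rightarrow> 'f set \<Rightarrow> ('f set \<Rightarrow>\<^sub>0 int) \<Rightarrow> 'f set" where
  "riemann_roch_space \<iota> F D =
     {z\<in>F. z = 0 \<or> (\<forall>P\<in>places \<iota> F. place_valuation F P z \<ge> - Poly_Mapping.lookup D P)}"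

definition divisor_dim :: "('k::field \<Rightarrow> 'f::field) \<Rightarrow> 'f set \<Rightarrow> ('f set \<Rightarrow>\<^sub>0 int) \<Rightarrow> nat" where
  "divisor_dim \<iota> F D = vector_space.dim (scale_via \<iota>) (riemann_roch_space \<iota> F D)"

text \<open>
  \<open>g = max {deg D - dim D + 1}\<close> over all divisors \<open>D\<close>. \<^const>\<open>Greatest\<close> is an actual maximum; it
  is unspecified if the values are unbounded.
\<close>

definition genus :: "('k::field \<Rightarrow> 'f::field) \<Rightarrow> 'f set \<Rightarrow> int" where
  "genus \<iota> F =
     (GREATEST g. \<exists>D\<in>divisors \<iota> F. g = divisor_degree \<iota> F D - int (divisor_dim \<iota> F D) + 1)"


section \<open>Automorphisms and fixed fields\<close>

definition aut_group :: "('k::field \<Rightarrow> 'f::field) \<Rightarrow> ('f \<Rightarrow> 'f) monoid" where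
  "aut_group \<iota> =
     \<lparr>carrier = {f. bij f \<and> field_homomorphism f \<and> (\<forall>k. f (\<iota> k) = \<iota> k)},
      mult = (\<circ>), one = id\<rparr>"

definition fixed_field :: "('f \<Rightarrow> 'f) set \<Rightarrow> 'f set" where
  "fixed_field G = {z. \<forall>f\<in>G. f z = z}"


section \<open>The Hermitian function field\<close>

definition primitive_root_of_unity :: "nat \<Rightarrow> 'k::field \<Rightarrow> bool" where
  "primitive_root_of_unity n a \<longleftrightarrow> a ^ n = 1 \<and> (\<forall>k. 0 < k \<and> k < n \<longrightarrow> a ^ k \<noteq> 1)"

text \<open>
  The whole type \<open>'h\<close> is \<open>K(x, y)\<close> with \<open>x\<close> transcendental over \<open>K\<close>. As \<open>T\<^sup>q + T - x\<^sup>q\<^sup>+\<^sup>1\<close> is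
  irreducible over \<open>K(x)\<close>, this determines the extension up to isomorphism.
\<close>

definition hermitian_function_field ::
    "nat \<Rightarrow> ('k::field \<Rightarrow> 'h::field) \<Rightarrow> 'h \<Rightarrow> 'h \<Rightarrow> bool" where
  "hermitian_function_field q \<iota> x y \<longleftrightarrow>
     CARD('k) = q ^ 2 \<and> field_homomorphism \<iota> \<and> transcendental_via \<iota> x \<and>
     y ^ q + y = x ^ (q + 1) \<and> adjoin \<iota> {x, y} = UNIV"

end

theory Submission
  imports Defs
begin

text \<open>
  Since \<open>\<delta>\<^sup>2 = a\<^sup>q\<^sup>+\<^sup>1\<close>, the constant \<open>c\<close> is zero. Put \<open>w = \<delta> y\<close>, \<open>u = (w - 1) / (w + 1)\<close>,
  \<open>t = u\<^sup>2\<close> and \<open>X = x / (w + 1)\<close>. Then \<open>\<sigma>\<close> maps \<open>w\<close> to \<open>1 / w\<close>, so it fixes \<open>t\<close>, and it multiplies \<open>X\<close>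
  by a primitive root of unity of order \<open>N = 2 (q + 1)\<close>; moreover \<open>X\<^sup>N = \<kappa> t h(t)\<^sup>2\<close> with
  \<open>h = 1 - T\<^sup>k\<close>, \<open>k = (q - 1) / 2\<close>. Thus \<open>H\<close> is a Kummer extension of \<open>K(t)\<close> with group \<open>\<langle>\<sigma>\<rangle>\<close>, and the
  fixed field of \<open>\<sigma>\<^sup>e\<close>, \<open>e = N / m\<close>, has the basis \<open>X\<^sup>j\<^sup>m\<close>, \<open>j < e\<close>, over \<open>K(t)\<close>. Dividing the elements
  with \<open>j m \<ge> q + 1\<close> by \<open>h(t)\<close> gives an integral basis \<open>b\<^sub>j\<close>: the element \<open>\<Sum> c\<^sub>j(t) b\<^sub>j\<close> lies in
  \<open>L(l (t)\<^sub>\<infinity>)\<close> iff the \<open>c\<^sub>j\<close> are polynomials with \<open>deg c\<^sub>j + d\<^sub>j \<le> l\<close>. So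
  \<open>dim L(l (t)\<^sub>\<infinity>) = e (l + 1) - \<Sum> d\<^sub>j\<close> for large \<open>l\<close>, and the genus is \<open>1 - e + \<Sum> d\<^sub>j\<close>.

  These divisors attain the maximum in the definition of the genus: \<open>deg D - dim D\<close> is monotone in \<open>D\<close>,
  every divisor is at most \<open>(f)\<^sub>0 + l (t)\<^sub>\<infinity>\<close> for some polynomial \<open>f\<close> in \<open>t\<close>, this divisor has the same
  dimension as \<open>(l + deg f) (t)\<^sub>\<infinity>\<close>, and \<open>deg (f)\<^sub>0 \<le> e deg f\<close> by weak approximation.
\<close>

section \<open>Linear algebra over the ground field\<close>

text \<open>The Cayley transform u = (w - 1) / (w + 1) turns the inversion w -> 1 / w into u -> - u,
  hence t = u^2. In these coordinates the curve becomes the Kummer equation: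
  \<open>\<delta> ^ q = - \<delta>\<close> and the Frobenius map give X^(q+1) = (u - u^q) / (2
  \<delta>), where u^q = u t^k.

  The obstacle is that the genus is a maximum over all divisors, while degrees and dimensions come
  from chosen bases, infinite ones counting as 0. All finiteness is drawn from one source, an upper
  bound for families independent over K[s], that is, for [F : K(s)]. It forces valuations to be
  discrete and residue degrees to be finite, and it yields deg (s)_0 <= [F : K(s)]. Zeros are
  controlled by this inequality; for the pole divisor of t equality is then read off from the growth
  of dim L(l (t)_inf).

  Integrality is tested at arbitrary places, without factoring h: that h is squarefree enters
  through an explicit Bezout identity between h and its derivative.\<close>

locale field_extension =
  fixes \<iota> :: "'k::field \<Rightarrow> 'f::field"
  assumes hom: "field_homomorphism \<iota>"
begin

lemma hom_1 [simp]: "\<iota> 1 = 1"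
  and hom_add: "\<iota> (u + v) = \<iota> u + \<iota> v"
  and hom_mult: "\<iota> (u * v) = \<iota> u * \<iota> v"
  using hom by (auto simp: field_homomorphism_def)

lemma hom_0 [simp]: "\<iota> 0 = 0"
  using hom_add[of 0 0] by (metis add_cancel_right_left add_0)

lemma hom_minus: "\<iota> (- u) = - \<iota> u"
  using hom_add[of u "- u"] by (simp add: eq_neg_iff_add_eq_0 add.commute)

lemma hom_diff: "\<iota> (u - v) = \<iota> u - \<iota> v"
  using hom_add[of u "- v"] by (simp add: hom_minus)

lemma hom_eq_0_iff [simp]: "\<iota> u = 0 \<longleftrightarrow> u = 0"
proof
  assume "\<iota> u = 0"
  show "u = 0"
  proof (rule ccontr)
    assume "u \<noteq> 0"
    then have "\<iota> 1 = \<iota> u * \<iota> (inverse u)" by (simp flip: hom_mult)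
    with \<open>\<iota> u = 0\<close> show False by simp
  qed
qed simp

lemma hom_inverse: "\<iota> (inverse u) = inverse (\<iota> u)"
proof (cases "u = 0")
  case False
  then have "\<iota> u * \<iota> (inverse u) = 1" by (simp flip: hom_mult)
  then show ?thesis by (metis inverse_unique)
qed simp

lemma hom_power: "\<iota> (u ^ k) = \<iota> u ^ k"
  by (induction k) (simp_all add: hom_mult)

lemma hom_of_nat: "\<iota> (of_nat k) = of_nat k"
  by (induction k) (simp_all add: hom_add)

lemma hom_sum: "\<iota> (sum g A) = (\<Sum>i\<in>A. \<iota> (g i))"
  by (induction A rule: infinite_finite_induct) (simp_all add: hom_add)

sublocale vs: vector_space "scale_via \<iota>"
  by unfold_locales (simp_all add: scale_via_def hom_add hom_mult algebra_simps)

lemma subspaceI: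
  assumes "0 \<in> V" "\<And>u v. u \<in> V \<Longrightarrow> v \<in> V \<Longrightarrow> u + v \<in> V" "\<And>k u. u \<in> V \<Longrightarrow> \<iota> k * u \<in> V"
  shows "vs.subspace V"
  using assms by (auto simp: vs.subspace_def scale_via_def)

lemma subspaceD:
  assumes "vs.subspace V"
  shows "0 \<in> V" "u \<in> V \<Longrightarrow> v \<in> V \<Longrightarrow> u + v \<in> V" "u \<in> V \<Longrightarrow> v \<in> V \<Longrightarrow> u - v \<in> V"
    "u \<in> V \<Longrightarrow> \<iota> k * u \<in> V" "u \<in> V \<Longrightarrow> - u \<in> V"
  using vs.subspace_0[OF assms] vs.subspace_add[OF assms] vs.subspace_diff[OF assms]
    vs.subspace_scale[OF assms] vs.subspace_neg[OF assms]
  by (auto simp: scale_via_def)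

lemma subspace_sum_scale:
  assumes "vs.subspace V" "\<And>i. i \<in> I \<Longrightarrow> f i \<in> V"
  shows "(\<Sum>i\<in>I. \<iota> (c i) * f i) \<in> V"
  by (rule vs.subspace_sum[OF assms(1)]) (auto intro: subspaceD(4)[OF assms(1)] assms(2))

text \<open>Indexed families are used so that products indexed by pairs can be counted directly;
  injectivity follows from independence. Over an infinite index set the sum is 0 by convention, so
  with \<open>0\<close> in \<open>W\<close> no nonempty infinite family is independent.\<close>

definition indep_mod :: "'f set \<Rightarrow> 'i set \<Rightarrow> ('i \<Rightarrow> 'f) \<Rightarrow> bool" where
  "indep_mod W I f \<longleftrightarrow> (\<forall>c. (\<Sum>i\<in>I. \<iota> (c i) * f i) \<in> W \<longrightarrow> (\<forall>i\<in>I. c i = 0))"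

lemma indep_modD: "indep_mod W I f \<Longrightarrow> (\<Sum>i\<in>I. \<iota> (c i) * f i) \<in> W \<Longrightarrow> i \<in> I \<Longrightarrow> c i = 0"
  by (auto simp: indep_mod_def)

lemma indep_mod_mono: "indep_mod W I f \<Longrightarrow> W' \<subseteq> W \<Longrightarrow> indep_mod W' I f"
  by (auto simp: indep_mod_def)

lemma indep_mod_0_independent:
  assumes "finite I" "indep_mod {0} I f"
  shows "inj_on f I" "vs.independent (f ` I)"
proof -
  show inj: "inj_on f I"
  proof (rule inj_onI, rule ccontr)
    fix i j assume ij: "i \<in> I" "j \<in> I" "f i = f j" "i \<noteq> j"
    define c where "c = (\<lambda>l. if l = i then 1 else if l = j then - 1 else 0 :: 'k)"
    have "(\<Sum>l\<in>I. \<iota> (c l) * f l) = (\<Sum>l\<in>{i, j}. \<iota> (c l) * f l)"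
      by (rule sum.mono_neutral_right) (use assms(1) ij in \<open>auto simp: c_def\<close>)
    also have "\<dots> = 0" using ij by (simp add: c_def hom_minus)
    finally show False using indep_modD[OF assms(2), of c i] ij by (simp add: c_def)
  qed
  have "\<forall>v\<in>f ` I. u v = 0" if "(\<Sum>v\<in>f ` I. scale_via \<iota> (u v) v) = 0" for u
  proof -
    have "(\<Sum>i\<in>I. \<iota> (u (f i)) * f i) = 0"
      using that by (simp add: sum.reindex[OF inj] scale_via_def)
    then show ?thesis using indep_modD[OF assms(2), of "\<lambda>i. u (f i)"] by auto
  qed
  then show "vs.independent (f ` I)" using vs.dependent_finite[of "f ` I"] assms(1) by auto
qed

lemma indep_mod_0_card_le:
  assumes "finite I" "indep_mod {0} I f" "f ` I \<subseteq> vs.span T" "finite T"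
  shows "card I \<le> card T"
  using vs.independent_span_bound[OF assms(4) indep_mod_0_independent(2)[OF assms(1,2)] assms(3)]
  by (simp add: card_image[OF indep_mod_0_independent(1)[OF assms(1,2)]])

text \<open>Shifting each member by an element of \<open>W\<close> moves it into the span of
  \<open>B\<close>. Independence modulo \<open>W\<close> becomes plain independence of the shifted
  family, and the exchange bound applies.\<close>

lemma indep_mod_card_le:
  assumes W: "vs.subspace W" and "finite B" and V: "\<And>v. v \<in> V \<Longrightarrow> \<exists>w\<in>W. v - w \<in> vs.span B"
    and "finite I" "f ` I \<subseteq> V" and ind: "indep_mod W I f"
  shows "card I \<le> card B"
proof -
  have "\<forall>i\<in>I. \<exists>w. w \<in> W \<and> f i - w \<in> vs.span B" using V assms(5) by blast
  then obtain w where w: "\<And>i. i \<in> I \<Longrightarrow> w i \<in> W" "\<And>i. i \<in> I \<Longrightarrow> f i - w i \<in> vs.span B"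
    by metis
  have "indep_mod {0} I (\<lambda>i. f i - w i)"
    unfolding indep_mod_def
  proof (intro allI impI)
    fix c assume "(\<Sum>i\<in>I. \<iota> (c i) * (f i - w i)) \<in> {0}"
    then have "(\<Sum>i\<in>I. \<iota> (c i) * f i) = (\<Sum>i\<in>I. \<iota> (c i) * w i)"
      by (simp add: algebra_simps sum_subtractf)
    also have "\<dots> \<in> W" by (intro subspace_sum_scale[OF W] w)
    finally show "\<forall>i\<in>I. c i = 0" using ind by (auto simp: indep_mod_def)
  qed
  with assms(4) have "card I \<le> card B"
    by (rule indep_mod_0_card_le) (use w assms(2) in auto)
  then show ?thesis .
qed

lemma basis_moduloI:
  assumes "B \<subseteq> V" "\<And>S. finite S \<Longrightarrow> S \<subseteq> B \<Longrightarrow> indep_mod W S id"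
    "\<And>v. v \<in> V \<Longrightarrow> \<exists>w\<in>W. v - w \<in> vs.span B"
  shows "basis_modulo (scale_via \<iota>) V W B"
  using assms unfolding basis_modulo_def indep_mod_def scale_via_def by auto

lemma basis_moduloD:
  assumes "basis_modulo (scale_via \<iota>) V W B"
  shows "B \<subseteq> V" "finite S \<Longrightarrow> S \<subseteq> B \<Longrightarrow> indep_mod W S id"
    "v \<in> V \<Longrightarrow> \<exists>w\<in>W. v - w \<in> vs.span B"
  using assms unfolding basis_modulo_def indep_mod_def scale_via_def by auto

lemma indep_mod_subset:
  assumes "indep_mod W I f" "J \<subseteq> I" "finite I"
  shows "indep_mod W J f"
  unfolding indep_mod_def
proof (intro allI impI)
  fix c assume c: "(\<Sum>i\<in>J. \<iota> (c i) * f i) \<in> W"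
  have "(\<Sum>i\<in>I. \<iota> ((if i \<in> J then c i else 0)) * f i) = (\<Sum>i\<in>J. \<iota> (c i) * f i)"
    by (rule sum.mono_neutral_cong_right) (use assms in auto)
  with c indep_modD[OF assms(1), of "\<lambda>i. if i \<in> J then c i else 0"] assms(2)
  show "\<forall>i\<in>J. c i = 0" by (metis subsetD)
qed

text \<open>\<open>quotient_dim\<close> counts a basis picked by choice, and an infinite one would
  count as 0. A uniform bound on independent finite sets yields a largest such set, which is a
  basis; the same bound makes the chosen basis finite.\<close>

lemma quotient_dim_basis:
  assumes V: "vs.subspace V" and W: "vs.subspace W"
    and bound: "\<And>S. finite S \<Longrightarrow> S \<subseteq> V \<Longrightarrow> indep_mod W S id \<Longrightarrow> card S \<le> N"
  obtains B where "finite B" "basis_modulo (scale_via \<iota>) V W B"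
    "card B = quotient_dim (scale_via \<iota>) V W" "card B \<le> N"
proof -
  define Q where "Q = (\<lambda>B. finite B \<and> B \<subseteq> V \<and> indep_mod W B id)"
  have "Q {}" by (auto simp: Q_def indep_mod_def)
  moreover have "\<forall>B. Q B \<longrightarrow> card B < Suc N" using bound by (force simp: Q_def)
  ultimately obtain B where B: "Q B" "\<And>B'. Q B' \<Longrightarrow> card B' \<le> card B"
    using ex_has_greatest_nat[of Q "{}" card "Suc N"] by auto
  have "basis_modulo (scale_via \<iota>) V W B"
  proof (rule basis_moduloI)
    show "B \<subseteq> V" using B(1) by (simp add: Q_def)
    show "indep_mod W S id" if "finite S" "S \<subseteq> B" for S
      using B(1) that by (auto simp: Q_def intro: indep_mod_subset)
    show "\<exists>w\<in>W. v - w \<in> vs.span B" if v: "v \<in> V" for v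
    proof (cases "v \<in> B")
      case True
      then show ?thesis
        using subspaceD(1)[OF W] by (intro bexI[of _ 0]) (auto intro: vs.span_base)
    next
      case False
      have "\<not> Q (insert v B)"
        using B(2)[of "insert v B"] B(1) False by (auto simp: Q_def)
      then obtain c where c: "(\<Sum>b\<in>insert v B. \<iota> (c b) * b) \<in> W" "\<exists>b\<in>insert v B. c b \<noteq> 0"
        using B(1) v by (auto simp: Q_def indep_mod_def)
      then have s: "\<iota> (c v) * v + (\<Sum>b\<in>B. \<iota> (c b) * b) \<in> W"
        using B(1) False by (simp add: Q_def)
      have "c v \<noteq> 0"
      proof
        assume "c v = 0"
        then have "(\<Sum>b\<in>B. \<iota> (c b) * b) \<in> W" using s by simp
        then have "\<forall>b\<in>B. c b = 0" using B(1) by (auto simp: Q_def indep_mod_def)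
        with c(2) \<open>c v = 0\<close> show False by auto
      qed
      \<comment> \<open>The relation forced by maximality is solved for \<open>v\<close>: dividing
        by the coefficient \<open>c v\<close> leaves \<open>v\<close> plus an element of the span of
        \<open>B\<close>.\<close>
      define w where "w = \<iota> (inverse (c v)) * (\<iota> (c v) * v + (\<Sum>b\<in>B. \<iota> (c b) * b))"
      have "w \<in> W" unfolding w_def by (rule subspaceD(4)[OF W s])
      have "v - w = - (\<Sum>b\<in>B. scale_via \<iota> (inverse (c v) * c b) b)"
        using \<open>c v \<noteq> 0\<close>
        by (simp add: w_def hom_inverse hom_mult scale_via_def distrib_left sum_distrib_left mult.assoc)
      moreover have "(\<Sum>b\<in>B. scale_via \<iota> (inverse (c v) * c b) b) \<in> vs.span B"
        by (intro vs.span_sum vs.span_scale vs.span_base)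
      ultimately have "v - w \<in> vs.span B"
        by (simp only: vs.span_neg)
      with \<open>w \<in> W\<close> show ?thesis by blast
    qed
  qed
  then have *: "basis_modulo (scale_via \<iota>) V W (SOME B. basis_modulo (scale_via \<iota>) V W B)" (is "basis_modulo _ _ _ ?B")
    by (rule someI)
  have fin: "finite ?B \<and> card ?B \<le> N"
    by (rule finite_if_finite_subsets_card_bdd)
      (use bound basis_moduloD(1,2)[OF *] in blast)
  show thesis
    by (rule that[of ?B]) (use * fin in \<open>auto simp: quotient_dim_def\<close>)
qed

definition fin_dim :: "'f set \<Rightarrow> bool" where
  "fin_dim V \<longleftrightarrow> (\<exists>B. finite B \<and> V \<subseteq> vs.span B)"

lemma fin_dim_basis:
  assumes "fin_dim V" "vs.subspace V" "C \<subseteq> V" "vs.independent C"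
  obtains B where "finite B" "C \<subseteq> B" "B \<subseteq> V" "vs.independent B" "V = vs.span B" "vs.dim V = card B"
proof -
  obtain B where B: "C \<subseteq> B" "B \<subseteq> V" "vs.independent B" "V \<subseteq> vs.span B"
    by (rule vs.maximal_independent_subset_extend[OF assms(3,4)])
  obtain T where T: "finite T" "V \<subseteq> vs.span T" using assms(1) by (auto simp: fin_dim_def)
  have "finite B" using vs.independent_span_bound[OF T(1) B(3)] B(2) T(2) by auto
  moreover have "vs.span B \<subseteq> V" by (rule vs.span_minimal[OF B(2) assms(2)])
  moreover have "vs.dim V = card B" using vs.basis_card_eq_dim[OF B(2,4,3)] by simp
  ultimately show thesis using B by (intro that[of B]) auto
qed

text \<open>Multiplication by \<open>s\<close> induces a linear map from \<open>V\<close> to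
  \<open>R / Q\<close> whose kernel lies in \<open>W\<close>, and \<open>B\<close> spans the target.
  It serves with \<open>s\<close> a power of a uniformizer for one-place steps of divisors, and with
  trivial \<open>W\<close> and \<open>Q\<close> for comparing two spaces.\<close>

lemma dim_le_add_quotient:
  assumes V: "fin_dim V" "vs.subspace V" and W: "vs.subspace W" "W \<subseteq> V"
    and Q: "vs.subspace Q" "finite B" "\<And>v. v \<in> R \<Longrightarrow> \<exists>w\<in>Q. v - w \<in> vs.span B"
    and s: "\<And>z. z \<in> V \<Longrightarrow> s * z \<in> R" "\<And>z. z \<in> V \<Longrightarrow> s * z \<in> Q \<Longrightarrow> z \<in> W"
  shows "vs.dim V \<le> vs.dim W + card B"
proof -
  have fW: "fin_dim W" using V(1) W(2) by (auto simp: fin_dim_def)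
  obtain C where C: "finite C" "{} \<subseteq> C" "C \<subseteq> W" "vs.independent C" "W = vs.span C" "vs.dim W = card C"
    by (rule fin_dim_basis[OF fW W(1) empty_subsetI vs.independent_empty])
  have "C \<subseteq> V" using C(3) W(2) by simp
  then obtain D where D: "finite D" "C \<subseteq> D" "D \<subseteq> V" "vs.independent D" "V = vs.span D" "vs.dim V = card D"
    by (rule fin_dim_basis[OF V _ C(4)])
  have "indep_mod Q (D - C) (\<lambda>z. s * z)"
    unfolding indep_mod_def
  proof (intro allI impI)
    fix c assume "(\<Sum>i\<in>D - C. \<iota> (c i) * (s * i)) \<in> Q"
    then have "s * (\<Sum>i\<in>D - C. \<iota> (c i) * i) \<in> Q"
      by (simp add: sum_distrib_left mult.left_commute)
    moreover have "(\<Sum>i\<in>D - C. \<iota> (c i) * i) \<in> V"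
      by (rule subspace_sum_scale[OF V(2)]) (use D in auto)
    ultimately have "(\<Sum>i\<in>D - C. \<iota> (c i) * i) \<in> vs.span C" using s C(5) by metis
    then obtain e where e: "(\<Sum>i\<in>D - C. \<iota> (c i) * i) = (\<Sum>i\<in>C. scale_via \<iota> (e i) i)"
      using vs.span_finite[OF C(1)] by auto
    define h where "h = (\<lambda>i. if i \<in> C then - e i else c i)"
    have "(\<Sum>i\<in>D. scale_via \<iota> (h i) i) = (\<Sum>i\<in>D - C. scale_via \<iota> (h i) i) + (\<Sum>i\<in>C. scale_via \<iota> (h i) i)"
      using D C by (intro sum.subset_diff) auto
    also have "\<dots> = 0" using e by (simp add: h_def scale_via_def hom_minus sum_negf)
    finally have "\<forall>i\<in>D. h i = 0" using D(4) vs.dependent_finite[OF D(1)] by blast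
    then show "\<forall>i\<in>D - C. c i = 0" by (auto simp: h_def)
  qed
  then have "card (D - C) \<le> card B"
    by (rule indep_mod_card_le[OF Q(1,2) Q(3), rotated -1]) (use D s in auto)
  then show ?thesis using C D by (simp add: card_Diff_subset)
qed


section \<open>Polynomials over the ground field\<close>

definition ev :: "'k poly \<Rightarrow> 'f \<Rightarrow> 'f" where
  "ev p z = poly (map_poly \<iota> p) z"

lemma ev_0 [simp]: "ev 0 z = 0"
  by (simp add: ev_def)

lemma ev_pCons [simp]: "ev (pCons a p) z = \<iota> a + z * ev p z"
  by (simp add: ev_def map_poly_pCons)

lemma ev_1 [simp]: "ev 1 z = 1"
  by (simp add: one_pCons)

lemma ev_add: "ev (p + r) z = ev p z + ev r z"
  by (induction p r rule: poly_induct2) (simp_all add: hom_add algebra_simps)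

lemma ev_smult: "ev (Polynomial.smult a p) z = \<iota> a * ev p z"
  by (induction p) (simp_all add: hom_mult algebra_simps)

lemma ev_mult: "ev (p * r) z = ev p z * ev r z"
  by (induction p) (simp_all add: ev_add ev_smult algebra_simps)

lemma ev_minus: "ev (- p) z = - ev p z"
  using ev_smult[of "- 1" p z] by (simp add: hom_minus)

lemma ev_diff: "ev (p - r) z = ev p z - ev r z"
  using ev_add[of p "- r" z] by (simp add: ev_minus)

lemma ev_sum: "ev (sum g A) z = (\<Sum>i\<in>A. ev (g i) z)"
  by (induction A rule: infinite_finite_induct) (simp_all add: ev_add)

lemma ev_power: "ev (p ^ k) z = ev p z ^ k"
  by (induction k) (simp_all add: ev_mult)

lemma ev_monom: "ev (monom a k) z = \<iota> a * z ^ k"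
  by (induction k) (simp_all add: monom_0 monom_Suc)

lemma ev_altdef: "degree p \<le> k \<Longrightarrow> ev p z = (\<Sum>i\<le>k. \<iota> (coeff p i) * z ^ i)"
proof -
  assume "degree p \<le> k"
  then have "ev p z = ev (\<Sum>i\<le>k. monom (coeff p i) i) z"
    by (metis poly_as_sum_of_monoms')
  then show ?thesis by (simp add: ev_sum ev_monom)
qed

lemma transcendental_iff: "transcendental_via \<iota> z \<longleftrightarrow> (\<forall>p. ev p z = 0 \<longrightarrow> p = 0)"
  by (auto simp: transcendental_via_def ev_def)

text \<open>For transcendental \<open>s\<close> this is linear independence over K(s) with
  denominators cleared, so that the rational function field itself never has to be formed.\<close>

definition poly_indep :: "'f \<Rightarrow> 'i set \<Rightarrow> ('i \<Rightarrow> 'f) \<Rightarrow> bool" where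
  "poly_indep s I f \<longleftrightarrow> (\<forall>p. (\<Sum>i\<in>I. ev (p i) s * f i) = 0 \<longrightarrow> (\<forall>i\<in>I. p i = 0))"

definition frac_span :: "'f \<Rightarrow> nat \<Rightarrow> (nat \<Rightarrow> 'f) \<Rightarrow> 'f set" where
  "frac_span t n b = {z. \<exists>D c. D \<noteq> 0 \<and> ev D t * z = (\<Sum>j<n. ev (c j) t * b j)}"

lemma frac_span_common_denominator:
  assumes "finite I" "f ` I \<subseteq> frac_span t n b"
  obtains D c where "D \<noteq> 0" "\<And>i. i \<in> I \<Longrightarrow> ev D t * f i = (\<Sum>j<n. ev (c i j) t * b j)"
  using assms
proof (induction I arbitrary: thesis)
  case empty
  show thesis by (rule empty(1)[of 1]) auto
next
  case (insert a I)
  obtain D c where D: "D \<noteq> 0" "\<And>i. i \<in> I \<Longrightarrow> ev D t * f i = (\<Sum>j<n. ev (c i j) t * b j)"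
    using insert by auto
  obtain E e where E: "E \<noteq> 0" "ev E t * f a = (\<Sum>j<n. ev (e j) t * b j)"
    using insert(5) by (auto simp: frac_span_def)
  show thesis
  proof (rule insert(4)[of "D * E" "\<lambda>i j. if i = a then D * e j else E * c i j"])
    show "D * E \<noteq> 0" using D E by simp
    fix i assume i: "i \<in> insert a I"
    show "ev (D * E) t * f i = (\<Sum>j<n. ev (if i = a then D * e j else E * c i j) t * b j)"
    proof (cases "i = a")
      case True
      then have "ev (D * E) t * f i = ev D t * (ev E t * f a)" by (simp add: ev_mult)
      then show ?thesis using True E by (simp add: ev_mult sum_distrib_left mult.assoc)
    next
      case False
      then have "ev (D * E) t * f i = ev E t * (ev D t * f i)" by (simp add: ev_mult mult_ac)
      also have "\<dots> = ev E t * (\<Sum>j<n. ev (c i j) t * b j)" using False D(2) i by simp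
      finally show ?thesis using False by (simp add: ev_mult sum_distrib_left mult.assoc)
    qed
  qed
qed

text \<open>
  For \<open>s\<close> of degree \<open>d\<close> in \<open>t\<close>, the products of the powers \<open>s\<^sup>k\<close>, \<open>k < L\<close>, with a family that
  is independent over \<open>K[s]\<close> are independent over \<open>K\<close>; after clearing denominators they lie in a
  space of dimension at most \<open>n d L + O(1)\<close>. Hence \<open>[F : K(s)] \<le> n d\<close>. The factor \<open>e\<close> clears the
  denominator of \<open>s\<close>.
\<close>

lemma poly_indep_card_le:
  assumes t: "transcendental_via \<iota> t" and I: "finite I" "f ` I \<subseteq> frac_span t n b"
    and ind: "poly_indep s I f"
    and e: "e \<noteq> 0" "\<And>L k. k < L \<Longrightarrow> \<exists>g. degree g \<le> L * d \<and> e ^ L * s ^ k = ev g t"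
  shows "card I \<le> n * d"
proof (rule ccontr)
  assume "\<not> card I \<le> n * d"
  then have big: "n * d + 1 \<le> card I" by simp
  obtain D c where D: "D \<noteq> 0" "\<And>i. i \<in> I \<Longrightarrow> ev D t * f i = (\<Sum>j<n. ev (c i j) t * b j)"
    using frac_span_common_denominator[OF I] by metis
  have Dt: "ev D t \<noteq> 0" using t D(1) by (auto simp: transcendental_iff)
  define M where "M = Max (insert 0 ((\<lambda>(i, j). degree (c i j)) ` (I \<times> {..<n})))"
  have M: "degree (c i j) \<le> M" if "i \<in> I" "j < n" for i j
    unfolding M_def by (rule Max_ge) (use I that in \<open>auto intro!: image_eqI[of _ _ "(i, j)"]\<close>)
  \<comment> \<open>In the final count the terms \<open>L * (n * d)\<close> cancel and
    \<open>L \<le> n * (M + 1)\<close> would remain; this is the first value violating it.\<close>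
  define L where "L = n * (M + 1) + 1"
  define T where "T = (\<lambda>(i, j). t ^ i * b j) ` ({..<M + L * d + 1} \<times> {..<n})"
  define h where "h = (\<lambda>(k, i). e ^ L * s ^ k * (ev D t * f i))"
  have T: "ev g t * b j \<in> vs.span T" if "degree g \<le> M + L * d" "j < n" for g j
  proof -
    have "ev g t * b j = (\<Sum>i\<le>M + L * d. scale_via \<iota> (coeff g i) (t ^ i * b j))"
      by (simp add: ev_altdef[OF that(1)] sum_distrib_left sum_distrib_right scale_via_def mult_ac)
    also have "\<dots> \<in> vs.span T"
      by (intro vs.span_sum vs.span_scale vs.span_base)
        (use that in \<open>auto simp: T_def intro!: image_eqI[of _ _ "(_, j)"]\<close>)
    finally show ?thesis .
  qed
  have "card ({..<L} \<times> I) \<le> card T"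
  proof (rule indep_mod_0_card_le)
    show "finite ({..<L} \<times> I)" using I by simp
    show "finite T" by (simp add: T_def)
    show "h ` ({..<L} \<times> I) \<subseteq> vs.span T"
    proof (rule image_subsetI)
      fix x assume "x \<in> {..<L} \<times> I"
      then obtain k i where x: "x = (k, i)" and k: "k \<in> {..<L}" and i: "i \<in> I" by auto
      from e(2)[of k L] k obtain g where g: "degree g \<le> L * d" "e ^ L * s ^ k = ev g t"
        by auto
      have "h (k, i) = (\<Sum>j<n. ev (g * c i j) t * b j)"
        unfolding h_def prod.case g(2) D(2)[OF i] by (simp add: ev_mult sum_distrib_left mult.assoc)
      also have "\<dots> \<in> vs.span T"
      proof (intro vs.span_sum T)
        fix j assume "j \<in> {..<n}"
        then show "degree (g * c i j) \<le> M + L * d"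
          using degree_mult_le[of g "c i j"] g(1) M[OF i, of j] by simp
      qed auto
      finally show "h x \<in> vs.span T" using x by simp
    qed
    show "indep_mod {0} ({..<L} \<times> I) h"
      unfolding indep_mod_def
    proof (intro allI impI)
      fix a assume "(\<Sum>x\<in>{..<L} \<times> I. \<iota> (a x) * h x) \<in> {0}"
      then have 0: "(\<Sum>x\<in>{..<L} \<times> I. \<iota> (a x) * h x) = 0" by simp
      define p where "p = (\<lambda>i. \<Sum>k<L. monom (a (k, i)) k)"
      have "(\<Sum>x\<in>{..<L} \<times> I. \<iota> (a x) * h x) = (\<Sum>i\<in>I. \<Sum>k<L. \<iota> (a (k, i)) * h (k, i))"
        by (simp add: sum.cartesian_product' sum.swap[of _ "{..<L}"])
      also have "\<dots> = (\<Sum>i\<in>I. (e ^ L * ev D t) * (ev (p i) s * f i))"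
      proof (rule sum.cong)
        fix i assume "i \<in> I"
        show "(\<Sum>k<L. \<iota> (a (k, i)) * h (k, i)) = (e ^ L * ev D t) * (ev (p i) s * f i)"
          unfolding p_def ev_sum ev_monom h_def
          by (simp add: sum_distrib_left sum_distrib_right mult_ac)
      qed simp
      also have "\<dots> = (e ^ L * ev D t) * (\<Sum>i\<in>I. ev (p i) s * f i)"
        by (simp add: sum_distrib_left)
      finally have "(\<Sum>i\<in>I. ev (p i) s * f i) = 0" using 0 Dt e(1) by simp
      then have p0: "\<forall>i\<in>I. p i = 0" using ind by (auto simp: poly_indep_def)
      have "coeff (p i) k = a (k, i)" if "k < L" for i k
        using that by (simp add: p_def coeff_sum)
      note this[symmetric]
      with p0 show "\<forall>x\<in>{..<L} \<times> I. a x = 0" by auto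
    qed
  qed
  also have "card T \<le> (M + L * d + 1) * n"
    unfolding T_def by (rule card_image_le[THEN order_trans]) auto
  finally have "L * card I \<le> (M + L * d + 1) * n" by (simp add: card_cartesian_product)
  moreover have "L * (n * d + 1) \<le> L * card I" using big by (rule mult_le_mono2)
  ultimately have "L * (n * d + 1) \<le> (M + L * d + 1) * n" by linarith
  then have "L * (n * d) + L \<le> n * (M + 1) + L * (n * d)" by (simp add: algebra_simps)
  then show False by (simp add: L_def)
qed

end

lemma poly_bezout:
  fixes p r :: "'k::field poly"
  assumes "r \<noteq> 0"
  obtains g u v where "g = u * p + v * r" "g dvd p" "g dvd r" "g \<noteq> 0"
proof -
  have "\<exists>g u v. g = u * p + v * r \<and> g dvd p \<and> g dvd r \<and> g \<noteq> 0" using assms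
  proof (induction "degree r" arbitrary: p r rule: less_induct)
    case less
    show ?case
    proof (cases "p mod r = 0")
      case True
      then show ?thesis using less(2) by (intro exI[of _ r] exI[of _ 0] exI[of _ 1]) auto
    next
      case False
      then have "degree (p mod r) < degree r" using degree_mod_less'[OF less(2)] by simp
      from less(1)[OF this False, of r] obtain g u v
        where g: "g = u * r + v * (p mod r)" "g dvd r" "g dvd p mod r" "g \<noteq> 0" by blast
      have "g dvd p" using g by (metis dvd_mod_iff)
      moreover have "g = v * p + (u - v * (p div r)) * r"
      proof -
        have "v * p = v * (p div r) * r + v * (p mod r)"
          by (metis div_mult_mod_eq distrib_left mult.assoc)
        then show ?thesis by (simp add: g(1) left_diff_distrib)
      qed
      ultimately show ?thesis using g by blast
    qed
  qed
  then show thesis using that by blast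
qed

section \<open>Places and their valuations\<close>

lemma poly_split_power:
  fixes p :: "'k::field poly"
  assumes "p \<noteq> 0"
  obtains l g where "p = monom 1 l * g" "coeff g 0 \<noteq> 0"
proof -
  have "\<exists>l g. p = monom 1 l * g \<and> coeff g 0 \<noteq> 0" using assms
  proof (induction p)
    case (pCons a p)
    show ?case
    proof (cases "a = 0")
      case True
      then obtain l g where "p = monom 1 l * g" "coeff g 0 \<noteq> 0" using pCons by auto
      then have "pCons a p = monom 1 (Suc l) * g" using True by (simp add: monom_Suc)
      with \<open>coeff g 0 \<noteq> 0\<close> show ?thesis by blast
    next
      case False
      then show ?thesis by (intro exI[of _ 0] exI[of _ "pCons a p"]) simp
    qed
  qed simp
  then show thesis using that by blast
qed

text \<open>Cancelling the lowest power of \<open>z\<close> that occurs shows that its coefficient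
  is a multiple of \<open>z\<close>. The predicate \<open>A\<close> marks coefficients that are
  nonzero as polynomials, before evaluation.\<close>

lemma lowest_term_relation:
  fixes z :: "'f::field"
  assumes "z \<noteq> 0" and 0: "(\<Sum>i\<le>N. c i * z ^ i) = 0"
    and "\<exists>i\<le>N. A i" "\<And>i. \<not> A i \<Longrightarrow> c i = 0"
  obtains j where "j \<le> N" "A j" "c j = z * (- (\<Sum>i\<in>{Suc j..N}. c i * z ^ (i - Suc j)))"
proof -
  obtain i1 where i1: "i1 \<le> N \<and> A i1" using assms(3) by blast
  define j where "j = (LEAST i. i \<le> N \<and> A i)"
  have j: "j \<le> N" "A j"
    using LeastI[of "\<lambda>i. i \<le> N \<and> A i", OF i1] by (auto simp: j_def)
  have lj: "c i = 0" if "i < j" for i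
    using not_less_Least[of i "\<lambda>i. i \<le> N \<and> A i"] that j(1) assms(4) unfolding j_def[symmetric] by auto
  have "(\<Sum>i\<le>N. c i * z ^ i) = (\<Sum>i\<in>{j..N}. c i * z ^ i)"
    by (rule sum.mono_neutral_right) (use lj in auto)
  also have "\<dots> = c j * z ^ j + (\<Sum>i\<in>{Suc j..N}. c i * z ^ i)"
    using j(1) by (simp add: sum.atLeast_Suc_atMost)
  also have "(\<Sum>i\<in>{Suc j..N}. c i * z ^ i) = z ^ j * (z * (\<Sum>i\<in>{Suc j..N}. c i * z ^ (i - Suc j)))"
  proof -
    have "z ^ i = z ^ j * (z * z ^ (i - Suc j))" if "i \<in> {Suc j..N}" for i
      using that by (simp flip: power_Suc power_add)
    then show ?thesis unfolding sum_distrib_left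
      by (intro sum.cong) (auto simp: mult_ac)
  qed
  finally have "z ^ j * (c j + z * (\<Sum>i\<in>{Suc j..N}. c i * z ^ (i - Suc j))) = 0"
    using 0 by (simp add: algebra_simps)
  then have "c j + z * (\<Sum>i\<in>{Suc j..N}. c i * z ^ (i - Suc j)) = 0"
    using \<open>z \<noteq> 0\<close> by simp
  then show thesis using j by (intro that) (auto simp: eq_neg_iff_add_eq_0)
qed

context field_extension
begin

text \<open>Modulo \<open>s\<close>, a polynomial relation is a relation between constant
  coefficients, which must vanish; dividing by \<open>s\<close> lowers the degree. Thus every bound
  on [F : K(s)] limits residue degrees, divisibility chains and zeros of \<open>s\<close>.\<close>

lemma poly_indep_if_indep_mod:
  assumes "s \<noteq> 0" "0 \<in> A" "\<And>u v. u \<in> A \<Longrightarrow> v \<in> A \<Longrightarrow> u + v \<in> A"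
    "\<And>p u. u \<in> A \<Longrightarrow> ev p s * u \<in> A" "f ` I \<subseteq> A" "indep_mod ((*) s ` A) I f"
  shows "poly_indep s I f"
proof -
  have A_sum: "(\<Sum>i\<in>J. g i) \<in> A" if "\<And>i. i \<in> J \<Longrightarrow> g i \<in> A" for g and J :: "'b set"
    using that by (induction J rule: infinite_finite_induct) (auto intro: assms(2,3))
  have "(\<Sum>i\<in>I. ev (p i) s * f i) = 0 \<Longrightarrow> (\<And>i. i \<in> I \<Longrightarrow> p i = 0 \<or> degree (p i) < d) \<Longrightarrow>
      \<forall>i\<in>I. p i = 0" for p d
  proof (induction d arbitrary: p)
    case (Suc d)
    define a where "a = (\<lambda>i. coeff (p i) 0)"
    define r where "r = (\<lambda>i. poly_shift 1 (p i))"
    have p: "p i = pCons (a i) (r i)" for i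
      by (rule poly_eqI) (simp add: a_def r_def coeff_pCons coeff_poly_shift split: nat.split)
    have 0: "(\<Sum>i\<in>I. \<iota> (a i) * f i) + s * (\<Sum>i\<in>I. ev (r i) s * f i) = 0"
      using Suc.prems(1) unfolding p
      by (simp add: algebra_simps sum.distrib sum_distrib_left)
    have "(\<Sum>i\<in>I. \<iota> (a i) * f i) = s * (\<Sum>i\<in>I. ev (- r i) s * f i)"
      using 0 by (simp add: ev_minus sum_negf eq_neg_iff_add_eq_0)
    also have "\<dots> \<in> (*) s ` A"
      using assms(4,5) by (intro imageI A_sum) auto
    finally have a: "\<forall>i\<in>I. a i = 0" using assms(6) by (auto simp: indep_mod_def)
    have "(\<Sum>i\<in>I. ev (r i) s * f i) = 0" using 0 a assms(1) by simp
    moreover have "r i = 0 \<or> degree (r i) < d" if "i \<in> I" for i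
      using Suc.prems(2)[OF that] unfolding p by (auto split: if_splits)
    ultimately have "\<forall>i\<in>I. r i = 0" by (rule Suc.IH)
    with a show ?case by (simp add: p)
  qed simp
  moreover have "\<exists>d. \<forall>i\<in>I. p i = 0 \<or> degree (p i) < d" if "finite I" for p :: "_ \<Rightarrow> 'k poly"
    using that by (intro exI[of _ "Suc (Max ((\<lambda>i. degree (p i)) ` I))"])
      (auto simp: less_Suc_eq_le)
  \<comment> \<open>A uniform degree bound needs a finite index set. An infinite one is impossible
    because its sum is 0, which lies in the multiples of \<open>s\<close>.\<close>
  moreover have "finite I \<or> I = {}"
  proof (rule ccontr)
    assume inf: "\<not> (finite I \<or> I = {})"
    then obtain i where "i \<in> I" by auto
    moreover have "0 \<in> (*) s ` A" using assms(2) by (auto intro: image_eqI[of _ _ 0])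
    ultimately show False using indep_modD[OF assms(6), of "\<lambda>_. 1" i] inf by simp
  qed
  ultimately show ?thesis unfolding poly_indep_def by (metis empty_iff)
qed

end

section \<open>Valuation rings and places of an intermediate field\<close>

locale field_between = field_extension +
  fixes F
  assumes F: "intermediate_field \<iota> F"
begin

lemma F_hom [simp]: "\<iota> k \<in> F"
  and F_diff: "u \<in> F \<Longrightarrow> v \<in> F \<Longrightarrow> u - v \<in> F"
  and F_mult: "u \<in> F \<Longrightarrow> v \<in> F \<Longrightarrow> u * v \<in> F"
  and F_inverse: "u \<in> F \<Longrightarrow> inverse u \<in> F"
  using F by (auto simp: intermediate_field_def)

lemma F_0 [simp]: "0 \<in> F" and F_1 [simp]: "1 \<in> F"
  using F_hom[of 0] F_hom[of 1] by simp_all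

lemma F_minus: "u \<in> F \<Longrightarrow> - u \<in> F"
  using F_diff[of 0 u] by simp

lemma F_add: "u \<in> F \<Longrightarrow> v \<in> F \<Longrightarrow> u + v \<in> F"
  using F_diff[of u "- v"] F_minus by simp

lemma F_divide: "u \<in> F \<Longrightarrow> v \<in> F \<Longrightarrow> u / v \<in> F"
  by (simp add: divide_inverse F_mult F_inverse)

lemma F_power: "u \<in> F \<Longrightarrow> u ^ k \<in> F"
  by (induction k) (simp_all add: F_mult)

lemma F_powi: "u \<in> F \<Longrightarrow> u powi k \<in> F"
  by (simp add: power_int_def F_power F_inverse)

lemma F_sum: "(\<And>i. i \<in> I \<Longrightarrow> f i \<in> F) \<Longrightarrow> sum f I \<in> F"
  by (induction I rule: infinite_finite_induct) (simp_all add: F_add)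

lemma F_ev: "u \<in> F \<Longrightarrow> ev p u \<in> F"
  by (induction p) (simp_all add: F_add F_mult)

abbreviation \<O> :: "'b set \<Rightarrow> 'b set" where "\<O> \<equiv> place_ring F"

abbreviation \<P> :: "'b set set" where "\<P> \<equiv> places \<iota> F"

abbreviation pdeg :: "'b set \<Rightarrow> nat" where "pdeg \<equiv> place_degree \<iota> F"

text \<open>For transcendental \<open>s\<close> this expresses [F : K(s)] \<le> N. A definition
  cannot quantify over index types, so they are fixed to \<open>nat\<close>;
  \<open>degree_boundD\<close> transfers the bound to any type.\<close>

definition degree_bound :: "'b \<Rightarrow> nat \<Rightarrow> bool" where
  "degree_bound s N \<longleftrightarrow>
     (\<forall>(I :: nat set) f. finite I \<longrightarrow> f ` I \<subseteq> F \<longrightarrow> poly_indep s I f \<longrightarrow> card I \<le> N)"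

lemma degree_boundD:
  fixes I :: "'i set"
  assumes "degree_bound s N" "finite I" "f ` I \<subseteq> F" "poly_indep s I f"
  shows "card I \<le> N"
proof -
  obtain h where h: "bij_betw h {0..<card I} I" using ex_bij_betw_nat_finite[OF assms(2)] by blast
  have "poly_indep s {0..<card I} (f \<circ> h)"
    unfolding poly_indep_def
  proof (intro allI impI ballI)
    fix p :: "nat \<Rightarrow> 'a poly" and i
    assume 0: "(\<Sum>i\<in>{0..<card I}. ev (p i) s * (f \<circ> h) i) = 0" and i: "i \<in> {0..<card I}"
    define g where "g = the_inv_into {0..<card I} h"
    have g: "g (h j) = j" if "j \<in> {0..<card I}" for j
      using h that by (simp add: g_def the_inv_into_f_f bij_betw_def)
    have "(\<Sum>i\<in>I. ev (p (g i)) s * f i) = (\<Sum>i\<in>{0..<card I}. ev (p (g (h i))) s * f (h i))"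
      by (rule sum.reindex_bij_betw[OF h, symmetric])
    also have "\<dots> = 0" using 0 g by simp
    finally have "\<forall>i\<in>I. p (g i) = 0"
      using assms(4)[unfolded poly_indep_def, rule_format, of "\<lambda>i. p (g i)"] by blast
    then show "p i = 0" using g[OF i] h i by (metis bij_betwE)
  qed
  moreover have "(f \<circ> h) ` {0..<card I} \<subseteq> F"
    using h assms(3) by (auto simp: bij_betw_def)
  ultimately show ?thesis using assms(1) unfolding degree_bound_def
    by (metis card_atLeastLessThan diff_zero finite_atLeastLessThan)
qed

lemma places_iff:
  "P \<in> \<P> \<longleftrightarrow> (\<exists>R. valuation_ring \<iota> F R \<and> P = {u\<in>R. u = 0 \<or> inverse u \<notin> R})"
  by (auto simp: places_def)

lemma place_ring_nonunits:
  assumes "valuation_ring \<iota> F R"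
  shows "\<O> {u\<in>R. u = 0 \<or> inverse u \<notin> R} = R"
  using assms unfolding place_ring_def valuation_ring_def
  by (auto split: if_splits)

context
  fixes P
  assumes P: "P \<in> \<P>"
begin

lemma valuation_ring_place_ring: "valuation_ring \<iota> F (\<O> P)"
  and place_eq: "P = {u\<in>\<O> P. u = 0 \<or> inverse u \<notin> \<O> P}"
  using P place_ring_nonunits by (auto simp: places_iff)

lemma R_hom: "\<iota> k \<in> \<O> P"
  and R_F: "u \<in> \<O> P \<Longrightarrow> u \<in> F"
  and R_diff: "u \<in> \<O> P \<Longrightarrow> v \<in> \<O> P \<Longrightarrow> u - v \<in> \<O> P"
  and R_mult: "u \<in> \<O> P \<Longrightarrow> v \<in> \<O> P \<Longrightarrow> u * v \<in> \<O> P"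
  and R_cases: "z \<in> F \<Longrightarrow> z \<in> \<O> P \<or> inverse z \<in> \<O> P"
  and R_neq: "\<O> P \<noteq> F"
  using valuation_ring_place_ring by (auto simp: valuation_ring_def)

lemma R_0: "0 \<in> \<O> P" and R_1: "1 \<in> \<O> P"
  using R_hom[of 0] R_hom[of 1] by simp_all

lemma R_minus: "u \<in> \<O> P \<Longrightarrow> - u \<in> \<O> P"
  using R_diff[of 0 u] R_0 by simp

lemma R_add: "u \<in> \<O> P \<Longrightarrow> v \<in> \<O> P \<Longrightarrow> u + v \<in> \<O> P"
  using R_diff[of u "- v"] R_minus by simp

lemma R_power: "u \<in> \<O> P \<Longrightarrow> u ^ k \<in> \<O> P"
  by (induction k) (simp_all add: R_mult R_1)

lemma R_sum: "(\<And>i. i \<in> I \<Longrightarrow> f i \<in> \<O> P) \<Longrightarrow> sum f I \<in> \<O> P"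
  by (induction I rule: infinite_finite_induct) (simp_all add: R_add R_0)

lemma R_ev: "u \<in> \<O> P \<Longrightarrow> ev p u \<in> \<O> P"
  by (induction p) (simp_all add: R_add R_mult R_0 R_hom)

lemma P_iff: "u \<in> P \<longleftrightarrow> u \<in> \<O> P \<and> (u = 0 \<or> inverse u \<notin> \<O> P)"
  using place_eq by blast

lemma P_0: "0 \<in> P" and P_not_1: "1 \<notin> P" and P_R: "u \<in> P \<Longrightarrow> u \<in> \<O> P"
  by (auto simp: P_iff R_0 R_1)

lemma P_if_not_R: "z \<in> F \<Longrightarrow> z \<notin> \<O> P \<Longrightarrow> inverse z \<in> P"
  using R_cases[of z] R_0 by (auto simp: P_iff)

lemma P_mult: "u \<in> \<O> P \<Longrightarrow> v \<in> P \<Longrightarrow> u * v \<in> P"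
proof -
  assume u: "u \<in> \<O> P" and v: "v \<in> P"
  show ?thesis
  proof (rule ccontr)
    assume *: "u * v \<notin> P"
    then have "u * v \<noteq> 0" "inverse (u * v) \<in> \<O> P"
      using u v by (auto simp: P_iff R_mult)
    then have "u * inverse (u * v) \<in> \<O> P" "v \<noteq> 0" "u \<noteq> 0" using u by (auto simp: R_mult)
    then show False using v by (simp add: P_iff field_simps)
  qed
qed

lemma P_mult': "u \<in> P \<Longrightarrow> v \<in> \<O> P \<Longrightarrow> u * v \<in> P"
  using P_mult[of v u] by (simp add: mult.commute)

lemma P_add_aux: "u \<in> P \<Longrightarrow> v \<in> P \<Longrightarrow> v \<noteq> 0 \<Longrightarrow> u / v \<in> \<O> P \<Longrightarrow> u + v \<in> P"
  using P_mult[of "u / v + 1" v] R_add R_1 by (simp add: distrib_right)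

lemma P_add: "u \<in> P \<Longrightarrow> v \<in> P \<Longrightarrow> u + v \<in> P"
proof (cases "u = 0 \<or> v = 0")
  case False
  assume uv: "u \<in> P" "v \<in> P"
  then have "u / v \<in> \<O> P \<or> v / u \<in> \<O> P"
    using R_cases[of "u / v"] by (auto simp: R_F P_R F_divide)
  then show ?thesis using uv False P_add_aux[of u v] P_add_aux[of v u] by (auto simp: add.commute)
qed auto

lemma P_minus: "u \<in> P \<Longrightarrow> - u \<in> P"
  using P_mult[of "- 1" u] R_minus R_1 by simp

lemma P_sum: "(\<And>i. i \<in> I \<Longrightarrow> f i \<in> P) \<Longrightarrow> sum f I \<in> P"
  by (induction I rule: infinite_finite_induct) (simp_all add: P_add P_0)

lemma R_subspace: "vs.subspace (\<O> P)"
  by (rule subspaceI) (simp_all add: R_add R_mult R_0 R_hom)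

lemma P_subspace: "vs.subspace P"
  by (rule subspaceI) (simp_all add: P_add P_0 P_mult R_hom)

lemma unit_plus_P: "k \<noteq> 0 \<Longrightarrow> u \<in> P \<Longrightarrow> \<iota> k + u \<in> \<O> P - P"
proof -
  assume "k \<noteq> 0" "u \<in> P"
  have "\<iota> k + u \<notin> P"
  proof
    assume "\<iota> k + u \<in> P"
    then have "(\<iota> k + u) + - u \<in> P" using P_add P_minus \<open>u \<in> P\<close> by blast
    then have "\<iota> k \<in> P" by simp
    then show False using \<open>k \<noteq> 0\<close> R_hom[of "inverse k"] by (simp add: P_iff hom_inverse)
  qed
  then show ?thesis using R_add R_hom P_R[OF \<open>u \<in> P\<close>] by blast
qed

lemma unit_inverse: "u \<in> \<O> P - P \<Longrightarrow> inverse u \<in> \<O> P - P" "u \<in> \<O> P - P \<Longrightarrow> u \<noteq> 0"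
  by (auto simp: P_iff R_0)

lemma unit_mult: "u \<in> \<O> P - P \<Longrightarrow> v \<in> \<O> P - P \<Longrightarrow> u * v \<in> \<O> P - P"
proof -
  assume u: "u \<in> \<O> P - P" and v: "v \<in> \<O> P - P"
  have "u * v \<notin> P"
  proof
    assume "u * v \<in> P"
    then have "inverse u * (u * v) \<in> P" using P_mult unit_inverse(1)[OF u] by blast
    then show False using u v unit_inverse(2)[OF u] by (simp flip: mult.assoc)
  qed
  then show ?thesis using u v R_mult by blast
qed

lemma unit_1: "1 \<in> \<O> P - P"
  using R_1 P_not_1 by simp

lemma unit_power: "u \<in> \<O> P - P \<Longrightarrow> u ^ k \<in> \<O> P - P"
  by (induction k) (simp_all only: power_0 power_Suc unit_1 unit_mult)

lemma unit_powi: "u \<in> \<O> P - P \<Longrightarrow> u powi k \<in> \<O> P - P"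
  using unit_power[of u] unit_power[of "inverse u"] unit_inverse by (simp add: power_int_def)

text \<open>In a nontrivial combination the member of largest index with nonzero coefficient divides
  the others properly; factoring it out leaves a unit. If the combination were a multiple of
  \<open>s\<close>, so would be this member. Chains of divisors not divisible by \<open>s\<close>
  are therefore independent over K(s), which is the source of discreteness.\<close>

lemma chain_card_le:
  assumes s: "s \<in> P" "s \<noteq> 0" "degree_bound s N"
    and x: "\<And>i. i < r \<Longrightarrow> x i \<in> \<O> P" "\<And>i. i < r \<Longrightarrow> x i \<notin> (*) s ` \<O> P"
      "\<And>i j. i < j \<Longrightarrow> j < r \<Longrightarrow> \<exists>p\<in>P. x i = x j * p"
  shows "r \<le> N"
proof -
  have "indep_mod ((*) s ` \<O> P) {..<r} x"
    unfolding indep_mod_def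
  proof (intro allI impI, rule ccontr)
    fix c assume c: "(\<Sum>i<r. \<iota> (c i) * x i) \<in> (*) s ` \<O> P" "\<not> (\<forall>i\<in>{..<r}. c i = 0)"
    define j where "j = Max {i. i < r \<and> c i \<noteq> 0}"
    have j: "j < r" "c j \<noteq> 0" "\<And>i. i < r \<Longrightarrow> j < i \<Longrightarrow> c i = 0"
      using Max_in[of "{i. i < r \<and> c i \<noteq> 0}"] c(2) Max_ge[of "{i. i < r \<and> c i \<noteq> 0}"]
      unfolding j_def[symmetric] by auto (metis leD)
    obtain p where p: "\<And>i. i < j \<Longrightarrow> p i \<in> P \<and> x i = x j * p i"
      using x(3)[OF _ j(1)] by metis
    have "(\<Sum>i<r. \<iota> (c i) * x i) = (\<Sum>i\<in>insert j {..<j}. \<iota> (c i) * x i)"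
      by (rule sum.mono_neutral_right) (use j in \<open>auto simp: not_less dest: le_neq_implies_less\<close>)
    also have "\<dots> = \<iota> (c j) * x j + (\<Sum>i<j. x j * (\<iota> (c i) * p i))"
      using p by (simp add: mult.left_commute)
    also have "\<dots> = x j * (\<iota> (c j) + (\<Sum>i<j. \<iota> (c i) * p i))"
      by (simp add: sum_distrib_left algebra_simps)
    finally have eq: "(\<Sum>i<r. \<iota> (c i) * x i) = x j * (\<iota> (c j) + (\<Sum>i<j. \<iota> (c i) * p i))" .
    have u: "\<iota> (c j) + (\<Sum>i<j. \<iota> (c i) * p i) \<in> \<O> P - P" (is "?u \<in> _")
      by (intro unit_plus_P j P_sum P_mult R_hom) (use p in auto)
    obtain w where w: "w \<in> \<O> P" "x j * ?u = s * w" using c(1) eq by auto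
    have "x j = s * (w * inverse ?u)"
      using w(2) unit_inverse(2)[OF u] by (simp add: field_simps)
    moreover have "w * inverse ?u \<in> \<O> P" using w(1) unit_inverse(1)[OF u] R_mult by blast
    ultimately show False using x(2)[OF j(1)] by blast
  qed
  then have "poly_indep s {..<r} x"
    by (rule poly_indep_if_indep_mod[rotated -1])
      (use s x R_0 R_add R_mult R_ev P_R in auto)
  then have "card {..<r} \<le> N"
    by (rule degree_boundD[OF s(3), rotated -1]) (use x R_F in auto)
  then show ?thesis by simp
qed

section \<open>Prime elements and discreteness of the valuation\<close>

lemma prime_element_iff: "prime_element F P \<pi> \<longleftrightarrow> P = (*) \<pi> ` \<O> P"
  by (simp add: prime_element_def)

lemma prime_elementD:
  assumes "prime_element F P \<pi>"
  shows "\<pi> \<in> P" "u \<in> P \<Longrightarrow> \<exists>r\<in>\<O> P. u = \<pi> * r"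
  using assms R_1 unfolding prime_element_iff
  by (metis image_eqI mult.right_neutral) (use assms in \<open>auto simp: prime_element_iff\<close>)

context
  fixes s N
  assumes s: "s \<in> P" "s \<noteq> 0" "degree_bound s N"
begin

text \<open>If \<open>P\<close> is not principal, each element of \<open>P\<close> is a product of
  two elements of \<open>P\<close>. Iterating this from \<open>s\<close> gives arbitrarily long
  chains of proper divisors.\<close>

lemma prime_element_exists: "\<exists>\<pi>. prime_element F P \<pi>"
proof (rule ccontr)
  assume none: "\<nexists>\<pi>. prime_element F P \<pi>"
  have step: "\<exists>y\<in>P. \<exists>p\<in>P. x = y * p" if x: "x \<in> P" for x
  proof -
    have "(*) x ` \<O> P \<subseteq> P" using P_mult'[OF x] by auto
    moreover have "P \<noteq> (*) x ` \<O> P" using none by (auto simp: prime_element_iff)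
    ultimately obtain y where y: "y \<in> P" "y \<notin> (*) x ` \<O> P" by blast
    then have "y \<noteq> 0" using R_0 by (metis image_eqI mult_zero_right)
    show ?thesis
    proof (cases "x = 0")
      case True
      then show ?thesis using y(1) P_0 by (intro bexI[of _ y] bexI[of _ 0]) auto
    next
      case False
      have "y / x \<notin> \<O> P"
      proof
        assume "y / x \<in> \<O> P"
        then have "x * (y / x) \<in> (*) x ` \<O> P" by blast
        with False y(2) show False by simp
      qed
      then have "inverse (y / x) \<in> P"
        using x y by (intro P_if_not_R F_divide R_F P_R)
      then show ?thesis using y(1) \<open>y \<noteq> 0\<close> by (intro bexI[of _ y] bexI[of _ "inverse (y / x)"]) auto
    qed
  qed
  have "\<exists>x. \<forall>n. (x n \<in> P \<and> (n = 0 \<longrightarrow> x n = s)) \<and> (\<exists>p\<in>P. x n = x (Suc n) * p)"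
  proof (rule dependent_nat_choice)
    show "\<exists>x. x \<in> P \<and> (0 = 0 \<longrightarrow> x = s)" using s(1) by blast
    show "\<exists>y. (y \<in> P \<and> (Suc n = 0 \<longrightarrow> y = s)) \<and> (\<exists>p\<in>P. x = y * p)"
      if "x \<in> P \<and> (n = 0 \<longrightarrow> x = s)" for x :: 'b and n :: nat
      using step[of x] that by auto
  qed
  then obtain x where x': "\<forall>n. (x n \<in> P \<and> (n = 0 \<longrightarrow> x n = s)) \<and> (\<exists>p\<in>P. x n = x (Suc n) * p)"
    by blast
  then have x: "\<And>n. x n \<in> P" "x 0 = s" "\<And>n. \<exists>p\<in>P. x n = x (Suc n) * p" by blast+
  have chain: "\<exists>p\<in>P. x i = x j * p" if "i < j" for i j
    using that
  proof (induction j)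
    case (Suc j)
    obtain p where p: "p \<in> P" "x j = x (Suc j) * p" using x(3) by blast
    show ?case
    proof (cases "i = j")
      case False
      then obtain p' where "p' \<in> P" "x i = x j * p'" using Suc by auto
      then show ?thesis using p P_mult P_R by (intro bexI[of _ "p * p'"]) auto
    qed (use p in auto)
  qed simp
  \<comment> \<open>The chain starts at \<open>x (Suc i)\<close>, since \<open>x 0 = s\<close> is
    itself a multiple of \<open>s\<close>.\<close>
  have "Suc N \<le> N"
  proof (rule chain_card_le[OF s, of _ "\<lambda>i. x (Suc i)"])
    show "x (Suc i) \<notin> (*) s ` \<O> P" for i
    proof
      assume "x (Suc i) \<in> (*) s ` \<O> P"
      then obtain r where r: "r \<in> \<O> P" "x (Suc i) = s * r" by auto
      obtain p where p: "p \<in> P" "s = x (Suc i) * p" using chain[of 0 "Suc i"] x(2) by auto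
      then have "r * p = 1" using r s by (simp add: mult.assoc)
      then show False using P_mult[OF r(1) p(1)] P_not_1 by simp
    qed
  qed (use x chain P_R in auto)
  then show False by simp
qed

text \<open>The claim for \<open>s\<close> comes from the chain bound, applied to powers of
  \<open>\<pi>\<close>. Hence \<open>s\<close> divides some power of \<open>\<pi>\<close>, and an
  infinitely divisible \<open>z\<close> would be divisible by every power of \<open>s\<close>; its
  powers would then be independent over K[s].\<close>

lemma not_infinitely_divisible:
  assumes pi: "prime_element F P \<pi>" and z: "z \<noteq> 0" "z \<in> \<O> P"
  shows "\<exists>k. z \<notin> (*) (\<pi> ^ k) ` \<O> P"
proof (rule ccontr)
  assume "\<nexists>k. z \<notin> (*) (\<pi> ^ k) ` \<O> P"
  then have z_div: "\<exists>r\<in>\<O> P. z = \<pi> ^ k * r" for k by auto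
  note pi_P = prime_elementD(1)[OF pi]
  have pi0: "\<pi> \<noteq> 0" using prime_elementD(2)[OF pi s(1)] s(2) by auto
  have "\<exists>k. s \<notin> (*) (\<pi> ^ k) ` \<O> P"
  proof (rule ccontr)
    assume "\<nexists>k. s \<notin> (*) (\<pi> ^ k) ` \<O> P"
    then have s_div: "\<exists>r\<in>\<O> P. s = \<pi> ^ k * r" for k by auto
    \<comment> \<open>The exponents \<open>N - i\<close> decrease, so that later members divide
      earlier ones; none is a multiple of \<open>s\<close>, because \<open>s\<close> is assumed
      divisible by all powers of \<open>\<pi>\<close>.\<close>
    have "Suc N \<le> N"
    proof (rule chain_card_le[OF s, of _ "\<lambda>i. \<pi> ^ (N - i)"])
      fix i
      show "\<pi> ^ (N - i) \<notin> (*) s ` \<O> P"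
      proof
        assume "\<pi> ^ (N - i) \<in> (*) s ` \<O> P"
        then obtain r where r: "r \<in> \<O> P" "\<pi> ^ (N - i) = s * r" by auto
        obtain r' where r': "r' \<in> \<O> P" "s = \<pi> ^ Suc (N - i) * r'" using s_div by blast
        have "\<pi> ^ (N - i) * (\<pi> * (r' * r)) = \<pi> ^ (N - i) * 1"
          using r(2) r'(2) by (simp add: mult_ac)
        then have "\<pi> * (r' * r) = 1" using pi0 by (subst (asm) mult_cancel_left) simp
        then show False using P_mult'[OF pi_P, of "r' * r"] r r' R_mult P_not_1 by simp
      qed
    next
      fix i j assume ij: "i < j" "j < Suc N"
      then have "N - i = Suc ((N - j) + (j - i - 1))" by simp
      then have "\<pi> ^ (N - i) = \<pi> ^ (N - j) * (\<pi> * \<pi> ^ (j - i - 1))"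
        by (simp only: power_Suc power_add mult_ac)
      then show "\<exists>p\<in>P. \<pi> ^ (N - i) = \<pi> ^ (N - j) * p"
        using P_mult'[OF pi_P R_power[OF P_R[OF pi_P]]] by blast
    qed (use R_power P_R pi_P in auto)
    then show False by simp
  qed
  then obtain k where k: "s \<notin> (*) (\<pi> ^ k) ` \<O> P" by blast
  have s_unit: "\<exists>r\<in>\<O> P. \<pi> ^ k = s * r"
  proof -
    have "s / \<pi> ^ k \<notin> \<O> P"
    proof
      assume "s / \<pi> ^ k \<in> \<O> P"
      then have "\<pi> ^ k * (s / \<pi> ^ k) \<in> (*) (\<pi> ^ k) ` \<O> P" by blast
      then show False using k pi0 by simp
    qed
    then have "inverse (s / \<pi> ^ k) \<in> \<O> P"
      using s pi_P by (intro P_R P_if_not_R F_divide F_power R_F)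
    then show ?thesis using s(2) by (intro bexI[of _ "inverse (s / \<pi> ^ k)"]) auto
  qed
  have z_s: "\<exists>r\<in>\<O> P. z = s ^ l * r" for l
  proof -
    obtain r where r: "r \<in> \<O> P" "\<pi> ^ k = s * r" using s_unit by blast
    obtain r' where r': "r' \<in> \<O> P" "z = \<pi> ^ (k * l) * r'" using z_div by blast
    have "z = s ^ l * (r ^ l * r')" by (simp add: r'(2) power_mult r(2) power_mult_distrib mult_ac)
    then show ?thesis using r r' R_mult R_power by blast
  qed
  \<comment> \<open>The lowest coefficient of a relation is \<open>s ^ l\<close> times a unit, but
    it is also a multiple of \<open>z\<close> and hence of \<open>s ^ Suc l\<close>. The index set
    has \<open>N + 1\<close> elements, one too many.\<close>
  have "poly_indep s {..N} (\<lambda>i. z ^ i)"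
    unfolding poly_indep_def
  proof (intro allI impI, rule ccontr)
    fix p assume p: "(\<Sum>i\<le>N. ev (p i) s * z ^ i) = 0" "\<not> (\<forall>i\<in>{..N}. p i = 0)"
    then obtain j where j: "j \<le> N" "p j \<noteq> 0"
      and e1: "ev (p j) s = z * (- (\<Sum>i\<in>{Suc j..N}. ev (p i) s * z ^ (i - Suc j)))" (is "_ = z * (- ?S)")
      using lowest_term_relation[OF z(1) p(1), of "\<lambda>i. p i \<noteq> 0"] by auto
    obtain l g where g: "p j = monom 1 l * g" "coeff g 0 \<noteq> 0" by (rule poly_split_power[OF j(2)])
    have S: "- ?S \<in> \<O> P" by (intro R_minus R_sum R_mult R_ev R_power z P_R s)
    obtain r where r: "r \<in> \<O> P" "z = s ^ Suc l * r" using z_s by blast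
    have "s ^ l * ev g s = s ^ l * (s * (r * (- ?S)))"
      using e1 unfolding g(1) r(2) by (simp add: ev_mult ev_monom mult_ac)
    then have "ev g s = s * (r * (- ?S))" using s(2) by (metis mult_cancel_left power_not_zero)
    moreover have "s * (r * (- ?S)) \<in> P" using s r S P_mult' R_mult by blast
    moreover have "ev g s \<in> \<O> P - P"
    proof -
      obtain a g' where "g = pCons a g'" by (cases g)
      then show ?thesis using g(2) unit_plus_P[OF _ P_mult'[OF s(1) R_ev[OF P_R[OF s(1)]]]] by auto
    qed
    ultimately show False by simp
  qed
  then have "card {..N} \<le> N"
    by (rule degree_boundD[OF s(3), rotated -1]) (use z R_F F_power in auto)
  then show False by simp
qed

lemma uniformizer_decomposition:
  assumes pi: "prime_element F P \<pi>" and z: "z \<noteq> 0" "z \<in> F"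
  shows "\<exists>n u. u \<in> \<O> P - P \<and> z = \<pi> powi n * u"
proof -
  have pi0: "\<pi> \<noteq> 0" using prime_elementD(2)[OF pi s(1)] s(2) by auto
  have *: "\<exists>n u. u \<in> \<O> P - P \<and> y = \<pi> ^ n * u" if y: "y \<noteq> 0" "y \<in> \<O> P" for y
  proof -
    define k where "k = (LEAST k. y \<notin> (*) (\<pi> ^ k) ` \<O> P)"
    have k: "y \<notin> (*) (\<pi> ^ k) ` \<O> P" "\<And>i. i < k \<Longrightarrow> y \<in> (*) (\<pi> ^ i) ` \<O> P"
      using LeastI_ex[OF not_infinitely_divisible[OF pi y]] not_less_Least[of _ "\<lambda>k. y \<notin> (*) (\<pi> ^ k) ` \<O> P"]
      unfolding k_def[symmetric] by auto
    have "k \<noteq> 0" using k(1) y(2) by (intro notI) auto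
    then obtain l where l: "k = Suc l" by (cases k) auto
    then obtain u where u: "u \<in> \<O> P" "y = \<pi> ^ l * u" using k(2)[of l] by auto
    have "u \<notin> P"
    proof
      assume "u \<in> P"
      then obtain r where "r \<in> \<O> P" "u = \<pi> * r" using prime_elementD(2)[OF pi] by blast
      then have "y = \<pi> ^ k * r" using u l by (simp add: mult_ac)
      then show False using k(1) \<open>r \<in> \<O> P\<close> by blast
    qed
    then show ?thesis using u by blast
  qed
  show ?thesis
  proof (cases "z \<in> \<O> P")
    case True
    then obtain n u where "u \<in> \<O> P - P" "z = \<pi> ^ n * u" using * z by blast
    then show ?thesis by (intro exI[of _ "int n"] exI[of _ u]) simp
  next
    case False
    then have "inverse z \<in> \<O> P" using R_cases z by blast
    then obtain n u where u: "u \<in> \<O> P - P" "inverse z = \<pi> ^ n * u" using *[of "inverse z"] z by auto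
    then have "z = \<pi> powi (- int n) * inverse u"
      by (metis inverse_inverse_eq inverse_mult_distrib power_int_minus power_int_of_nat)
    then show ?thesis using unit_inverse(1)[OF u(1)] by blast
  qed
qed

text \<open>The description in \<open>place_valuation\<close> ranges over all prime elements; two of
  them differ by a unit, so the exponent is independent of the choice.\<close>

lemma place_valuation_eq:
  assumes pi: "prime_element F P \<pi>" and u: "u \<in> \<O> P - P"
  shows "place_valuation F P (\<pi> powi n * u) = n"
  unfolding place_valuation_def
proof (rule the_equality)
  show "\<exists>t u'. prime_element F P t \<and> u' \<in> \<O> P - P \<and> \<pi> powi n * u = t powi n * u'"
    using pi u by blast
  fix k assume "\<exists>t u'. prime_element F P t \<and> u' \<in> \<O> P - P \<and> \<pi> powi n * u = t powi k * u'"
  then obtain t u' where t: "prime_element F P t" and u': "u' \<in> \<O> P - P"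
    and eq: "\<pi> powi n * u = t powi k * u'" by blast
  have pi0: "\<pi> \<noteq> 0" using prime_elementD(2)[OF pi s(1)] s(2) by auto
  have t0: "t \<noteq> 0" using prime_elementD(2)[OF t s(1)] s(2) by auto
  obtain e where e: "e \<in> \<O> P" "t = \<pi> * e" using prime_elementD[OF pi] prime_elementD[OF t] by blast
  obtain e' where e': "e' \<in> \<O> P" "\<pi> = t * e'" using prime_elementD[OF pi] prime_elementD[OF t] by blast
  have "inverse e = e'" using e e' t0 pi0 by (metis inverse_unique mult.assoc mult_cancel_left1)
  then have eu: "e \<in> \<O> P - P" using e e' t0 by (auto simp: P_iff)
  define w where "w = e powi k * u' * inverse u"
  have w: "w \<in> \<O> P - P" unfolding w_def by (intro unit_mult unit_powi eu u' unit_inverse u)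
  have "\<pi> powi n = \<pi> powi k * w"
    using eq unit_inverse(2)[OF u] by (simp add: w_def e(2) power_int_mult_distrib field_simps)
  then have "\<pi> powi (n - k) = w" using pi0 by (simp add: power_int_diff)
  have pos: "\<pi> powi l \<in> P" if "l > 0" for l
  proof -
    have "\<pi> powi l = \<pi> * \<pi> ^ (nat (l - 1))"
      using that by (simp add: power_int_def nat_diff_distrib flip: power_Suc)
    then show ?thesis using P_mult' R_power P_R prime_elementD(1)[OF pi] by metis
  qed
  have "\<not> n - k > 0" using pos[of "n - k"] \<open>\<pi> powi (n - k) = w\<close> w by auto
  moreover have "\<not> k - n > 0"
  proof
    assume "k - n > 0"
    then have "\<pi> powi (k - n) \<in> P" by (rule pos)
    moreover have "\<pi> powi (k - n) = inverse w"
      using \<open>\<pi> powi (n - k) = w\<close> by (metis minus_diff_eq power_int_minus)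
    ultimately show False using unit_inverse(1)[OF w] by auto
  qed
  ultimately show "k = n" by linarith
qed

text \<open>Multiples of \<open>s\<close> lie in \<open>P\<close>, so elements independent in the
  residue field are independent modulo \<open>s\<close> and hence over K(s). This makes
  \<open>pdeg P\<close> the size of an actual finite basis.\<close>

lemma residue_basis:
  obtains B where "finite B" "basis_modulo (scale_via \<iota>) (\<O> P) P B" "card B = pdeg P"
proof (rule quotient_dim_basis[OF R_subspace P_subspace])
  fix S assume S: "finite S" "S \<subseteq> (\<O> P)" "indep_mod P S id"
  have "(*) s ` \<O> P \<subseteq> P" using P_mult'[OF s(1)] by auto
  then have "indep_mod ((*) s ` \<O> P) S id" using S(3) indep_mod_mono by blast
  then have "poly_indep s S id"
    by (rule poly_indep_if_indep_mod[rotated -1])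
      (use s S R_0 R_add R_mult R_ev P_R in auto)
  then show "card S \<le> N"
    by (rule degree_boundD[OF s(3) S(1), rotated -1]) (use S R_F in auto)
qed (use that in \<open>auto simp: place_degree_def\<close>)

end

end

end

text \<open>The assumption is exactly what the construction of a uniformizer consumes: each place
  contains a nonzero element over whose rational function field \<open>F\<close> has bounded
  degree.\<close>

locale discrete_field = field_between +
  assumes discrete: "P \<in> \<P> \<Longrightarrow> \<exists>s N. s \<in> P \<and> s \<noteq> 0 \<and> degree_bound s N"
begin

abbreviation "lookup \<equiv> Poly_Mapping.lookup"

abbreviation "keys \<equiv> Poly_Mapping.keys"

abbreviation "val \<equiv> place_valuation F"

text \<open>Builds in v_P(0) = \<infinity>, since \<open>val P 0\<close> carries no meaning.\<close>

definition vge :: "'b set \<Rightarrow> int \<Rightarrow> 'b \<Rightarrow> bool" where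
  "vge P n z \<longleftrightarrow> z = 0 \<or> n \<le> val P z"

context
  fixes P
  assumes P: "P \<in> \<P>"
begin

lemma uniformizer:
  obtains \<pi> where "\<pi> \<noteq> 0" "\<pi> \<in> P" "\<pi> \<in> F"
    "\<And>z. z \<in> F \<Longrightarrow> z \<noteq> 0 \<Longrightarrow> \<exists>u\<in>\<O> P - P. z = \<pi> powi val P z * u"
    "\<And>n u. u \<in> \<O> P - P \<Longrightarrow> val P (\<pi> powi n * u) = n"
proof -
  obtain s N where s: "s \<in> P" "s \<noteq> 0" "degree_bound s N" using discrete[OF P] by blast
  obtain \<pi> where pi: "prime_element F P \<pi>" using prime_element_exists[OF P s] by blast
  note eq = place_valuation_eq[OF P s pi]
  show thesis
  proof (rule that)
    show "\<pi> \<noteq> 0" using prime_elementD(2)[OF P pi s(1)] s(2) by auto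
    show "\<pi> \<in> P" by (rule prime_elementD(1)[OF P pi])
    then show "\<pi> \<in> F" using R_F[OF P] P_R[OF P] by blast
    show "val P (\<pi> powi n * u) = n" if "u \<in> \<O> P - P" for n u by (rule eq[OF that])
    show "\<exists>u\<in>\<O> P - P. z = \<pi> powi val P z * u" if "z \<in> F" "z \<noteq> 0" for z
      using uniformizer_decomposition[OF P s pi that(2,1)] eq by metis
  qed
qed

lemma uniformizer_val:
  obtains \<pi> where "\<pi> \<noteq> 0" "\<pi> \<in> F" "val P \<pi> = 1"
proof -
  obtain \<pi> where pi: "\<pi> \<noteq> 0" "\<pi> \<in> F" "\<And>n u. u \<in> \<O> P - P \<Longrightarrow> val P (\<pi> powi n * u) = n"
    using uniformizer by metis
  have "val P \<pi> = 1" using pi(3)[OF unit_1[OF P], of 1] by simp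
  with pi show thesis using that by blast
qed

lemma val_mult:
  assumes "z \<in> F" "z \<noteq> 0" "w \<in> F" "w \<noteq> 0"
  shows "val P (z * w) = val P z + val P w"
proof -
  obtain \<pi> where pi: "\<pi> \<noteq> 0"
    "\<And>z. z \<in> F \<Longrightarrow> z \<noteq> 0 \<Longrightarrow> \<exists>u\<in>\<O> P - P. z = \<pi> powi val P z * u"
    "\<And>n u. u \<in> \<O> P - P \<Longrightarrow> val P (\<pi> powi n * u) = n"
    using uniformizer by metis
  obtain u where u: "u \<in> \<O> P - P" "z = \<pi> powi val P z * u" using pi(2) assms by blast
  obtain u' where u': "u' \<in> \<O> P - P" "w = \<pi> powi val P w * u'" using pi(2) assms by blast
  have "z * w = \<pi> powi (val P z + val P w) * (u * u')"
    using u(2) u'(2) pi(1) by (metis (no_types, lifting) mult.assoc mult.left_commute power_int_add)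
  then show ?thesis using pi(3)[OF unit_mult[OF P u(1) u'(1)]] by metis
qed

lemma val_unit: "u \<in> \<O> P - P \<Longrightarrow> val P u = 0"
  using uniformizer by (metis mult_1 power_int_0_right)

lemma val_1 [simp]: "val P 1 = 0"
  using val_unit unit_1[OF P] by blast

lemma val_hom: "k \<noteq> 0 \<Longrightarrow> val P (\<iota> k) = 0"
  using val_unit unit_plus_P[OF P _ P_0[OF P], of k] by simp

lemma val_inverse:
  assumes "z \<in> F" "z \<noteq> 0"
  shows "val P (inverse z) = - val P z"
  using val_mult[of z "inverse z"] assms F_inverse by simp

lemma val_divide:
  assumes "z \<in> F" "z \<noteq> 0" "w \<in> F" "w \<noteq> 0"
  shows "val P (z / w) = val P z - val P w"
  using val_mult[of z "inverse w"] val_inverse[of w] assms F_inverse by (simp add: divide_inverse)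

lemma val_power:
  assumes "z \<in> F" "z \<noteq> 0"
  shows "val P (z ^ k) = int k * val P z"
  by (induction k) (use assms in \<open>simp_all add: val_mult F_power algebra_simps\<close>)

lemma val_powi:
  assumes "z \<in> F" "z \<noteq> 0"
  shows "val P (z powi k) = k * val P z"
  using assms by (simp add: power_int_def val_power val_inverse F_inverse)

lemma P_iff_val:
  assumes z: "z \<in> F" "z \<noteq> 0"
  shows "z \<in> P \<longleftrightarrow> 1 \<le> val P z"
    and R_iff_val: "z \<in> \<O> P \<longleftrightarrow> 0 \<le> val P z"
proof -
  obtain \<pi> where pi: "\<pi> \<noteq> 0" "\<pi> \<in> P"
    "\<And>z. z \<in> F \<Longrightarrow> z \<noteq> 0 \<Longrightarrow> \<exists>u\<in>\<O> P - P. z = \<pi> powi val P z * u"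
    using uniformizer by metis
  have pos: "w \<in> P" if w: "w \<in> F" "w \<noteq> 0" "val P w \<ge> 1" for w
  proof -
    obtain u where u: "u \<in> \<O> P - P" "w = \<pi> powi val P w * u" using pi(3) w by blast
    have "\<pi> powi val P w = \<pi> * \<pi> ^ nat (val P w - 1)"
      using w(3) by (simp add: power_int_def nat_diff_distrib flip: power_Suc)
    then have "w = \<pi> * (\<pi> ^ nat (val P w - 1) * u)" using u(2) by (simp add: mult.assoc)
    moreover have "\<pi> * (\<pi> ^ nat (val P w - 1) * u) \<in> P"
      using u(1) pi(2) P_mult'[OF P] R_mult[OF P] R_power[OF P] P_R[OF P] by (meson DiffD1)
    ultimately show ?thesis by simp
  qed
  have zero: "w \<in> \<O> P - P" if w: "w \<in> F" "w \<noteq> 0" "val P w = 0" for w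
    using pi(3)[OF w(1,2)] w(3) by auto
  have neg: "w \<notin> \<O> P" if w: "w \<in> F" "w \<noteq> 0" "val P w < 0" for w
  proof
    assume "w \<in> \<O> P"
    moreover have "inverse w \<in> P" using w pos[of "inverse w"] F_inverse val_inverse by auto
    ultimately have "w * inverse w \<in> P" using P_mult[OF P] by blast
    then show False using w P_not_1[OF P] by simp
  qed
  show "z \<in> P \<longleftrightarrow> 1 \<le> val P z"
    using pos[OF z] zero[OF z] neg[OF z] P_R[OF P, of z] by fastforce
  show "z \<in> \<O> P \<longleftrightarrow> 0 \<le> val P z"
    using pos[OF z] zero[OF z] neg[OF z] P_R[OF P, of z] by fastforce
qed

lemma vge_0_iff: "z \<in> F \<Longrightarrow> vge P 0 z \<longleftrightarrow> z \<in> \<O> P"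
  using R_iff_val R_0[OF P] by (auto simp: vge_def)

lemma vge_1_iff: "z \<in> F \<Longrightarrow> vge P 1 z \<longleftrightarrow> z \<in> P"
  using P_iff_val P_0[OF P] by (auto simp: vge_def)

lemma vge_mult:
  assumes "z \<in> F" "w \<in> F" "vge P m z" "vge P n w"
  shows "vge P (m + n) (z * w)"
  using assms val_mult[of z w] by (cases "z = 0 \<or> w = 0") (auto simp: vge_def)

lemma vge_scale: "z \<in> F \<Longrightarrow> vge P n z \<Longrightarrow> vge P n (\<iota> k * z)"
  using vge_mult[of "\<iota> k" z 0 n] val_hom[of k] by (cases "k = 0") (auto simp: vge_def)

lemma vge_add:
  assumes "z \<in> F" "w \<in> F" "vge P n z" "vge P n w"
  shows "vge P n (z + w)"
proof -
  have *: "vge P n (z + w)" if "z \<in> F" "w \<in> F" "z \<noteq> 0" "n \<le> val P z" "w / z \<in> \<O> P" for z w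
  proof -
    have "z + w = z * (1 + w / z)" using that by (simp add: field_simps)
    moreover have "1 + w / z \<in> F" using that F_add F_divide F_1 by blast
    moreover have "vge P 0 (1 + w / z)"
      using that R_add[OF P] R_1[OF P] R_F[OF P] by (subst vge_0_iff) auto
    ultimately show ?thesis using vge_mult[of z "1 + w / z" n 0] that by (auto simp: vge_def)
  qed
  consider "z = 0 \<or> w = 0" | "z \<noteq> 0" "w \<noteq> 0" "w / z \<in> \<O> P" | "z \<noteq> 0" "w \<noteq> 0" "z / w \<in> \<O> P"
    using R_cases[OF P F_divide[OF assms(1,2)]] by auto
  then show ?thesis
    using assms *[of z w] *[of w z] by cases (auto simp: vge_def add.commute)
qed

lemma vge_mono: "vge P n z \<Longrightarrow> m \<le> n \<Longrightarrow> vge P m z"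
  by (auto simp: vge_def)

lemma val_add_eq:
  assumes "z \<in> F" "z \<noteq> 0" "w \<in> F" "w \<noteq> 0" "val P z < val P w"
  shows "z + w \<noteq> 0" "val P (z + w) = val P z"
proof -
  have wz: "w / z \<in> P"
    using assms val_divide[of w z] by (subst P_iff_val) (auto intro: F_divide)
  have eq: "z + w = z * (1 + w / z)" using assms by (simp add: field_simps)
  have u: "1 + w / z \<in> \<O> P - P" using unit_plus_P[OF P _ wz, of 1] by simp
  then show "z + w \<noteq> 0" using eq assms unit_inverse(2)[OF P u] by simp
  show "val P (z + w) = val P z"
    unfolding eq using assms u val_mult[of z "1 + w / z"] val_unit[OF u] unit_inverse(2)[OF P u]
    by (auto simp: R_F[OF P])
qed

lemma val_add_neq:
  assumes "z \<in> F" "z \<noteq> 0" "w \<in> F" "w \<noteq> 0" "val P z \<noteq> val P w"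
  shows "z + w \<noteq> 0" "val P (z + w) = min (val P z) (val P w)"
proof -
  consider "val P z < val P w" | "val P w < val P z" using assms(5) by linarith
  then have "z + w \<noteq> 0 \<and> val P (z + w) = min (val P z) (val P w)"
  proof cases
    case 1
    then show ?thesis using val_add_eq[of z w] assms by simp
  next
    case 2
    then show ?thesis using val_add_eq[of w z] assms by (simp add: add.commute)
  qed
  then show "z + w \<noteq> 0" "val P (z + w) = min (val P z) (val P w)" by auto
qed

lemma residue_basis':
  obtains B where "finite B" "basis_modulo (scale_via \<iota>) (\<O> P) P B" "card B = pdeg P"
  using discrete[OF P] residue_basis[OF P] by metis

lemma place_degree_pos: "pdeg P \<ge> 1"
proof -
  obtain B where B: "finite B" "basis_modulo (scale_via \<iota>) (\<O> P) P B" "card B = pdeg P"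
    by (rule residue_basis')
  have "B \<noteq> {}"
  proof
    assume "B = {}"
    then obtain w where "w \<in> P" "1 - w = 0" using basis_moduloD(3)[OF B(2) R_1[OF P]] by auto
    then show False using P_not_1[OF P] by simp
  qed
  then have "0 < card B" using B(1) by (simp add: card_gt_0_iff)
  then show ?thesis using B(3) by simp
qed

end

section \<open>Weak approximation and the degree of zero divisors\<close>

lemma places_incomparable:
  assumes P: "P \<in> \<P>" and Q: "Q \<in> \<P>" and "P \<noteq> Q"
  obtains z where "z \<in> \<O> P" "z \<notin> \<O> Q"
proof (rule ccontr)
  assume "\<not> thesis"
  then have sub: "\<O> P \<subseteq> \<O> Q" using that by blast
  obtain \<pi> where pi: "\<pi> \<noteq> 0" "\<pi> \<in> P"
    "\<And>z. z \<in> F \<Longrightarrow> z \<noteq> 0 \<Longrightarrow> \<exists>u\<in>\<O> P - P. z = \<pi> powi val P z * u"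
    using uniformizer[OF P] by metis
  have pi_Q: "\<pi> \<in> \<O> Q" using pi(2) P_R[OF P] sub by blast
  \<comment> \<open>A discrete valuation ring is a maximal proper subring: together with the inverse
    of \<open>\<pi>\<close> it generates all of \<open>F\<close>. Conversely, an element of the
    larger ring outside the smaller one would put that inverse into it.\<close>
  have inv_pi: "inverse \<pi> \<notin> \<O> Q"
  proof
    assume inv: "inverse \<pi> \<in> \<O> Q"
    have "z \<in> \<O> Q" if z: "z \<in> F" for z
    proof (cases "z = 0")
      case False
      obtain u where u: "u \<in> \<O> P - P" "z = \<pi> powi val P z * u" using pi(3) z False by blast
      have "\<pi> powi val P z \<in> \<O> Q"
        using R_power[OF Q] inv pi_Q by (simp add: power_int_def)
      then show ?thesis using u sub R_mult[OF Q] by (metis DiffD1 subsetD)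
    qed (simp add: R_0[OF Q])
    then show False using R_neq[OF Q] R_F[OF Q] by blast
  qed
  have "\<O> Q \<subseteq> \<O> P"
  proof (rule subsetI, rule ccontr)
    fix z assume z: "z \<in> \<O> Q" "z \<notin> \<O> P"
    have zF: "z \<in> F" using z R_F[OF Q] by blast
    have z0: "z \<noteq> 0" using z R_0[OF P] by auto
    obtain u where u: "u \<in> \<O> P - P" "z = \<pi> powi val P z * u" using pi(3) zF z0 by blast
    have neg: "val P z < 0" using z(2) R_iff_val[OF P zF z0] by simp
    define k where "k = nat (- val P z - 1)"
    have "z = inverse \<pi> ^ Suc k * u"
      using u(2) neg by (simp add: k_def power_int_def Suc_nat_eq_nat_zadd1 del: power_Suc)
    then have "inverse \<pi> = z * \<pi> ^ k * inverse u"
      using pi(1) unit_inverse(2)[OF P u(1)] by (simp add: field_simps)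
    moreover have "z * \<pi> ^ k * inverse u \<in> \<O> Q"
      using z(1) pi_Q unit_inverse(1)[OF P u(1)] sub R_mult[OF Q] R_power[OF Q]
      by (metis DiffD1 subsetD)
    ultimately show False using inv_pi by simp
  qed
  with sub have "\<O> P = \<O> Q" by blast
  then show False using place_eq[OF P] place_eq[OF Q] \<open>P \<noteq> Q\<close> by simp
qed

text \<open>Induction over the places. If \<open>z\<close> has no pole at the new place
  \<open>Q\<close>, a high power of some \<open>w\<close> with a zero at \<open>P\<close> and a pole
  at \<open>Q\<close> is added.\<close>

lemma separating_element:
  assumes "finite S" "S \<subseteq> \<P>" and P: "P \<in> \<P>" and "P \<notin> S"
  obtains z where "z \<in> F" "z \<noteq> 0" "val P z \<ge> 1" "\<forall>Q\<in>S. val Q z < 0"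
proof -
  have "\<exists>z\<in>F. z \<noteq> 0 \<and> val P z \<ge> 1 \<and> (\<forall>Q\<in>S. val Q z < 0)" using assms(1,2,4)
  proof (induction S)
    case empty
    show ?case using uniformizer_val[OF P] by (metis empty_iff order.refl)
  next
    case (insert Q S)
    have Q: "Q \<in> \<P>" using insert by simp
    obtain z where z: "z \<in> F" "z \<noteq> 0" "val P z \<ge> 1" "\<forall>Q\<in>S. val Q z < 0" using insert by auto
    show ?case
    proof (cases "val Q z < 0")
      case True
      then show ?thesis using z by blast
    next
      case False
      have "P \<noteq> Q" using insert by auto
      obtain y where y: "y \<in> \<O> P" "y \<notin> \<O> Q"
        using places_incomparable[OF P Q \<open>P \<noteq> Q\<close>] .
      obtain y' where y': "y' \<in> \<O> Q" "y' \<notin> \<O> P"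
        using places_incomparable[OF Q P \<open>P \<noteq> Q\<close>[symmetric]] .
      have yF: "y \<in> F" "y \<noteq> 0" "y' \<in> F" "y' \<noteq> 0"
        using y y' R_F[OF P] R_F[OF Q] R_0[OF P] R_0[OF Q] by auto
      define w where "w = y / y'"
      have w: "w \<in> F" "w \<noteq> 0" "val P w \<ge> 1" "val Q w < 0"
        using yF y y' val_divide[OF P yF] val_divide[OF Q yF]
          R_iff_val[OF P yF(1,2)] R_iff_val[OF P yF(3,4)] R_iff_val[OF Q yF(1,2)] R_iff_val[OF Q yF(3,4)]
        by (auto simp: w_def F_divide)
      \<comment> \<open>\<open>k\<close> exceeds every valuation of \<open>z\<close> on
        \<open>S\<close> in absolute value. At an old place \<open>z\<close> and
        \<open>w ^ k\<close> then have different valuations, so no cancellation can destroy the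
        pole.\<close>
      define k where "k = nat (1 + (\<Sum>Q\<in>S. \<bar>val Q z\<bar>))"
      have k: "int k > \<bar>val Q' z\<bar>" if "Q' \<in> S" for Q'
        using member_le_sum[of Q' S "\<lambda>Q. \<bar>val Q z\<bar>"] that insert(1) by (simp add: k_def)
      have "0 \<le> (\<Sum>Q\<in>S. \<bar>val Q z\<bar>)" by (rule sum_nonneg) simp
      then have k1: "k \<ge> 1" unfolding k_def by linarith
      have wk: "w ^ k \<in> F" "w ^ k \<noteq> 0" using w F_power by auto
      have "val Q (w ^ k) < 0"
        unfolding val_power[OF Q w(1,2)] using k1 w(4) by (simp add: mult_pos_neg)
      then have neq: "val Q z \<noteq> val Q (w ^ k)" "val Q (w ^ k) < val Q z" using False by auto
      have n0: "z + w ^ k \<noteq> 0" and vQ: "val Q (z + w ^ k) < 0"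
        using val_add_neq[OF Q z(1,2) wk neq(1)] neq \<open>val Q (w ^ k) < 0\<close> by (auto simp: min_def)
      have "int k * val P w \<ge> 1 * 1" using k1 w(3) by (intro mult_mono) auto
      then have "vge P 1 (w ^ k)" by (simp add: vge_def val_power[OF P w(1,2)])
      then have "vge P 1 (z + w ^ k)"
        using z(3) by (intro vge_add[OF P z(1) wk(1)]) (auto simp: vge_def)
      then have vP: "val P (z + w ^ k) \<ge> 1" using n0 by (simp add: vge_def)
      have "val Q' (z + w ^ k) < 0" if Q': "Q' \<in> S" for Q'
      proof -
        have Q'': "Q' \<in> \<P>" using Q' insert by auto
        have "val Q' z \<noteq> val Q' (w ^ k)"
        proof (cases "val Q' w = 0")
          case True
          then show ?thesis using z(4) Q' by (auto simp: val_power[OF Q'' w(1,2)])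
        next
          case False
          have "int k * 1 \<le> int k * \<bar>val Q' w\<bar>" using False by (intro mult_left_mono) auto
          then have "\<bar>val Q' (w ^ k)\<bar> \<ge> int k" by (simp add: val_power[OF Q'' w(1,2)] abs_mult)
          then show ?thesis using k[OF Q'] by auto
        qed
        then show ?thesis
          using val_add_neq[OF Q'' z(1,2) wk] z(4) Q' by (auto simp: min_def)
      qed
      then show ?thesis using n0 vQ vP z wk F_add by (intro bexI[of _ "z + w ^ k"]) auto
    qed
  qed
  then show thesis using that by blast
qed

text \<open>With \<open>z\<close> vanishing at \<open>P\<close> and having poles on
  \<open>S\<close>, the element 1 / (1 + z) is a unit at \<open>P\<close> and vanishes on
  \<open>S\<close>. A high power of it corrects \<open>\<pi> powi n\<close> on \<open>S\<close>
  without changing the value at \<open>P\<close>.\<close>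

lemma approximation:
  assumes S: "finite S" "S \<subseteq> \<P>" and P: "P \<in> \<P>" and "P \<notin> S"
  obtains w where "w \<in> F" "w \<noteq> 0" "val P w = n" "\<forall>Q\<in>S. k Q \<le> val Q w"
proof -
  obtain z where z: "z \<in> F" "z \<noteq> 0" "val P z \<ge> 1" "\<forall>Q\<in>S. val Q z < 0"
    by (rule separating_element[OF assms])
  have one: "val P 1 < val P z" using z(3) val_1[OF P] by simp
  define w0 where "w0 = inverse (1 + z)"
  have n0: "1 + z \<noteq> 0" using val_add_eq[OF P F_1 _ z(1,2) one] by simp
  have zF: "1 + z \<in> F" using z F_add F_1 by blast
  have w0: "w0 \<in> F" "w0 \<noteq> 0" using n0 zF F_inverse by (auto simp: w0_def)
  have w0P: "val P w0 = 0"
    using val_add_eq[OF P F_1 _ z(1,2) one] val_1[OF P] val_inverse[OF P zF n0] by (simp add: w0_def)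
  have w0Q: "val Q w0 \<ge> 1" if Q: "Q \<in> S" for Q
  proof -
    have Q': "Q \<in> \<P>" using Q S by auto
    have "val Q z < val Q 1" using bspec[OF z(4) Q] val_1[OF Q'] by simp
    then have "val Q (z + 1) = val Q z" using val_add_eq[OF Q' z(1,2) F_1] by simp
    then show ?thesis using bspec[OF z(4) Q] val_inverse[OF Q' zF n0] by (simp add: w0_def add.commute)
  qed
  obtain \<pi> where pi: "\<pi> \<noteq> 0" "\<pi> \<in> F" "val P \<pi> = 1" using uniformizer_val[OF P] .
  have pin: "\<pi> powi n \<in> F" "\<pi> powi n \<noteq> 0" using pi F_powi by auto
  define M where "M = nat (\<Sum>Q\<in>S. \<bar>k Q - val Q (\<pi> powi n)\<bar>)"
  have w0M: "w0 ^ M \<in> F" "w0 ^ M \<noteq> 0" using w0 F_power by auto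
  show thesis
  proof (rule that[of "\<pi> powi n * w0 ^ M"])
    show "\<pi> powi n * w0 ^ M \<in> F" "\<pi> powi n * w0 ^ M \<noteq> 0" using pin w0M F_mult by auto
    show "val P (\<pi> powi n * w0 ^ M) = n"
      using val_mult[OF P pin w0M] val_powi[OF P pi(2,1)] val_power[OF P w0] w0P pi(3) by simp
    show "\<forall>Q\<in>S. k Q \<le> val Q (\<pi> powi n * w0 ^ M)"
    proof
      fix Q assume Q: "Q \<in> S"
      then have Q': "Q \<in> \<P>" using S by auto
      have "\<bar>k Q - val Q (\<pi> powi n)\<bar> \<le> int M"
        using member_le_sum[OF Q, of "\<lambda>Q. \<bar>k Q - val Q (\<pi> powi n)\<bar>"] S(1) by (simp add: M_def sum_nonneg)
      moreover have "int M * 1 \<le> int M * val Q w0" using w0Q[OF Q] by (intro mult_left_mono) auto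
      ultimately show "k Q \<le> val Q (\<pi> powi n * w0 ^ M)"
        using val_mult[OF Q' pin w0M] val_power[OF Q' w0] by simp
    qed
  qed
qed

definition vge_on :: "'b set set \<Rightarrow> ('b set \<Rightarrow> nat) \<Rightarrow> 'b set" where
  "vge_on S a = {z\<in>F. \<forall>P\<in>S. vge P (int (a P)) z}"

lemma vge_on_subspace: "S \<subseteq> \<P> \<Longrightarrow> vs.subspace (vge_on S a)"
  by (rule subspaceI) (auto simp: vge_on_def F_add F_mult vge_add vge_scale subset_iff, simp add: vge_def)

text \<open>This bounds from below the dimension of the semilocal ring of \<open>S\<close> modulo
  the ideal given by \<open>a\<close>. Raising \<open>a P\<close> by one adds lifts of a residue
  basis at \<open>P\<close>, multiplied by an element of value \<open>a P - 1\<close> at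
  \<open>P\<close> and of large value elsewhere.\<close>

lemma weak_approximation_family:
  assumes "finite S" "S \<subseteq> \<P>"
  obtains E where "finite E" "E \<subseteq> vge_on S (\<lambda>_. 0)" "indep_mod (vge_on S a) E id"
    "card E = (\<Sum>P\<in>S. a P * pdeg P)"
proof -
  have "\<exists>E. finite E \<and> E \<subseteq> vge_on S (\<lambda>_. 0) \<and> indep_mod (vge_on S a) E id \<and>
      card E = (\<Sum>P\<in>S. a P * pdeg P)"
  proof (induction "\<Sum>P\<in>S. a P" arbitrary: a)
    case 0
    then have "\<And>P. P \<in> S \<Longrightarrow> a P = 0" using assms(1) by auto
    then show ?case by (intro exI[of _ "{}"]) (auto simp: indep_mod_def)
  next
    case (Suc m)
    have "\<exists>P\<in>S. a P \<noteq> 0" using Suc(2) by (metis old.nat.distinct(2) sum.neutral)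
    then obtain P where PS: "P \<in> S" and aP: "a P > 0" by auto
    have P: "P \<in> \<P>" using PS assms(2) by blast
    define a' where "a' = a(P := a P - 1)"
    have sum_a: "(\<Sum>Q\<in>S. a Q * f Q) = (\<Sum>Q\<in>S. a' Q * f Q) + f P" for f :: "'b set \<Rightarrow> nat"
    proof -
      have "(\<Sum>Q\<in>S. a Q * f Q) = a P * f P + (\<Sum>Q\<in>S - {P}. a Q * f Q)"
        using PS assms(1) by (simp add: sum.remove)
      moreover have "(\<Sum>Q\<in>S. a' Q * f Q) = a' P * f P + (\<Sum>Q\<in>S - {P}. a' Q * f Q)"
        using PS assms(1) by (simp add: sum.remove)
      moreover have "(\<Sum>Q\<in>S - {P}. a' Q * f Q) = (\<Sum>Q\<in>S - {P}. a Q * f Q)"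
        by (rule sum.cong) (auto simp: a'_def)
      moreover have "a P * f P = a' P * f P + f P" using aP by (cases "a P") (auto simp: a'_def)
      ultimately show ?thesis by linarith
    qed
    have "m = (\<Sum>Q\<in>S. a' Q)" using sum_a[of "\<lambda>_. 1"] Suc(2) by simp
    from Suc(1)[OF this] obtain E where E: "finite E" "E \<subseteq> vge_on S (\<lambda>_. 0)"
      "indep_mod (vge_on S a') E id" "card E = (\<Sum>P\<in>S. a' P * pdeg P)" by blast
    obtain B where B: "finite B" "basis_modulo (scale_via \<iota>) (\<O> P) P B" "card B = pdeg P"
      by (rule residue_basis'[OF P])
    have B_ind: "indep_mod P B id" by (rule basis_moduloD(2)[OF B(2,1)]) simp
    have B_R: "B \<subseteq> \<O> P" by (rule basis_moduloD(1)[OF B(2)])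
    have B_F: "B \<subseteq> F" using B_R R_F[OF P] by blast
    \<comment> \<open>The extra sum of absolute values compensates possible poles of the residue
      representatives \<open>b\<close> at the other places.\<close>
    obtain w where w: "w \<in> F" "w \<noteq> 0" "val P w = int (a P - 1)"
      "\<forall>Q\<in>S - {P}. int (a Q) + (\<Sum>b\<in>B. \<bar>val Q b\<bar>) \<le> val Q w"
      by (rule approximation[of "S - {P}" P "int (a P - 1)" "\<lambda>Q. int (a Q) + (\<Sum>b\<in>B. \<bar>val Q b\<bar>)"])
        (use assms P in auto)
    have wb: "w * b \<in> vge_on S a'" "Q \<in> S \<Longrightarrow> Q \<noteq> P \<Longrightarrow> vge Q (int (a Q)) (w * b)" if b: "b \<in> B" for b Q
    proof -
      show *: "vge Q (int (a Q)) (w * b)" if Q: "Q \<in> S" "Q \<noteq> P" for Q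
      proof (cases "b = 0")
        case False
        have Q': "Q \<in> \<P>" using Q assms by blast
        have "\<bar>val Q b\<bar> \<le> (\<Sum>b\<in>B. \<bar>val Q b\<bar>)" by (rule member_le_sum[OF b]) (use B in auto)
        moreover have "int (a Q) + (\<Sum>b\<in>B. \<bar>val Q b\<bar>) \<le> val Q w" using w(4) Q by blast
        moreover have "val Q (w * b) = val Q w + val Q b" using b B_F False by (intro val_mult[OF Q' w(1,2)]) auto
        ultimately show ?thesis unfolding vge_def by linarith
      qed (simp add: vge_def)
      have "vge P (int (a P - 1) + 0) (w * b)"
      proof (rule vge_mult[OF P w(1)])
        show "b \<in> F" using b B_F by blast
        then show "vge P 0 b" using b B_R vge_0_iff[OF P] by blast
      qed (simp add: vge_def w(3))
      then show "w * b \<in> vge_on S a'" using * w(1) b B_F by (auto simp: vge_on_def a'_def F_mult)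
    qed
    define E' where "E' = (*) w ` B"
    have inj: "inj_on ((*) w) B" using w(2) by (auto simp: inj_on_def)
    have disj: "E \<inter> E' = {}"
    proof (rule ccontr)
      assume "E \<inter> E' \<noteq> {}"
      then obtain z where z: "z \<in> E" "z \<in> vge_on S a'" using wb(1) by (auto simp: E'_def)
      have "(\<Sum>i\<in>E. \<iota> (if i = z then 1 else 0) * i) = (\<Sum>i\<in>E. if i = z then z else 0)"
        by (rule sum.cong) auto
      also have "\<dots> = z" using z(1) E(1) by simp
      finally show False using indep_modD[OF E(3), of "\<lambda>i. if i = z then 1 else 0" z] z by simp
    qed
    have a'_sub: "vge_on S a' \<subseteq> vge_on S (\<lambda>_. 0)" by (auto simp: vge_on_def vge_def)
    have a_sub: "vge_on S a \<subseteq> vge_on S a'" by (auto simp: vge_on_def vge_def a'_def)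
    have "indep_mod (vge_on S a) (E \<union> E') id"
      unfolding indep_mod_def
    proof (intro allI impI)
      fix c assume c: "(\<Sum>i\<in>E \<union> E'. \<iota> (c i) * id i) \<in> vge_on S a"
      have split: "(\<Sum>i\<in>E \<union> E'. \<iota> (c i) * id i) = (\<Sum>i\<in>E. \<iota> (c i) * i) + (\<Sum>i\<in>E'. \<iota> (c i) * i)"
        using E(1) B(1) disj by (simp add: sum.union_disjoint E'_def)
      have E'_a': "(\<Sum>i\<in>E'. \<iota> (c i) * i) \<in> vge_on S a'"
        by (rule subspace_sum_scale[OF vge_on_subspace[OF assms(2)]]) (use wb in \<open>auto simp: E'_def\<close>)
      have "(\<Sum>i\<in>E. \<iota> (c i) * i) \<in> vge_on S a'"
        using subspaceD(3)[OF vge_on_subspace[OF assms(2)] subsetD[OF a_sub c] E'_a'] split by simp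
      then have cE: "\<forall>i\<in>E. c i = 0" using E(3) by (auto simp: indep_mod_def)
      then have "(\<Sum>i\<in>E'. \<iota> (c i) * i) \<in> vge_on S a" using c split by simp
      then have "(\<Sum>b\<in>B. \<iota> (c (w * b)) * (w * b)) \<in> vge_on S a"
        by (simp add: E'_def sum.reindex[OF inj])
      then have s: "w * (\<Sum>b\<in>B. \<iota> (c (w * b)) * b) \<in> vge_on S a"
        by (simp add: sum_distrib_left mult.left_commute)
      have sF: "(\<Sum>b\<in>B. \<iota> (c (w * b)) * b) \<in> F" (is "?s \<in> F")
        using B_F by (intro F_sum F_mult) auto
      have "vge P (int (a P)) (w * ?s)" using s PS by (auto simp: vge_on_def)
      \<comment> \<open>\<open>w\<close> has value only \<open>a P - 1\<close>, so the missing one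
        must come from the residue combination.\<close>
      then have "?s = 0 \<or> 1 \<le> val P ?s"
        using w(2,3) aP val_mult[OF P w(1,2) sF] by (cases "?s = 0") (auto simp: vge_def)
      then have "?s \<in> P" using vge_1_iff[OF P sF] by (auto simp: vge_def)
      then have "\<forall>b\<in>B. c (w * b) = 0" using B_ind by (auto simp: indep_mod_def)
      with cE show "\<forall>i\<in>E \<union> E'. c i = 0" by (auto simp: E'_def)
    qed
    moreover have "card (E \<union> E') = (\<Sum>P\<in>S. a P * pdeg P)"
      using E(1,4) B(1,3) disj sum_a[of "pdeg"]
      by (simp add: card_Un_disjoint E'_def card_image[OF inj])
    moreover have "E \<union> E' \<subseteq> vge_on S (\<lambda>_. 0)" using E(2) wb(1) a'_sub by (auto simp: E'_def)
    moreover have "finite (E \<union> E')" using E(1) B(1) by (simp add: E'_def)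
    ultimately show ?case by blast
  qed
  then show thesis using that by blast
qed

text \<open>The family from weak approximation is independent modulo multiples of \<open>s\<close>,
  because \<open>s\<close> itself has the prescribed zeros on \<open>S\<close>. So its size, the
  degree of this part of the zero divisor, is at most [F : K(s)].\<close>

lemma zero_degree_le:
  assumes s: "s \<in> F" "s \<noteq> 0" "degree_bound s N"
    and S: "finite S" "S \<subseteq> {P\<in>\<P>. s \<in> P}"
  shows "(\<Sum>P\<in>S. nat (val P s) * pdeg P) \<le> N"
proof -
  have S': "S \<subseteq> \<P>" using S by blast
  obtain E where E: "finite E" "E \<subseteq> vge_on S (\<lambda>_. 0)" "indep_mod (vge_on S (\<lambda>P. nat (val P s))) E id"
    "card E = (\<Sum>P\<in>S. nat (val P s) * pdeg P)"
    by (rule weak_approximation_family[OF S(1) S'])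
  have "(*) s ` vge_on S (\<lambda>_. 0) \<subseteq> vge_on S (\<lambda>P. nat (val P s))"
  proof (rule image_subsetI)
    fix z assume z: "z \<in> vge_on S (\<lambda>_. 0)"
    have "vge P (int (nat (val P s))) (s * z)" if P: "P \<in> S" for P
    proof -
      have P': "P \<in> \<P>" using P S' by blast
      have "val P s \<ge> 1" using S P P_iff_val[OF P' s(1,2)] by blast
      then have "vge P (int (nat (val P s))) s" by (simp add: vge_def)
      from vge_mult[OF P' s(1) _ this, of z 0] z P show ?thesis by (auto simp: vge_on_def)
    qed
    then show "s * z \<in> vge_on S (\<lambda>P. nat (val P s))" using z s by (auto simp: vge_on_def F_mult)
  qed
  then have "indep_mod ((*) s ` vge_on S (\<lambda>_. 0)) E id" using E(3) indep_mod_mono by blast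
  then have "poly_indep s E id"
  proof (rule poly_indep_if_indep_mod[rotated -1])
    fix p u assume u: "u \<in> vge_on S (\<lambda>_. 0)"
    have "vge P 0 (ev p s * u)" if P: "P \<in> S" for P
    proof -
      have P': "P \<in> \<P>" using P S' by blast
      have "s \<in> \<O> P" using S P P_R[OF P'] by blast
      then have "vge P 0 (ev p s)" using vge_0_iff[OF P'] R_ev[OF P'] F_ev[OF s(1)] by blast
      from vge_mult[OF P' F_ev[OF s(1)] _ this, of u 0] u P show ?thesis by (auto simp: vge_on_def)
    qed
    then show "ev p s * u \<in> vge_on S (\<lambda>_. 0)" using u F_ev[OF s(1)] F_mult by (auto simp: vge_on_def)
  qed (use s E subspaceD(1,2)[OF vge_on_subspace[OF S']] in auto)
  then have "card E \<le> N"
    by (rule degree_boundD[OF s(3) E(1), rotated -1]) (use E in \<open>auto simp: vge_on_def\<close>)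
  then show ?thesis using E by simp
qed

lemma finite_zeros:
  assumes s: "s \<in> F" "s \<noteq> 0" "degree_bound s N"
  shows "finite {P\<in>\<P>. s \<in> P}"
proof -
  have "card S \<le> N" if S: "S \<subseteq> {P\<in>\<P>. s \<in> P}" "finite S" for S
  proof -
  have "1 \<le> nat (val P s) * pdeg P" if "P \<in> S" for P
  proof -
    have P: "P \<in> \<P>" "s \<in> P" using that S by auto
    then have "val P s \<ge> 1" using P_iff_val[OF P(1) s(1,2)] by blast
    then show ?thesis using place_degree_pos[OF P(1)] by simp
  qed
  then have "(\<Sum>P\<in>S. 1) \<le> (\<Sum>P\<in>S. nat (val P s) * pdeg P)" by (rule sum_mono)
  then show "card S \<le> N" using zero_degree_le[OF s S(2,1)] by simp
  qed
  then have "finite {P\<in>\<P>. s \<in> P} \<and> card {P\<in>\<P>. s \<in> P} \<le> N"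
    by (rule finite_if_finite_subsets_card_bdd)
  then show ?thesis ..
qed

section \<open>Riemann-Roch spaces and their growth\<close>

definition L :: "('b set \<Rightarrow> int) \<Rightarrow> 'b set" where
  "L a = {z\<in>F. \<forall>P\<in>\<P>. vge P (- a P) z}"

lemma riemann_roch_space_eq: "riemann_roch_space \<iota> F D = L (lookup D)"
  by (auto simp: riemann_roch_space_def L_def vge_def)

lemma L_subspace: "vs.subspace (L a)"
  by (rule subspaceI) (auto simp: L_def F_add F_mult vge_add vge_scale, simp add: vge_def)

lemma L_mono:
  assumes "\<And>P. P \<in> \<P> \<Longrightarrow> a P \<le> a' P"
  shows "L a \<subseteq> L a'"
proof -
  have "vge P (- a' P) z" if "P \<in> \<P>" "vge P (- a P) z" for P z
    by (rule vge_mono[OF that]) (use assms[OF that(1)] in simp)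
  then show ?thesis by (auto simp: L_def)
qed

text \<open>Raising the divisor by one at \<open>P\<close> enlarges the space by at most
  \<open>pdeg P\<close>: multiplication by a uniformizer power of exponent \<open>a P + 1\<close>
  sends the larger space to the residue field, with the smaller one as kernel.\<close>

lemma dim_L_le:
  assumes "finite S" "S \<subseteq> \<P>" "fin_dim (L a')"
    and "\<And>P. a P \<le> a' P" "\<And>P. P \<notin> S \<Longrightarrow> a P = a' P"
  shows "int (vs.dim (L a')) \<le> int (vs.dim (L a)) + (\<Sum>P\<in>S. (a' P - a P) * int (pdeg P))"
  using assms(4,5)
proof (induction "\<Sum>P\<in>S. nat (a' P - a P)" arbitrary: a)
  case 0
  have "a' P = a P" for P
  proof (cases "P \<in> S")
    case True
    then have "nat (a' P - a P) = 0" using 0(1) assms(1) by simp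
    then show ?thesis using 0(2)[of P] by simp
  qed (simp add: 0(3))
  then have "a' = a" by (rule ext)
  then show ?case by simp
next
  case (Suc m)
  have "\<exists>P\<in>S. nat (a' P - a P) \<noteq> 0"
  proof (rule ccontr)
    assume "\<not> ?thesis"
    then have "(\<Sum>P\<in>S. nat (a' P - a P)) = 0" by (intro sum.neutral) blast
    then show False using Suc(2) by linarith
  qed
  then obtain P where PS: "P \<in> S" and aP: "a P < a' P" by auto
  have P: "P \<in> \<P>" using PS assms(2) by blast
  define e where "e = a(P := a P + 1)"
  have le: "e Q \<le> a' Q" for Q using Suc(3)[of Q] aP by (auto simp: e_def)
  have m: "m = (\<Sum>Q\<in>S. nat (a' Q - e Q))"
  proof -
    have "(\<Sum>Q\<in>S. nat (a' Q - a Q)) = nat (a' P - a P) + (\<Sum>Q\<in>S - {P}. nat (a' Q - a Q))"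
      using PS assms(1) by (simp add: sum.remove)
    moreover have "(\<Sum>Q\<in>S. nat (a' Q - e Q)) = nat (a' P - e P) + (\<Sum>Q\<in>S - {P}. nat (a' Q - e Q))"
      using PS assms(1) by (simp add: sum.remove)
    moreover have "(\<Sum>Q\<in>S - {P}. nat (a' Q - e Q)) = (\<Sum>Q\<in>S - {P}. nat (a' Q - a Q))"
      by (rule sum.cong) (auto simp: e_def)
    moreover have "nat (a' P - a P) = Suc (nat (a' P - e P))" using aP by (simp add: e_def)
    ultimately show ?thesis using Suc(2) by linarith
  qed
  have out: "e Q = a' Q" if "Q \<notin> S" for Q
    using Suc(4)[OF that] that PS by (auto simp: e_def)
  have IH: "int (vs.dim (L a')) \<le> int (vs.dim (L e)) + (\<Sum>P\<in>S. (a' P - e P) * int (pdeg P))"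
    by (rule Suc(1)[OF m le out])
  have sum_eq: "(\<Sum>Q\<in>S. (a' Q - a Q) * int (pdeg Q)) =
      (\<Sum>Q\<in>S. (a' Q - e Q) * int (pdeg Q)) + int (pdeg P)"
  proof -
    have "(\<Sum>Q\<in>S. (a' Q - a Q) * int (pdeg Q)) =
        (\<Sum>Q\<in>S. (a' Q - e Q) * int (pdeg Q) + (if Q = P then int (pdeg P) else 0))"
      by (rule sum.cong) (simp_all add: e_def left_diff_distrib distrib_right)
    then show ?thesis using PS assms(1) by (simp add: sum.distrib)
  qed
  obtain B where B: "finite B" "basis_modulo (scale_via \<iota>) (\<O> P) P B" "card B = pdeg P"
    by (rule residue_basis'[OF P])
  obtain \<pi> where pi: "\<pi> \<noteq> 0" "\<pi> \<in> F" "val P \<pi> = 1" using uniformizer_val[OF P] .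
  define s where "s = \<pi> powi (a P + 1)"
  have s: "s \<in> F" "s \<noteq> 0" "val P s = a P + 1"
    using pi F_powi val_powi[OF P pi(2,1)] by (auto simp: s_def)
  have fe: "fin_dim (L e)"
  proof -
    have "L e \<subseteq> L a'" by (rule L_mono) (rule le)
    then show ?thesis using assms(3) unfolding fin_dim_def by (meson order_trans)
  qed
  have "vs.dim (L e) \<le> vs.dim (L a) + card B"
  proof (rule dim_le_add_quotient[OF fe L_subspace L_subspace _ P_subspace[OF P] B(1), where s = s and R = "\<O> P"])
    show "L a \<subseteq> L e" by (rule L_mono) (simp add: e_def)
    show "\<exists>w\<in>P. v - w \<in> vs.span B" if "v \<in> \<O> P" for v
      by (rule basis_moduloD(3)[OF B(2) that])
  next
    fix z assume z: "z \<in> L e"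
    then have zF: "z \<in> F" and zP: "vge P (- a P - 1) z" using P by (auto simp: L_def e_def)
    have *: "z \<noteq> 0 \<Longrightarrow> val P (s * z) = a P + 1 + val P z" using val_mult[OF P s(1,2) zF] s(3) by simp
    have szF: "s * z \<in> F" using s(1) zF F_mult by blast
    show "s * z \<in> \<O> P"
    proof (cases "z = 0")
      case False
      then have "vge P 0 (s * z)" using zP * by (simp add: vge_def)
      then show ?thesis using vge_0_iff[OF P szF] by blast
    qed (simp add: R_0[OF P])
    assume "s * z \<in> P"
    then have "vge P 1 (s * z)" using vge_1_iff[OF P szF] by blast
    then have "vge P (- a P) z" using * s(2) by (cases "z = 0") (simp_all add: vge_def)
    moreover have "vge Q (- a Q) z" if Q: "Q \<in> \<P>" "Q \<noteq> P" for Q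
    proof -
      have "vge Q (- e Q) z" using z Q(1) by (simp add: L_def)
      then show ?thesis using Q(2) by (simp add: e_def)
    qed
    ultimately show "z \<in> L a" using zF by (auto simp: L_def)
  qed
  then show ?case using IH sum_eq B(3) by linarith
qed

lemma divisor_degree_eq:
  assumes "finite S" "keys D \<subseteq> S"
  shows "divisor_degree \<iota> F D = (\<Sum>P\<in>S. lookup D P * int (pdeg P))"
  unfolding divisor_degree_def
  by (rule sum.mono_neutral_left) (use assms in \<open>auto simp: in_keys_iff\<close>)

text \<open>It allows the maximum in the genus to be bounded on a cofinal family of
  divisors.\<close>

lemma divisor_degree_dim_mono:
  assumes D: "D \<in> divisors \<iota> F" "D' \<in> divisors \<iota> F"
    and le: "\<And>P. lookup D P \<le> lookup D' P"
    and "fin_dim (L (lookup D'))"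
  shows "divisor_degree \<iota> F D - int (divisor_dim \<iota> F D) \<le> divisor_degree \<iota> F D' - int (divisor_dim \<iota> F D')"
proof -
  define S where "S = keys D \<union> keys D'"
  have S: "finite S" "S \<subseteq> \<P>" using D by (auto simp: S_def divisors_def)
  have "int (vs.dim (L (lookup D'))) \<le> int (vs.dim (L (lookup D))) +
      (\<Sum>P\<in>S. (lookup D' P - lookup D P) * int (pdeg P))"
    using S by (rule dim_L_le) (use assms in \<open>auto simp: S_def in_keys_iff\<close>)
  moreover have "divisor_degree \<iota> F D = (\<Sum>P\<in>S. lookup D P * int (pdeg P))"
    "divisor_degree \<iota> F D' = (\<Sum>P\<in>S. lookup D' P * int (pdeg P))"
    using S by (auto intro!: divisor_degree_eq simp: S_def)
  ultimately show ?thesis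
    by (simp add: divisor_dim_def riemann_roch_space_eq left_diff_distrib sum_subtractf)
qed

end

section \<open>Existence of places above a subring\<close>

context field_between
begin

definition coeffs_in :: "'b set \<Rightarrow> 'b poly set" where
  "coeffs_in R = {p. \<forall>i. coeff p i \<in> R}"

text \<open>
  If \<open>1/s\<close> is a polynomial over \<open>R\<close> both in \<open>w\<close> and in \<open>1/w\<close>, the leading term of the
  expression of larger degree can be cancelled with the other one.
\<close>

lemma degree_reduction:
  assumes R: "\<And>u v. u \<in> R \<Longrightarrow> v \<in> R \<Longrightarrow> u - v \<in> R" "\<And>u v. u \<in> R \<Longrightarrow> v \<in> R \<Longrightarrow> u * v \<in> R"
    "1 \<in> R" and "s \<in> R" and "w \<noteq> 0"
    and p: "p \<in> coeffs_in R" "degree p \<le> n" "s * poly p w = 1"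
    and r: "r \<in> coeffs_in R" "degree r \<le> m" "s * poly r (inverse w) = 1"
    and "m \<le> n" "n \<ge> 1"
  shows "\<exists>p\<in>coeffs_in R. degree p \<le> n - 1 \<and> s * poly p w = 1"
proof -
  have R0: "0 \<in> R" using R(1)[OF R(3,3)] by simp
  have R_add: "u + v \<in> R" if "u \<in> R" "v \<in> R" for u v
    using R(1)[OF that(1) R(1)[OF R0 that(2)]] by simp
  have R_sum: "sum f I \<in> R" if "\<And>i. i \<in> I \<Longrightarrow> f i \<in> R" for f and I :: "nat set"
    using that by (induction I rule: infinite_finite_induct) (auto simp: R0 R_add)
  define a where "a = coeff p n"
  define b where "b = coeff r 0"
  define rr where "rr = (\<Sum>j\<le>m. monom (coeff r j) (n - j))"
  \<comment> \<open>\<open>rr\<close> is w^n r(1/w), so \<open>s * rr\<close> evaluates to w^n and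
    the last two terms cancel at \<open>w\<close>. The rest gives s b + (1 - s b) = 1, while the
    coefficient of degree \<open>n\<close> is (1 - s b) a - a + s a b = 0.\<close>
  define p' where "p' = [:b:] + Polynomial.smult (1 - s * b) p - monom a n + Polynomial.smult (s * a) rr"
  have a: "a \<in> R" and b: "b \<in> R" using p(1) r(1) by (auto simp: a_def b_def coeffs_in_def)
  have coeff_rr: "coeff rr i = (\<Sum>j\<le>m. if n - j = i then coeff r j else 0)" for i
    by (simp add: rr_def coeff_sum)
  have rr_R: "coeff rr i \<in> R" for i
    unfolding coeff_rr using r(1) R0 by (intro R_sum) (auto simp: coeffs_in_def)
  have "p' \<in> coeffs_in R"
    unfolding coeffs_in_def
  proof (rule CollectI, rule allI)
    fix i
    have "coeff [:b:] i \<in> R" using b R0 by (cases i) auto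
    moreover have "(1 - s * b) * coeff p i \<in> R"
      using p(1) R(1,2,3) \<open>s \<in> R\<close> b by (auto simp: coeffs_in_def)
    moreover have "coeff (monom a n) i \<in> R" using a R0 by simp
    moreover have "(s * a) * coeff rr i \<in> R" using R(2) \<open>s \<in> R\<close> a rr_R by blast
    ultimately show "coeff p' i \<in> R" unfolding p'_def by (simp only: coeff_add coeff_diff coeff_smult R_add R(1))
  qed
  moreover have "degree p' \<le> n - 1"
  proof (rule degree_le, intro allI impI)
    fix i assume "i > n - 1"
    then consider "i = n" | "i > n" using \<open>n \<ge> 1\<close> by linarith
    then show "coeff p' i = 0"
    proof cases
      case 1
      have "coeff rr n = (\<Sum>j\<le>m. if j = 0 then coeff r j else 0)"
        unfolding coeff_rr by (rule sum.cong) (use \<open>m \<le> n\<close> \<open>n \<ge> 1\<close> in auto)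
      then have "coeff rr n = b" by (simp add: b_def)
      moreover have "coeff [:b:] n = 0" using \<open>n \<ge> 1\<close> by (cases n) auto
      ultimately show ?thesis using 1 by (simp add: p'_def a_def algebra_simps)
    next
      case 2
      have "coeff rr i = 0" unfolding coeff_rr by (rule sum.neutral) (use 2 in auto)
      moreover have "coeff [:b:] i = 0" using 2 by (cases i) auto
      moreover have "coeff p i = 0" using 2 p(2) by (simp add: coeff_eq_0)
      ultimately show ?thesis using 2 by (simp add: p'_def)
    qed
  qed
  moreover have "s * poly p' w = 1"
  proof -
    have "poly rr w = (\<Sum>j\<le>m. coeff r j * w ^ (n - j))"
      by (simp add: rr_def poly_sum poly_monom)
    also have "\<dots> = (\<Sum>j\<le>m. w ^ n * (coeff r j * inverse w ^ j))"
    proof (rule sum.cong)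
      fix j assume "j \<in> {..m}"
      then have "w ^ n = w ^ (n - j) * w ^ j" using \<open>m \<le> n\<close> by (simp flip: power_add)
      then show "coeff r j * w ^ (n - j) = w ^ n * (coeff r j * inverse w ^ j)"
        using \<open>w \<noteq> 0\<close> by (simp add: field_simps)
    qed simp
    also have "\<dots> = w ^ n * (\<Sum>j\<le>m. coeff r j * inverse w ^ j)"
      by (simp only: sum_distrib_left)
    also have "(\<Sum>j\<le>m. coeff r j * inverse w ^ j) = poly r (inverse w)"
      unfolding poly_altdef by (rule sum.mono_neutral_right) (use r(2) in \<open>auto simp: coeff_eq_0\<close>)
    finally have "s * poly rr w = w ^ n" using r(3) by simp
    then have "s * poly p' w = s * b + (1 - s * b) * (s * poly p w) - s * (a * w ^ n) + s * a * (s * poly rr w)"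
      by (simp add: p'_def poly_monom algebra_simps)
    then show ?thesis using p(3) \<open>s * poly rr w = w ^ n\<close> by (simp add: mult.assoc)
  qed
  ultimately show ?thesis by blast
qed

text \<open>A subring containing \<open>A\<close> and maximal with respect to omitting 1/s is a
  valuation ring. Adjoining any outside element makes 1/s a polynomial in it; if \<open>z\<close>
  and 1/z were both outside, expressions of least degree could be shortened.\<close>

lemma place_exists:
  assumes A: "A \<subseteq> F" "range \<iota> \<subseteq> A" "\<And>u v. u \<in> A \<Longrightarrow> v \<in> A \<Longrightarrow> u - v \<in> A"
      "\<And>u v. u \<in> A \<Longrightarrow> v \<in> A \<Longrightarrow> u * v \<in> A"
    and s: "s \<in> A" "s \<noteq> 0" "inverse s \<notin> A"
  shows "\<exists>P\<in>\<P>. s \<in> P \<and> A \<subseteq> \<O> P"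
proof -
  define \<S> where "\<S> = {S. A \<subseteq> S \<and> S \<subseteq> F \<and> (\<forall>u\<in>S. \<forall>v\<in>S. u - v \<in> S \<and> u * v \<in> S) \<and> inverse s \<notin> S}"
  have "\<exists>M\<in>\<S>. \<forall>X\<in>\<S>. M \<subseteq> X \<longrightarrow> X = M"
  proof (rule subset_Zorn_nonempty)
    show "\<S> \<noteq> {}" using A s by (auto simp: \<S>_def intro!: exI[of _ A])
    fix C assume C: "C \<noteq> {}" "subset.chain \<S> C"
    have mem: "u - v \<in> \<Union>C \<and> u * v \<in> \<Union>C" if uv: "u \<in> \<Union>C" "v \<in> \<Union>C" for u v
    proof -
      obtain X Y where X: "X \<in> C" "u \<in> X" and Y: "Y \<in> C" "v \<in> Y" using uv by blast
      have "X \<subseteq> Y \<or> Y \<subseteq> X" using C(2) X Y by (auto simp: subset.chain_def)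
      then obtain Z where "Z \<in> C" "u \<in> Z" "v \<in> Z" using X Y by blast
      moreover have "Z \<in> \<S>" using \<open>Z \<in> C\<close> C(2) by (auto simp: subset.chain_def)
      ultimately have "u - v \<in> Z \<and> u * v \<in> Z" by (simp add: \<S>_def)
      then show ?thesis using \<open>Z \<in> C\<close> by blast
    qed
    have CS: "C \<subseteq> \<S>" using C(2) by (auto simp: subset.chain_def)
    have "A \<subseteq> \<Union>C" using C(1) CS by (force simp: \<S>_def)
    moreover have "\<Union>C \<subseteq> F" "inverse s \<notin> \<Union>C" using CS by (auto simp: \<S>_def)
    ultimately show "\<Union>C \<in> \<S>" using mem by (simp add: \<S>_def)
  qed
  then obtain R where R: "R \<in> \<S>" and max: "\<And>X. X \<in> \<S> \<Longrightarrow> R \<subseteq> X \<Longrightarrow> X = R" by blast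
  have RA: "A \<subseteq> R" and RF: "R \<subseteq> F" and R_diff: "\<And>u v. u \<in> R \<Longrightarrow> v \<in> R \<Longrightarrow> u - v \<in> R"
    and R_mult: "\<And>u v. u \<in> R \<Longrightarrow> v \<in> R \<Longrightarrow> u * v \<in> R" and s_inv: "inverse s \<notin> R"
    using R by (auto simp: \<S>_def)
  have R_hom: "\<iota> k \<in> R" for k using A(2) RA by blast
  have R1: "1 \<in> R" and R0: "0 \<in> R" using R_hom[of 1] R_hom[of 0] by simp_all
  have sR: "s \<in> R" using s RA by blast
  have R_add: "u + v \<in> R" if "u \<in> R" "v \<in> R" for u v
    using R_diff[OF that(1) R_diff[OF R0 that(2)]] by simp
  have R_sum: "sum f I \<in> R" if "\<And>i. i \<in> I \<Longrightarrow> f i \<in> R" for f and I :: "nat set"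
    using that by (induction I rule: infinite_finite_induct) (auto simp: R0 R_add)
  have expr: "\<exists>n. \<exists>p\<in>coeffs_in R. degree p \<le> n \<and> s * poly p w = 1" if w: "w \<in> F" "w \<notin> R" for w
  proof -
    define X where "X = (\<lambda>p. poly p w) ` coeffs_in R"
    have "R \<subseteq> X"
    proof
      fix u assume "u \<in> R"
      then show "u \<in> X" using R0
        by (auto simp: X_def coeffs_in_def coeff_pCons split: nat.split intro!: image_eqI[of _ _ "[:u:]"])
    qed
    moreover have "w \<in> X"
      using R0 R1 by (auto simp: X_def coeffs_in_def coeff_pCons split: nat.split intro!: image_eqI[of _ _ "[:0, 1:]"])
    ultimately have "X \<notin> \<S>" using max w by blast
    moreover have "X \<subseteq> F"
      using w(1) RF by (auto simp: X_def coeffs_in_def poly_altdef intro!: F_sum F_mult F_power)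
    moreover have "u - v \<in> X \<and> u * v \<in> X" if uv: "u \<in> X" "v \<in> X" for u v
    proof -
      obtain p r where p: "p \<in> coeffs_in R" "u = poly p w" and r: "r \<in> coeffs_in R" "v = poly r w"
        using uv by (auto simp: X_def)
      have "p - r \<in> coeffs_in R" using p r R_diff by (auto simp: coeffs_in_def)
      moreover have "p * r \<in> coeffs_in R"
        using p r by (auto simp: coeffs_in_def coeff_mult intro!: R_sum R_mult)
      ultimately have "poly (p - r) w \<in> X" "poly (p * r) w \<in> X" unfolding X_def by blast+
      then show ?thesis using p r by simp
    qed
    ultimately have "inverse s \<in> X" using \<open>R \<subseteq> X\<close> RA by (auto simp: \<S>_def)
    then obtain p where "p \<in> coeffs_in R" "inverse s = poly p w" by (auto simp: X_def)
    then show ?thesis using s(2) by (intro exI[of _ "degree p"] bexI[of _ p]) (auto simp: field_simps)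
  qed
  have cases: "z \<in> R \<or> inverse z \<in> R" if z: "z \<in> F" for z
  proof (rule ccontr)
    assume not: "\<not> (z \<in> R \<or> inverse z \<in> R)"
    then have z0: "z \<noteq> 0" "inverse z \<noteq> 0" using R0 by auto
    define E where "E = (\<lambda>w n. \<exists>p\<in>coeffs_in R. degree p \<le> n \<and> s * poly p w = 1)"
    define n where "n = (LEAST n. E z n)"
    define m where "m = (LEAST m. E (inverse z) m)"
    have n: "E z n" and m: "E (inverse z) m"
      unfolding n_def m_def
      using LeastI_ex[of "E z"] LeastI_ex[of "E (inverse z)"] expr[OF z] expr[OF F_inverse[OF z]] not
      unfolding E_def by blast+
    \<comment> \<open>A constant expression would be an inverse of \<open>s\<close> inside
      \<open>R\<close>.\<close>
    have pos: "k \<ge> 1" if k: "E w k" for w k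
    proof (rule ccontr)
      assume "\<not> k \<ge> 1"
      with k obtain p where p: "p \<in> coeffs_in R" "degree p = 0" "s * poly p w = 1"
        by (auto simp: E_def)
      from degree_eq_zeroE[OF p(2)] obtain e where e: "p = [:e:]" .
      then have "e \<in> R" using p(1) by (auto simp: coeffs_in_def dest: spec[of _ 0])
      moreover have "e = inverse s" using p(3) e s(2) by (simp add: inverse_unique)
      ultimately show False using s_inv by simp
    qed
    have red: "E w (k - 1)" if "w \<noteq> 0" "E w k" "E (inverse w) l" "l \<le> k" for w k l
      using degree_reduction[OF R_diff R_mult R1 sR that(1)] that pos[OF \<open>E w k\<close>] unfolding E_def by blast
    show False
    proof (cases "m \<le> n")
      case True
      then have "E z (n - 1)" using red[OF z0(1) n m] by simp
      then have "n \<le> n - 1" unfolding n_def by (rule Least_le)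
      then show False using pos[OF n] by simp
    next
      case False
      then have "E (inverse z) (m - 1)" using red[OF z0(2) m] n by simp
      then have "m \<le> m - 1" unfolding m_def by (rule Least_le)
      then show False using pos[OF m] by simp
    qed
  qed
  have "s \<notin> range \<iota>"
  proof
    assume "s \<in> range \<iota>"
    then obtain k where "s = \<iota> k" by blast
    then have "inverse s = \<iota> (inverse k)" by (simp add: hom_inverse)
    then show False using s_inv R_hom by simp
  qed
  moreover have "inverse s \<in> F" using s(1) A(1) F_inverse by blast
  ultimately have V: "valuation_ring \<iota> F R"
    unfolding valuation_ring_def using RF R_hom sR s_inv R_diff R_mult cases by blast
  define P where "P = {u\<in>R. u = 0 \<or> inverse u \<notin> R}"
  have "P \<in> \<P>" using V by (auto simp: places_iff P_def)
  moreover have "s \<in> P" using sR s_inv by (simp add: P_def)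
  moreover have "A \<subseteq> \<O> P" using RA place_ring_nonunits[OF V] by (simp add: P_def)
  ultimately show ?thesis by blast
qed

end

section \<open>The genus from an integral basis\<close>

text \<open>At this stage \<open>n\<close> is only an upper bound for [F : K(t)], since
  \<open>b\<close> spans but need not be independent.\<close>

locale function_field = field_between +
  fixes t :: 'b and n :: nat and b :: "nat \<Rightarrow> 'b"
  assumes t_F: "t \<in> F" and t_trans: "transcendental_via \<iota> t"
    and F_span: "F \<subseteq> frac_span t n b"
begin

lemma ev_t_eq_0_iff [simp]: "ev f t = 0 \<longleftrightarrow> f = 0"
  using t_trans by (auto simp: transcendental_iff)

lemma ev_t_eq_iff: "ev f t = ev g t \<longleftrightarrow> f = g"
  using ev_t_eq_0_iff[of "f - g"] by (simp add: ev_diff)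

lemma t_neq_0 [simp]: "t \<noteq> 0"
  using ev_t_eq_0_iff[of "[:0, 1:]"] by auto

lemma degree_bound_ev: "degree_bound (ev f t) (n * degree f)"
  unfolding degree_bound_def
proof (intro allI impI)
  fix I :: "nat set" and g assume *: "finite I" "g ` I \<subseteq> F" "poly_indep (ev f t) I g"
  show "card I \<le> n * degree f"
  proof (rule poly_indep_card_le[OF t_trans *(1) order_trans[OF *(2) F_span] *(3), of 1])
    fix L k :: nat assume "k < L"
    then have "degree (f ^ k) \<le> L * degree f"
      using degree_power_le[of f k] by (metis less_imp_le mult.commute mult_le_mono1 order_trans)
    then show "\<exists>g. degree g \<le> L * degree f \<and> 1 ^ L * ev f t ^ k = ev g t"
      by (intro exI[of _ "f ^ k"]) (simp add: ev_power)
  qed simp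
qed

text \<open>The factor \<open>t ^ L\<close> turns the powers of 1/t of exponent below
  \<open>L\<close> into polynomials in \<open>t\<close> of degree at most \<open>L\<close>.\<close>

lemma degree_bound_inverse_t: "degree_bound (inverse t) n"
  unfolding degree_bound_def
proof (intro allI impI)
  fix I :: "nat set" and g assume *: "finite I" "g ` I \<subseteq> F" "poly_indep (inverse t) I g"
  have "card I \<le> n * 1"
  proof (rule poly_indep_card_le[OF t_trans *(1) order_trans[OF *(2) F_span] *(3), of t])
    fix L k :: nat assume "k < L"
    then have "t ^ L * inverse t ^ k = ev (monom 1 (L - k)) t"
      by (simp add: ev_monom field_simps flip: power_add)
    then show "\<exists>g. degree g \<le> L * 1 \<and> t ^ L * inverse t ^ k = ev g t"
      by (intro exI[of _ "monom 1 (L - k)"]) (simp add: degree_monom_eq)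
  qed simp
  then show "card I \<le> n" by simp
qed

text \<open>If all nonzero polynomials in \<open>t\<close> were units at \<open>P\<close>, the
  powers of a nonzero element of \<open>P\<close> would be independent over K(t), since the lowest
  coefficient of a relation lies in \<open>P\<close>.\<close>

lemma finite_place_contains_polynomial:
  assumes P: "P \<in> \<P>" and "t \<in> \<O> P"
  obtains f where "f \<noteq> 0" "ev f t \<in> P"
proof (rule ccontr)
  assume "\<not> thesis"
  then have unit: "\<And>f. f \<noteq> 0 \<Longrightarrow> ev f t \<notin> P" using that by blast
  obtain z where z: "z \<in> F" "z \<notin> \<O> P" using R_neq[OF P] R_F[OF P] by blast
  define w where "w = inverse z"
  have w: "w \<in> P" unfolding w_def by (rule P_if_not_R[OF P z])
  have w0: "w \<noteq> 0" using z(2) R_0[OF P] by (auto simp: w_def)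
  have "poly_indep t {..n} (\<lambda>i. w ^ i)"
    unfolding poly_indep_def
  proof (intro allI impI, rule ccontr)
    fix p assume p: "(\<Sum>i\<le>n. ev (p i) t * w ^ i) = 0" "\<not> (\<forall>i\<in>{..n}. p i = 0)"
    then obtain j where j: "p j \<noteq> 0"
      "ev (p j) t = w * (- (\<Sum>i\<in>{Suc j..n}. ev (p i) t * w ^ (i - Suc j)))"
      using lowest_term_relation[OF w0 p(1), of "\<lambda>i. p i \<noteq> 0"] by auto
    have "- (\<Sum>i\<in>{Suc j..n}. ev (p i) t * w ^ (i - Suc j)) \<in> \<O> P"
      using assms w P_R[OF P] by (intro R_minus[OF P] R_sum[OF P] R_mult[OF P] R_ev[OF P] R_power[OF P]) auto
    then have "ev (p j) t \<in> P" unfolding j(2) using P_mult'[OF P w] by blast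
    then show False using unit j(1) by blast
  qed
  then have "card {..n} \<le> n * degree [:0, 1 :: 'a:]"
    using degree_boundD[OF degree_bound_ev[of "[:0, 1:]"], of "{..n}" "\<lambda>i. w ^ i"] z F_power F_inverse
    by (auto simp: w_def)
  then show False by simp
qed

sublocale discrete_field \<iota> F
proof
  fix P assume P: "P \<in> \<P>"
  show "\<exists>s N. s \<in> P \<and> s \<noteq> 0 \<and> degree_bound s N"
  proof (cases "t \<in> \<O> P")
    case True
    then obtain f where "f \<noteq> 0" "ev f t \<in> P" using finite_place_contains_polynomial[OF P] by blast
    then show ?thesis using degree_bound_ev by (intro exI[of _ "ev f t"]) auto
  next
    case False
    then show ?thesis
      using P_if_not_R[OF P t_F] degree_bound_inverse_t by (intro exI[of _ "inverse t"]) auto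
  qed
qed

text \<open>A nonconstant polynomial is not invertible in K[t], so a place above K[t] contains
  it.\<close>

lemma finite_place_exists:
  assumes "degree f > 0"
  obtains P where "P \<in> \<P>" "t \<in> \<O> P" "ev f t \<in> P"
proof -
  have [simp]: "f \<noteq> 0" using assms by auto
  have not_inv: "inverse (ev f t) \<notin> range (\<lambda>p. ev p t)"
  proof
    assume "inverse (ev f t) \<in> range (\<lambda>p. ev p t)"
    then obtain g where "inverse (ev f t) = ev g t" by blast
    then have "ev (f * g) t = 1" by (metis ev_mult ev_t_eq_0_iff \<open>f \<noteq> 0\<close> right_inverse)
    then have "f * g = 1" using ev_t_eq_iff[of "f * g" 1] by simp
    then have "degree (f * g) = 0" by simp
    moreover have "g \<noteq> 0" using \<open>f * g = 1\<close> by auto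
    ultimately show False using assms by (simp add: degree_mult_eq)
  qed
  have "\<iota> k = ev [:k:] t" for k by simp
  then have A_hom: "range \<iota> \<subseteq> range (\<lambda>p. ev p t)" by blast
  have A_ring: "u - v \<in> range (\<lambda>p. ev p t)" "u * v \<in> range (\<lambda>p. ev p t)"
    if "u \<in> range (\<lambda>p. ev p t)" "v \<in> range (\<lambda>p. ev p t)" for u v
    using that by (auto simp flip: ev_diff ev_mult)
  have AF: "range (\<lambda>p. ev p t) \<subseteq> F" using F_ev[OF t_F] by blast
  have ev_f: "ev f t \<in> range (\<lambda>p. ev p t)" by blast
  have "ev f t \<noteq> 0" by simp
  have "\<exists>P\<in>\<P>. ev f t \<in> P \<and> range (\<lambda>p. ev p t) \<subseteq> \<O> P"
    by (rule place_exists) fact+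
  then obtain P where P: "P \<in> \<P>" "ev f t \<in> P" "range (\<lambda>p. ev p t) \<subseteq> \<O> P"
    by blast
  have "t = ev [:0, 1:] t" by simp
  then have "t \<in> \<O> P" using P(3) by blast
  with P show thesis using that by blast
qed

lemma infinite_place_exists:
  obtains P where "P \<in> \<P>" "t \<notin> \<O> P"
proof -
  define A where "A = range (\<lambda>p. ev p (inverse t))"
  have "t \<notin> A"
  proof
    assume "t \<in> A"
    then obtain p where p: "t = ev p (inverse t)" by (auto simp: A_def)
    \<comment> \<open>The reversed polynomial: t = p(1/t) would give r(t) = t^(deg p + 1), although
      \<open>r\<close> has degree at most deg p.\<close>
    define r where "r = (\<Sum>i\<le>degree p. monom (coeff p i) (degree p - i))"
    have "ev r t = (\<Sum>i\<le>degree p. \<iota> (coeff p i) * t ^ (degree p - i))"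
      by (simp add: r_def ev_sum ev_monom)
    also have "\<dots> = (\<Sum>i\<le>degree p. t ^ degree p * (\<iota> (coeff p i) * inverse t ^ i))"
    proof (rule sum.cong)
      fix i assume "i \<in> {..degree p}"
      then have "t ^ degree p = t ^ (degree p - i) * t ^ i" by (simp flip: power_add)
      then show "\<iota> (coeff p i) * t ^ (degree p - i) = t ^ degree p * (\<iota> (coeff p i) * inverse t ^ i)"
        by (simp add: field_simps)
    qed simp
    also have "\<dots> = t ^ degree p * ev p (inverse t)"
      by (simp add: ev_altdef[OF order.refl] sum_distrib_left)
    finally have "ev r t = ev (monom 1 (Suc (degree p))) t" using p by (simp add: ev_monom)
    then have "r = monom 1 (Suc (degree p))" by (simp only: ev_t_eq_iff)
    moreover have "degree r \<le> degree p"
      unfolding r_def by (intro degree_sum_le) (auto intro: degree_monom_le[THEN order_trans])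
    ultimately show False by (simp add: degree_monom_eq)
  qed
  have "\<iota> k = ev [:k:] (inverse t)" for k by simp
  then have A_hom: "range \<iota> \<subseteq> A" unfolding A_def by blast
  have A_ring: "u - v \<in> A" "u * v \<in> A" if "u \<in> A" "v \<in> A" for u v
    using that by (auto simp: A_def simp flip: ev_diff ev_mult)
  have "inverse t = ev [:0, 1:] (inverse t)" by simp
  then have tA: "inverse t \<in> A" unfolding A_def by blast
  have AF: "A \<subseteq> F" using F_ev F_inverse[OF t_F] by (auto simp: A_def)
  have "inverse t \<noteq> 0" "inverse (inverse t) \<notin> A" using \<open>t \<notin> A\<close> by simp_all
  have "\<exists>P\<in>\<P>. inverse t \<in> P \<and> A \<subseteq> \<O> P"
    by (rule place_exists) fact+
  then obtain P where P: "P \<in> \<P>" "inverse t \<in> P" by blast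
  have "t \<notin> \<O> P"
    using P_iff[OF P(1), of "inverse t"] P(2) by simp
  with P show thesis using that by blast
qed

lemma val_ev_infinite:
  assumes P: "P \<in> \<P>" "t \<notin> \<O> P" and "f \<noteq> 0"
  shows "val P (ev f t) = int (degree f) * val P t"
  using \<open>f \<noteq> 0\<close>
proof (induction f)
  case (pCons a f)
  have t: "val P t < 0" using R_iff_val[OF P(1) t_F] P(2) by simp
  show ?case
  proof (cases "f = 0")
    case True
    then show ?thesis using pCons val_hom[OF P(1)] by auto
  next
    case False
    then have IH: "val P (ev f t) = int (degree f) * val P t" using pCons by blast
    have v: "val P (t * ev f t) = int (Suc (degree f)) * val P t"
      using val_mult[OF P(1) t_F _ F_ev[OF t_F]] False IH by (simp add: algebra_simps)
    show ?thesis
    proof (cases "a = 0")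
      case True
      then show ?thesis using v False by simp
    next
      case a: False
      have "val P (t * ev f t) < val P (\<iota> a)"
        unfolding v val_hom[OF P(1) a] using t by (simp add: mult_pos_neg)
      then have "val P (t * ev f t + \<iota> a) = val P (t * ev f t)"
        using a False by (intro val_add_eq(2)[OF P(1)]) (auto simp: F_mult t_F F_ev)
      then show ?thesis using v False by (simp add: add.commute)
    qed
  qed
qed simp
end

section \<open>The divisors \<open>(f)\<^sub>0 + l (t)\<^sub>\<infinity>\<close> and their
  Riemann-Roch spaces\<close>

context function_field
begin

text \<open>The space \<open>L(l (t)\<^sub>\<infinity>)\<close>, written with valuation rings
  instead of valuations, so that automorphisms fixing \<open>t\<close> transport it
  directly.\<close>

definition L_int :: "nat \<Rightarrow> 'b set" where
  "L_int l = {z\<in>F. \<forall>P\<in>\<P>. (t \<in> \<O> P \<longrightarrow> z \<in> \<O> P) \<and>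
      (t \<notin> \<O> P \<longrightarrow> z / t ^ l \<in> \<O> P)}"

text \<open>The divisor \<open>(f)\<^sub>0 + l (t)\<^sub>\<infinity>\<close>, where \<open>(f)\<^sub>0\<close> is the zero divisor of \<open>f(t)\<close>.\<close>

definition fdiv :: "'a poly \<Rightarrow> nat \<Rightarrow> 'b set \<Rightarrow>\<^sub>0 int" where
  "fdiv f l = Abs_poly_mapping (\<lambda>P. if P \<in> \<P> then
      if t \<in> \<O> P then val P (ev f t) else - int l * val P t else 0)"

definition zeros :: "'a poly \<Rightarrow> 'b set set" where
  "zeros f = {P\<in>\<P>. t \<in> \<O> P \<and> ev f t \<in> P}"

definition poles :: "'b set set" where
  "poles = {P\<in>\<P>. t \<notin> \<O> P}"

lemma poles_eq: "poles = {P\<in>\<P>. inverse t \<in> P}"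
  using P_if_not_R[OF _ t_F] P_iff[of _ "inverse t"] by (auto simp: poles_def)

lemma inverse_t: "inverse t \<in> F" "inverse t \<noteq> 0"
  using F_inverse[OF t_F] by auto

lemma finite_poles: "finite poles"
  unfolding poles_eq by (rule finite_zeros[OF inverse_t degree_bound_inverse_t])

lemma finite_zeros_ev: "f \<noteq> 0 \<Longrightarrow> finite (zeros f)"
  using finite_zeros[OF F_ev[OF t_F] _ degree_bound_ev] by (rule finite_subset[rotated]) (auto simp: zeros_def)

lemma val_ev_nonneg: "P \<in> \<P> \<Longrightarrow> t \<in> \<O> P \<Longrightarrow> f \<noteq> 0 \<Longrightarrow> 0 \<le> val P (ev f t)"
  using R_iff_val[of P "ev f t"] R_ev[of P t f] F_ev[OF t_F] by simp

lemma val_t_neg: "P \<in> poles \<Longrightarrow> val P t \<le> - 1"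
  using R_iff_val[of P t] t_F by (auto simp: poles_def)

lemma lookup_fdiv:
  assumes "f \<noteq> 0"
  shows "lookup (fdiv f l) = (\<lambda>P. if P \<in> \<P> then
      if t \<in> \<O> P then val P (ev f t) else - int l * val P t else 0)"
  unfolding fdiv_def
proof (rule Abs_poly_mapping_inverse, rule CollectI, rule finite_subset)
  show "finite (zeros f \<union> poles)" using finite_poles finite_zeros_ev[OF assms] by simp
  have "val P (ev f t) = 0" if "P \<in> \<P>" "t \<in> \<O> P" "P \<notin> zeros f" for P
  proof -
    have "\<not> 1 \<le> val P (ev f t)"
      using that P_iff_val[OF that(1) F_ev[OF t_F, of f]] assms by (auto simp: zeros_def)
    then show ?thesis using val_ev_nonneg[OF that(1,2) assms] by linarith
  qed
  then show "{P. (if P \<in> \<P> then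
      if t \<in> \<O> P then val P (ev f t) else - int l * val P t else 0) \<noteq> 0} \<subseteq> zeros f \<union> poles"
    by (auto simp: poles_def split: if_splits)
qed

lemma keys_fdiv: "f \<noteq> 0 \<Longrightarrow> keys (fdiv f l) \<subseteq> zeros f \<union> poles"
proof
  fix P assume f: "f \<noteq> 0" and "P \<in> keys (fdiv f l)"
  then have P: "P \<in> \<P>" "t \<in> \<O> P \<Longrightarrow> val P (ev f t) \<noteq> 0"
    by (auto simp: in_keys_iff lookup_fdiv split: if_splits)
  show "P \<in> zeros f \<union> poles"
  proof (cases "t \<in> \<O> P")
    case True
    then have "1 \<le> val P (ev f t)" using P val_ev_nonneg[OF P(1) True f] by force
    then show ?thesis using True P P_iff_val[OF P(1) F_ev[OF t_F, of f]] f by (auto simp: zeros_def)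
  qed (use P in \<open>auto simp: poles_def\<close>)
qed

lemma fdiv_in_divisors: "f \<noteq> 0 \<Longrightarrow> fdiv f l \<in> divisors \<iota> F"
  using keys_fdiv[of f l] by (auto simp: divisors_def zeros_def poles_def)

definition pole_degree :: int where
  "pole_degree = (\<Sum>P\<in>poles. - val P t * int (pdeg P))"

lemma pole_degree_le: "pole_degree \<le> int n"
proof -
  have "(\<Sum>P\<in>poles. nat (val P (inverse t)) * pdeg P) \<le> n"
    by (rule zero_degree_le[OF inverse_t degree_bound_inverse_t finite_poles]) (simp add: poles_eq)
  moreover have "int (\<Sum>P\<in>poles. nat (val P (inverse t)) * pdeg P) = pole_degree"
    unfolding pole_degree_def of_nat_sum
  proof (rule sum.cong)
    fix P assume P: "P \<in> poles"
    then have "val P (inverse t) = - val P t" using val_inverse[OF _ t_F] by (auto simp: poles_def)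
    then show "int (nat (val P (inverse t)) * pdeg P) = - val P t * int (pdeg P)"
      using val_t_neg[OF P] by simp
  qed simp
  ultimately show ?thesis by linarith
qed

lemma divisor_degree_fdiv:
  assumes f: "f \<noteq> 0"
  shows "divisor_degree \<iota> F (fdiv f l) \<le> int (n * degree f) + int l * pole_degree"
    and "f = 1 \<Longrightarrow> divisor_degree \<iota> F (fdiv f l) = int l * pole_degree"
proof -
  have disj: "zeros f \<inter> poles = {}" by (auto simp: zeros_def poles_def)
  let ?z = "\<Sum>P\<in>zeros f. val P (ev f t) * int (pdeg P)"
  have "divisor_degree \<iota> F (fdiv f l) =
      (\<Sum>P\<in>zeros f \<union> poles. lookup (fdiv f l) P * int (pdeg P))"
    by (rule divisor_degree_eq) (use keys_fdiv[OF f] finite_poles finite_zeros_ev[OF f] in auto)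
  also have "\<dots> = (\<Sum>P\<in>zeros f. lookup (fdiv f l) P * int (pdeg P)) +
      (\<Sum>P\<in>poles. lookup (fdiv f l) P * int (pdeg P))"
    by (rule sum.union_disjoint[OF finite_zeros_ev[OF f] finite_poles disj])
  also have "(\<Sum>P\<in>zeros f. lookup (fdiv f l) P * int (pdeg P)) = ?z"
    by (rule sum.cong) (auto simp: lookup_fdiv[OF f] zeros_def)
  also have "(\<Sum>P\<in>poles. lookup (fdiv f l) P * int (pdeg P)) = int l * pole_degree"
    unfolding pole_degree_def sum_distrib_left
    by (rule sum.cong) (auto simp: lookup_fdiv[OF f] poles_def)
  finally have eq: "divisor_degree \<iota> F (fdiv f l) = ?z + int l * pole_degree" .
  have "(\<Sum>P\<in>zeros f. nat (val P (ev f t)) * pdeg P) \<le> n * degree f"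
    by (rule zero_degree_le[OF F_ev[OF t_F] _ degree_bound_ev finite_zeros_ev[OF f]])
      (use f in \<open>auto simp: zeros_def\<close>)
  moreover have "int (\<Sum>P\<in>zeros f. nat (val P (ev f t)) * pdeg P) = ?z"
    unfolding of_nat_sum
    by (rule sum.cong) (use val_ev_nonneg f in \<open>auto simp: zeros_def\<close>)
  ultimately have "?z \<le> int (n * degree f)" by linarith
  with eq show "divisor_degree \<iota> F (fdiv f l) \<le> int (n * degree f) + int l * pole_degree" by simp
  show "divisor_degree \<iota> F (fdiv f l) = int l * pole_degree" if "f = 1"
  proof -
    have "zeros f = {}" using that P_not_1 by (auto simp: zeros_def)
    then show ?thesis using eq by simp
  qed
qed

text \<open>The divisor of f(t) is \<open>(f)\<^sub>0\<close> minus deg f times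
  \<open>(t)\<^sub>\<infinity>\<close>, so multiplication by f(t) trades the finite zeros for poles
  at infinity.\<close>

lemma L_fdiv_iff:
  assumes f: "f \<noteq> 0"
  shows "z \<in> L (lookup (fdiv f l)) \<longleftrightarrow> ev f t * z \<in> L_int (l + degree f)"
proof (cases "z = 0")
  case True
  then show ?thesis using R_0 by (auto simp: L_def L_int_def vge_def)
next
  case False
  have ft: "ev f t \<in> F" "ev f t \<noteq> 0" using F_ev[OF t_F] f by auto
  have F_iff: "z \<in> F \<longleftrightarrow> ev f t * z \<in> F"
    using ft F_mult F_divide by (metis nonzero_mult_div_cancel_left)
  have "vge P (- lookup (fdiv f l) P) z \<longleftrightarrow>
      (t \<in> \<O> P \<longrightarrow> ev f t * z \<in> \<O> P) \<and>
      (t \<notin> \<O> P \<longrightarrow> ev f t * z / t ^ (l + degree f) \<in> \<O> P)"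
    if z: "z \<in> F" and P: "P \<in> \<P>" for P
  proof -
    have fz: "ev f t * z \<in> F" "ev f t * z \<noteq> 0" using F_iff z ft False by auto
    have v: "val P (ev f t * z) = val P (ev f t) + val P z" by (rule val_mult[OF P ft z False])
    show ?thesis
    proof (cases "t \<in> \<O> P")
      case True
      then show ?thesis using v P False R_iff_val[OF P fz] by (auto simp: lookup_fdiv[OF f] vge_def)
    next
      case tP: False
      have tl: "t ^ (l + degree f) \<in> F" "t ^ (l + degree f) \<noteq> 0" using F_power[OF t_F] by auto
      have "val P (ev f t * z / t ^ (l + degree f)) = val P z - int l * val P t"
        using val_divide[OF P fz tl] v val_ev_infinite[OF P tP f] val_power[OF P t_F, of "l + degree f"]
        by (simp add: algebra_simps)
      moreover have "ev f t * z / t ^ (l + degree f) \<in> F" using fz tl F_divide by blast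
      ultimately have "ev f t * z / t ^ (l + degree f) \<in> \<O> P \<longleftrightarrow> int l * val P t \<le> val P z"
        using R_iff_val[OF P, of "ev f t * z / t ^ (l + degree f)"] fz tl by simp
      then show ?thesis using tP P False by (simp add: lookup_fdiv[OF f] vge_def)
    qed
  qed
  then show ?thesis using F_iff unfolding L_def L_int_def by blast
qed

lemma L_int_eq: "L_int l = L (lookup (fdiv 1 l))"
  using L_fdiv_iff[of 1 _ l] by auto

text \<open>Each finite place of the support contains some polynomial in \<open>t\<close>; high
  powers of these dominate the finite part, and a large \<open>l\<close> the infinite part. The
  parameter \<open>l0\<close> lets the caller force \<open>l\<close> into the range of the dimension
  formula.\<close>

lemma divisor_le_fdiv:
  assumes "D \<in> divisors \<iota> F"
  obtains f l where "f \<noteq> 0" "l \<ge> l0" "\<And>P. lookup D P \<le> lookup (fdiv f l) P"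
proof -
  let ?D = "lookup D"
  define S where "S = {P\<in>keys D. t \<in> \<O> P}"
  have finS: "finite S" by (simp add: S_def)
  have S: "S \<subseteq> \<P>" using assms by (auto simp: S_def divisors_def)
  have "\<exists>f. f \<noteq> 0 \<and> ev f t \<in> P" if P: "P \<in> S" for P
  proof -
    have "P \<in> \<P>" "t \<in> \<O> P" using P S by (auto simp: S_def)
    then show ?thesis by (rule finite_place_contains_polynomial) blast
  qed
  then obtain g where g: "\<And>P. P \<in> S \<Longrightarrow> g P \<noteq> 0 \<and> ev (g P) t \<in> P" by metis
  define f where "f = (\<Prod>P\<in>S. g P ^ nat \<bar>?D P\<bar>)"
  define l where "l = l0 + nat (\<Sum>P\<in>keys D. \<bar>?D P\<bar>)"
  have f0: "f \<noteq> 0" using g finS by (simp add: f_def)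
  have "?D P \<le> lookup (fdiv f l) P" for P
  proof (cases "P \<in> keys D")
    case False
    then have "?D P = 0" by (simp add: in_keys_iff)
    moreover have "0 \<le> - int l * val P t" if "P \<in> poles"
      using val_t_neg[OF that] by (simp add: mult_nonneg_nonpos)
    ultimately show ?thesis using val_ev_nonneg f0 by (auto simp: lookup_fdiv[OF f0] poles_def)
  next
    case key: True
    then have P: "P \<in> \<P>" using assms by (auto simp: divisors_def)
    show ?thesis
    proof (cases "t \<in> \<O> P")
      case True
      then have PS: "P \<in> S" using key by (simp add: S_def)
      define k where "k = nat \<bar>?D P\<bar>"
      define r where "r = (\<Prod>P\<in>S - {P}. g P ^ nat \<bar>?D P\<bar>)"
      have fr: "f = g P ^ k * r" unfolding f_def r_def k_def by (rule prod.remove[OF finS PS])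
      have r0: "r \<noteq> 0" and g0: "g P \<noteq> 0" using f0 g[OF PS] by (auto simp: fr)
      have "val P (ev f t) = int k * val P (ev (g P) t) + val P (ev r t)"
        unfolding fr ev_mult ev_power
        using val_mult[OF P F_power[OF F_ev[OF t_F]] _ F_ev[OF t_F], of "g P" k r] val_power[OF P F_ev[OF t_F], of "g P" k]
          r0 g0 by simp
      moreover have "1 \<le> val P (ev (g P) t)"
        using g[OF PS] P_iff_val(1)[OF P F_ev[OF t_F], of "g P"] by auto
      then have "int k * 1 \<le> int k * val P (ev (g P) t)" by (intro mult_left_mono) auto
      moreover have "0 \<le> val P (ev r t)" by (rule val_ev_nonneg[OF P True r0])
      moreover have "?D P \<le> int k" by (simp add: k_def)
      ultimately show ?thesis using P True by (simp add: lookup_fdiv[OF f0])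
    next
      case False
      have "\<bar>?D P\<bar> \<le> (\<Sum>P\<in>keys D. \<bar>?D P\<bar>)"
        by (rule member_le_sum[OF key]) auto
      then have "?D P \<le> int l" by (simp add: l_def)
      also have "int l * 1 \<le> int l * (- val P t)"
        using val_t_neg[of P] P False by (intro mult_left_mono) (auto simp: poles_def)
      finally show ?thesis using P False by (simp add: lookup_fdiv[OF f0])
    qed
  qed
  moreover have "l \<ge> l0" by (simp add: l_def)
  ultimately show thesis using f0 that by blast
qed

end

text \<open>Membership in the spaces \<open>L_int l\<close> is decided coordinate by coordinate.
  Here \<open>d j\<close> is the pole order of \<open>b j\<close> at infinity in multiples of that
  of \<open>t\<close>, rounded up.\<close>

locale integral_basis = function_field +
  fixes d :: "nat \<Rightarrow> nat"
  assumes b_indep: "poly_indep t {..<n} b"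
    and L_int_basis: "L_int l = {(\<Sum>j<n. ev (c j) t * b j) | c. \<forall>j<n. c j = 0 \<or> degree (c j) + d j \<le> l}"
begin

lemma dim_L_int:
  assumes "\<And>j. j < n \<Longrightarrow> d j \<le> l"
  shows "fin_dim (L_int l)" "int (vs.dim (L_int l)) = int n * (int l + 1) - (\<Sum>j<n. int (d j))"
proof -
  define I where "I = Sigma {..<n} (\<lambda>j. {..l - d j})"
  define h where "h = (\<lambda>(j, i). t ^ i * b j)"
  have finI: "finite I" by (simp add: I_def)
  have h_mem: "h x \<in> L_int l" if xI: "x \<in> I" for x
  proof -
    obtain j i where x: "x = (j, i)" "j < n" "i \<le> l - d j" using xI by (auto simp: I_def)
    define c where "c = (\<lambda>k. if k = j then monom (1::'a) i else 0)"
    have "(\<Sum>k<n. ev (c k) t * b k) = (\<Sum>k<n. if k = j then t ^ i * b j else 0)"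
      by (rule sum.cong) (auto simp: c_def ev_monom)
    then have "h x = (\<Sum>k<n. ev (c k) t * b k)" using x by (simp add: h_def)
    moreover have "\<forall>k<n. c k = 0 \<or> degree (c k) + d k \<le> l"
      using x assms[OF x(2)] by (auto simp: c_def degree_monom_eq)
    ultimately show ?thesis unfolding L_int_basis by blast
  qed
  have span: "L_int l \<subseteq> vs.span (h ` I)"
  proof
    fix z assume "z \<in> L_int l"
    then obtain c where z: "z = (\<Sum>j<n. ev (c j) t * b j)" and c: "\<And>j. j < n \<Longrightarrow> c j = 0 \<or> degree (c j) + d j \<le> l"
      unfolding L_int_basis by blast
    have "ev (c j) t * b j \<in> vs.span (h ` I)" if j: "j < n" for j
    proof -
      have "degree (c j) \<le> l - d j" using c[OF j] by auto
      then have "ev (c j) t * b j = (\<Sum>i\<le>l - d j. scale_via \<iota> (coeff (c j) i) (h (j, i)))"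
        by (simp add: ev_altdef sum_distrib_right h_def scale_via_def mult.assoc)
      also have "\<dots> \<in> vs.span (h ` I)"
        by (intro vs.span_sum vs.span_scale vs.span_base imageI) (use j in \<open>simp add: I_def\<close>)
      finally show ?thesis .
    qed
    then show "z \<in> vs.span (h ` I)" unfolding z by (intro vs.span_sum) simp
  qed
  have ind: "indep_mod {0} I h"
    unfolding indep_mod_def
  proof (intro allI impI)
    fix a assume a: "(\<Sum>x\<in>I. \<iota> (a x) * h x) \<in> {0}"
    define p where "p = (\<lambda>j. \<Sum>i\<le>l - d j. monom (a (j, i)) i)"
    have "(\<Sum>x\<in>I. \<iota> (a x) * h x) = (\<Sum>j<n. \<Sum>i\<le>l - d j. \<iota> (a (j, i)) * h (j, i))"
      unfolding I_def by (subst sum.Sigma) auto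
    also have "\<dots> = (\<Sum>j<n. ev (p j) t * b j)"
      by (rule sum.cong) (auto simp: p_def ev_sum ev_monom sum_distrib_right h_def mult.assoc)
    finally have "\<forall>j\<in>{..<n}. p j = 0" using a b_indep by (simp add: poly_indep_def)
    moreover have "coeff (p j) i = a (j, i)" if "i \<le> l - d j" for i j
      using that by (simp add: p_def coeff_sum)
    note this[symmetric]
    ultimately show "\<forall>x\<in>I. a x = 0" by (auto simp: I_def)
  qed
  note indep = indep_mod_0_independent[OF finI ind]
  show "fin_dim (L_int l)" using span finI unfolding fin_dim_def by blast
  have "vs.dim (L_int l) = card (h ` I)"
    by (rule vs.dim_unique[OF _ span indep(2)]) (use h_mem in auto)
  also have "\<dots> = card I" by (rule card_image[OF indep(1)])
  also have "\<dots> = (\<Sum>j<n. l - d j + 1)" by (simp add: I_def)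
  also have "int \<dots> = (\<Sum>j<n. int l + 1 - int (d j))"
    unfolding of_nat_sum by (rule sum.cong) (use assms in \<open>auto simp: of_nat_diff\<close>)
  also have "\<dots> = int n * (int l + 1) - (\<Sum>j<n. int (d j))" by (simp add: sum_subtractf)
  finally show "int (vs.dim (L_int l)) = int n * (int l + 1) - (\<Sum>j<n. int (d j))" .
qed

text \<open>Multiplication by f(t) carries the space into \<open>L_int (l + degree f)\<close>, which
  gives finiteness; division by f(t) embeds the latter back, which gives the inequality that the
  upper bound for the genus uses.\<close>

lemma dim_fdiv:
  assumes "\<And>j. j < n \<Longrightarrow> d j \<le> l" and f: "f \<noteq> 0"
  shows "fin_dim (L (lookup (fdiv f l)))"
    "vs.dim (L_int (l + degree f)) \<le> vs.dim (L (lookup (fdiv f l)))"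
proof -
  let ?V = "L (lookup (fdiv f l))" and ?W = "L_int (l + degree f)"
  have ft: "ev f t \<noteq> 0" using f by simp
  have dl: "d j \<le> l + degree f" if "j < n" for j using assms(1)[OF that] by simp
  obtain B where B: "finite B" "?W \<subseteq> vs.span B" using dim_L_int(1)[OF dl] by (auto simp: fin_dim_def)
  have "?V \<subseteq> vs.span ((*) (inverse (ev f t)) ` B)"
  proof
    fix z assume "z \<in> ?V"
    then have "ev f t * z \<in> vs.span B" using B(2) L_fdiv_iff[OF f] by blast
    then obtain c where "ev f t * z = (\<Sum>v\<in>B. scale_via \<iota> (c v) v)"
      using vs.span_finite[OF B(1)] by auto
    then have "inverse (ev f t) * (ev f t * z) = (\<Sum>v\<in>B. scale_via \<iota> (c v) (inverse (ev f t) * v))"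
      by (simp add: sum_distrib_left scale_via_def mult.left_commute)
    moreover have "inverse (ev f t) * (ev f t * z) = z" using ft by (simp flip: mult.assoc)
    ultimately have "z = (\<Sum>v\<in>B. scale_via \<iota> (c v) (inverse (ev f t) * v))" by simp
    also have "\<dots> \<in> vs.span ((*) (inverse (ev f t)) ` B)"
      by (intro vs.span_sum vs.span_scale vs.span_base imageI)
    finally show "z \<in> vs.span ((*) (inverse (ev f t)) ` B)" .
  qed
  then show fV: "fin_dim ?V" using B(1) unfolding fin_dim_def by blast
  obtain C where C: "finite C" "{} \<subseteq> C" "C \<subseteq> ?V" "vs.independent C" "?V = vs.span C" "vs.dim ?V = card C"
    by (rule fin_dim_basis[OF fV L_subspace empty_subsetI vs.independent_empty])
  have W: "vs.subspace ?W" unfolding L_int_eq by (rule L_subspace)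
  have "vs.dim ?W \<le> vs.dim {0} + card C"
  proof (rule dim_le_add_quotient[OF dim_L_int(1)[OF dl] W vs.subspace_single_0 _ vs.subspace_single_0 C(1),
        where s = "inverse (ev f t)" and R = ?V])
    show "{0} \<subseteq> ?W" using subspaceD(1)[OF W] by simp
    show "\<exists>w\<in>{0}. v - w \<in> vs.span C" if "v \<in> ?V" for v using that C(5) by simp
    show "inverse (ev f t) * z \<in> ?V" if "z \<in> ?W" for z
      using that ft unfolding L_fdiv_iff[OF f] by (simp add: mult.assoc[symmetric])
    show "z \<in> {0}" if "z \<in> ?W" "inverse (ev f t) * z \<in> {0}" for z using that ft by simp
  qed
  moreover have "vs.dim {0} = 0"
    using vs.dim_span[of "{}"] vs.dim_eq_card_independent[OF vs.independent_empty] by simp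
  ultimately show "vs.dim ?W \<le> vs.dim ?V" using C(6) by simp
qed

text \<open>The dimension of \<open>L_int l\<close> grows like n l, but raising the divisor step by
  step allows a growth of at most \<open>pole_degree\<close> per unit of \<open>l\<close>.\<close>

lemma pole_degree_eq: "pole_degree = int n"
proof (rule antisym[OF pole_degree_le], rule ccontr)
  assume "\<not> int n \<le> pole_degree"
  then have less: "pole_degree \<le> int n - 1" by simp
  let ?a = "\<lambda>_::'b set. 0::int"
  \<comment> \<open>\<open>l\<close> is at least every \<open>d j\<close> and exceeds the constants
    that remain once the multiples of \<open>l * n\<close> cancel.\<close>
  define l where "l = (\<Sum>j<n. d j) + vs.dim (L ?a) + 1"
  have dl: "d j \<le> l" if "j < n" for j
    using member_le_sum[of j "{..<n}" d] that by (simp add: l_def)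
  have pos: "0 \<le> lookup (fdiv 1 l) P" for P
    using val_t_neg[of P] val_1 by (auto simp: lookup_fdiv poles_def mult_nonneg_nonpos)
  have sup: "lookup (fdiv 1 l) P = 0" if "P \<notin> poles" for P
    using that val_1 by (auto simp: lookup_fdiv poles_def)
  have "int (vs.dim (L (lookup (fdiv 1 l)))) \<le> int (vs.dim (L ?a)) +
      (\<Sum>P\<in>poles. (lookup (fdiv 1 l) P - 0) * int (pdeg P))"
    by (rule dim_L_le[OF finite_poles])
      (use dim_L_int(1)[OF dl] pos sup in \<open>auto simp: L_int_eq poles_def\<close>)
  also have "(\<Sum>P\<in>poles. (lookup (fdiv 1 l) P - 0) * int (pdeg P)) = int l * pole_degree"
    unfolding pole_degree_def sum_distrib_left
    by (rule sum.cong) (auto simp: lookup_fdiv poles_def)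
  finally have "int (vs.dim (L_int l)) \<le> int (vs.dim (L ?a)) + int l * pole_degree"
    unfolding L_int_eq .
  moreover have "int l * pole_degree \<le> int l * (int n - 1)" using less by (rule mult_left_mono) simp
  ultimately have "int n * (int l + 1) - (\<Sum>j<n. int (d j)) \<le> int (vs.dim (L ?a)) + int l * (int n - 1)"
    using dim_L_int(2)[OF dl] by linarith
  then have "int l + int n \<le> int (vs.dim (L ?a)) + (\<Sum>j<n. int (d j))" by (simp add: algebra_simps)
  then show False by (simp add: l_def)
qed

theorem genus_eq: "genus \<iota> F = 1 - int n + (\<Sum>j<n. int (d j))"
  unfolding genus_def
proof (rule Greatest_equality)
  define l0 where "l0 = (\<Sum>j<n. d j)"
  have dl: "d j \<le> l" if "j < n" "l0 \<le> l" for j l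
    using member_le_sum[of j "{..<n}" d] that by (simp add: l0_def)
  have "1 - int n + (\<Sum>j<n. int (d j)) =
      divisor_degree \<iota> F (fdiv 1 l0) - int (divisor_dim \<iota> F (fdiv 1 l0)) + 1"
    using divisor_degree_fdiv(2)[of 1 l0] dim_L_int(2)[OF dl, of l0]
    by (simp add: divisor_dim_def riemann_roch_space_eq flip: L_int_eq) (simp add: pole_degree_eq algebra_simps)
  then show "\<exists>D\<in>divisors \<iota> F. 1 - int n + (\<Sum>j<n. int (d j)) = divisor_degree \<iota> F D - int (divisor_dim \<iota> F D) + 1"
    using fdiv_in_divisors[of 1 l0] by auto
  fix g assume "\<exists>D\<in>divisors \<iota> F. g = divisor_degree \<iota> F D - int (divisor_dim \<iota> F D) + 1"
  then obtain D where D: "D \<in> divisors \<iota> F" "g = divisor_degree \<iota> F D - int (divisor_dim \<iota> F D) + 1" by blast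
  obtain f l where f: "f \<noteq> 0" "l \<ge> l0" "\<And>P. lookup D P \<le> lookup (fdiv f l) P"
    using divisor_le_fdiv[OF D(1)] by metis
  note dl' = dl[OF _ f(2)]
  have "divisor_degree \<iota> F D - int (divisor_dim \<iota> F D)
      \<le> divisor_degree \<iota> F (fdiv f l) - int (divisor_dim \<iota> F (fdiv f l))"
    by (rule divisor_degree_dim_mono[OF D(1) fdiv_in_divisors[OF f(1)] f(3) dim_fdiv(1)[OF dl' f(1)]])
  moreover have "divisor_degree \<iota> F (fdiv f l) \<le> int (n * degree f) + int l * int n"
    using divisor_degree_fdiv(1)[OF f(1)] by (simp add: pole_degree_eq)
  moreover have "int (vs.dim (L_int (l + degree f))) = int n * (int (l + degree f) + 1) - (\<Sum>j<n. int (d j))"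
    by (rule dim_L_int(2)) (use dl' in \<open>auto intro: trans_le_add1\<close>)
  moreover have "vs.dim (L_int (l + degree f)) \<le> divisor_dim \<iota> F (fdiv f l)"
    using dim_fdiv(2)[OF dl' f(1)] by (simp add: divisor_dim_def riemann_roch_space_eq)
  ultimately show "g \<le> 1 - int n + (\<Sum>j<n. int (d j))"
    unfolding D(2) by (simp add: algebra_simps)
qed

end

section \<open>Kummer extensions\<close>

lemma field_homomorphismD:
  assumes "field_homomorphism \<phi>"
  shows "\<phi> 1 = 1" "\<phi> 0 = 0" "\<phi> (u + v) = \<phi> u + \<phi> v" "\<phi> (u * v) = \<phi> u * \<phi> v" "\<phi> (- u) = - \<phi> u"
    "\<phi> (u - v) = \<phi> u - \<phi> v" "\<phi> (inverse u) = inverse (\<phi> u)" "\<phi> (u / v) = \<phi> u / \<phi> v" "\<phi> (u ^ k) = \<phi> u ^ k"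
    "\<phi> (sum f A) = (\<Sum>i\<in>A. \<phi> (f i))"
proof -
  interpret h: field_extension \<phi> by unfold_locales (rule assms)
  show "\<phi> 1 = 1" "\<phi> 0 = 0" "\<phi> (u + v) = \<phi> u + \<phi> v" "\<phi> (u * v) = \<phi> u * \<phi> v" "\<phi> (- u) = - \<phi> u"
    "\<phi> (u - v) = \<phi> u - \<phi> v" "\<phi> (inverse u) = inverse (\<phi> u)" "\<phi> (u / v) = \<phi> u / \<phi> v" "\<phi> (u ^ k) = \<phi> u ^ k"
    "\<phi> (sum f A) = (\<Sum>i\<in>A. \<phi> (f i))"
    by (simp_all add: h.hom_add h.hom_mult h.hom_minus h.hom_diff h.hom_inverse divide_inverse h.hom_power h.hom_sum)
qed

lemma field_homomorphism_funpow:
  fixes f :: "'f::field \<Rightarrow> 'f"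
  shows "field_homomorphism f \<Longrightarrow> field_homomorphism (f ^^ k)"
  by (induction k) (auto simp: field_homomorphism_def)

lemma primitive_root_power_eq_1_iff:
  assumes "primitive_root_of_unity N \<zeta>" "N > 0"
  shows "\<zeta> ^ k = 1 \<longleftrightarrow> N dvd k"
proof -
  have *: "\<zeta> ^ k = \<zeta> ^ (k mod N)"
  proof -
    have "\<zeta> ^ k = (\<zeta> ^ N) ^ (k div N) * \<zeta> ^ (k mod N)" by (simp flip: power_mult power_add)
    then show ?thesis using assms(1) by (simp add: primitive_root_of_unity_def)
  qed
  have "k mod N < N" using assms(2) by simp
  then show ?thesis unfolding * using assms(1)
    by (cases "k mod N = 0") (auto simp: primitive_root_of_unity_def dvd_eq_mod_eq_0)
qed

lemma sum_power_root_of_unity: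
  fixes \<mu> :: "'k::field"
  assumes "\<mu> ^ N = 1" "\<mu> \<noteq> 1"
  shows "(\<Sum>k<N. \<mu> ^ k) = 0"
  using geometric_sum[OF assms(2), of N] assms(1) by simp

section \<open>The field generated by \<open>t\<close> and an \<open>N\<close>-th root of a
  polynomial in \<open>t\<close>\<close>

context field_extension
begin

definition poly_span :: "'f \<Rightarrow> nat \<Rightarrow> 'f \<Rightarrow> 'f set" where
  "poly_span t N X = range (\<lambda>c. \<Sum>i<N. ev (c i) t * X ^ i)"

lemma poly_spanI: "z = (\<Sum>i<N. ev (c i) t * X ^ i) \<Longrightarrow> z \<in> poly_span t N X"
  by (simp add: poly_span_def)

lemma frac_span_iff:
  "z \<in> frac_span t N (\<lambda>i. X ^ i) \<longleftrightarrow> (\<exists>D. D \<noteq> 0 \<and> ev D t * z \<in> poly_span t N X)"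
  by (auto simp: frac_span_def poly_span_def)

lemma poly_span_add: "u \<in> poly_span t N X \<Longrightarrow> v \<in> poly_span t N X \<Longrightarrow> u + v \<in> poly_span t N X"
proof -
  assume "u \<in> poly_span t N X" "v \<in> poly_span t N X"
  then obtain c e where c: "u = (\<Sum>i<N. ev (c i) t * X ^ i)" and e: "v = (\<Sum>i<N. ev (e i) t * X ^ i)"
    by (auto simp: poly_span_def)
  have "u + v = (\<Sum>i<N. ev (c i + e i) t * X ^ i)"
    by (simp add: c e ev_add distrib_right sum.distrib)
  then show ?thesis by (rule poly_spanI)
qed

lemma poly_span_ev_mult: "u \<in> poly_span t N X \<Longrightarrow> ev p t * u \<in> poly_span t N X"
proof -
  assume "u \<in> poly_span t N X"
  then obtain c where c: "u = (\<Sum>i<N. ev (c i) t * X ^ i)" by (auto simp: poly_span_def)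
  have "ev p t * u = (\<Sum>i<N. ev (p * c i) t * X ^ i)"
    by (simp add: c ev_mult sum_distrib_left mult.assoc)
  then show ?thesis by (rule poly_spanI)
qed

lemma poly_span_0: "0 \<in> poly_span t N X"
  by (rule poly_spanI[where c = "\<lambda>_. 0"]) simp

lemma poly_span_sum: "(\<And>i. i \<in> I \<Longrightarrow> f i \<in> poly_span t N X) \<Longrightarrow> sum f I \<in> poly_span t N X"
  by (induction I rule: infinite_finite_induct) (auto intro: poly_span_add poly_span_0)

lemma poly_span_diff: "u \<in> poly_span t N X \<Longrightarrow> v \<in> poly_span t N X \<Longrightarrow> u - v \<in> poly_span t N X"
  using poly_span_add[of u t N X "ev [:- 1:] t * v"] poly_span_ev_mult[of v t N X "[:- 1:]"]
  by (simp add: hom_minus)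

context
  fixes t X :: 'f and N :: nat and r :: "'k poly"
  assumes N: "N > 0" and XN: "X ^ N = ev r t"
begin

lemma poly_span_power: "X ^ k \<in> poly_span t N X"
proof (induction k rule: less_induct)
  case (less k)
  show ?case
  proof (cases "k < N")
    case True
    have "(\<Sum>i<N. ev (if i = k then 1 else 0) t * X ^ i) = (\<Sum>i<N. if i = k then X ^ i else 0)"
      by (rule sum.cong) auto
    also have "\<dots> = X ^ k" using True by simp
    finally show ?thesis by (rule poly_spanI[OF sym])
  next
    case False
    then have "X ^ k = ev r t * X ^ (k - N)" by (simp flip: XN power_add)
    then show ?thesis using less[of "k - N"] False N poly_span_ev_mult by simp
  qed
qed

lemma poly_span_mult: "u \<in> poly_span t N X \<Longrightarrow> v \<in> poly_span t N X \<Longrightarrow> u * v \<in> poly_span t N X"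
proof -
  assume u: "u \<in> poly_span t N X" and "v \<in> poly_span t N X"
  then obtain c e where c: "u = (\<Sum>i<N. ev (c i) t * X ^ i)" and e: "v = (\<Sum>i<N. ev (e i) t * X ^ i)"
    by (auto simp: poly_span_def)
  have "u * v = (\<Sum>i<N. \<Sum>j<N. ev (c i * e j) t * X ^ (i + j))"
    by (simp add: c e sum_product ev_mult power_add mult_ac)
  also have "\<dots> \<in> poly_span t N X"
    by (intro poly_span_sum poly_span_ev_mult poly_span_power)
  finally show ?thesis .
qed

text \<open>Closure under inverses is the point: the \<open>N + 1\<close> powers of \<open>z\<close>
  up to the exponent \<open>N\<close> are dependent over K(t), and in a relation the lowest
  coefficient is \<open>z\<close> times an element of the span. Dividing by both exhibits
  1/z.\<close>

lemma frac_span_intermediate_field: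
  assumes t: "transcendental_via \<iota> t"
  shows "intermediate_field \<iota> (frac_span t N (\<lambda>i. X ^ i))" (is "intermediate_field \<iota> ?E")
    and "t \<in> frac_span t N (\<lambda>i. X ^ i)" "X \<in> frac_span t N (\<lambda>i. X ^ i)"
proof -
  have E_ev: "ev p t \<in> ?E" for p
    using poly_span_ev_mult[OF poly_span_power[of 0], of p]
    by (auto simp: frac_span_iff intro!: exI[of _ 1])
  have hom_E: "\<iota> k \<in> ?E" for k using E_ev[of "[:k:]"] by simp
  show "t \<in> ?E" using E_ev[of "[:0, 1:]"] by simp
  show "X \<in> ?E" using poly_span_power[of 1] by (auto simp: frac_span_iff intro!: exI[of _ 1])
  have E_diff: "u - v \<in> ?E" and E_mult: "u * v \<in> ?E" if uv: "u \<in> ?E" "v \<in> ?E" for u v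
  proof -
    obtain D C where D: "D \<noteq> 0" "ev D t * u \<in> poly_span t N X" and C: "C \<noteq> 0" "ev C t * v \<in> poly_span t N X"
      using uv by (auto simp: frac_span_iff)
    have "ev C t * (ev D t * u) - ev D t * (ev C t * v) \<in> poly_span t N X"
      by (rule poly_span_diff[OF poly_span_ev_mult[OF D(2)] poly_span_ev_mult[OF C(2)]])
    then have "ev (D * C) t * (u - v) \<in> poly_span t N X" by (simp add: ev_mult algebra_simps)
    then show "u - v \<in> ?E" using D C unfolding frac_span_iff by (intro exI[of _ "D * C"]) simp
    have "(ev D t * u) * (ev C t * v) \<in> poly_span t N X" by (rule poly_span_mult[OF D(2) C(2)])
    then have "ev (D * C) t * (u * v) \<in> poly_span t N X" by (simp add: ev_mult mult_ac)
    then show "u * v \<in> ?E" using D C unfolding frac_span_iff by (intro exI[of _ "D * C"]) simp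
  qed
  have E_power: "u ^ k \<in> ?E" if "u \<in> ?E" for u k
    using that hom_E[of 1] by (induction k) (simp_all add: E_mult)
  have E_add: "u + v \<in> ?E" if "u \<in> ?E" "v \<in> ?E" for u v
    using E_diff[OF that(1) E_diff[OF _ that(2), of 0]] hom_E[of 0] by simp
  have E_sum: "sum f I \<in> ?E" if "\<And>i. i \<in> I \<Longrightarrow> f i \<in> ?E" for f and I :: "nat set"
    using that hom_E[of 0] by (induction I rule: infinite_finite_induct) (simp_all add: E_add)
  have E_inverse: "inverse z \<in> ?E" if z: "z \<in> ?E" for z
  proof (cases "z = 0")
    case False
    have "\<not> poly_indep t {..N} (\<lambda>i. z ^ i)"
    proof
      assume ind: "poly_indep t {..N} (\<lambda>i. z ^ i)"
      have "card {..N} \<le> N * 1"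
      proof (rule poly_indep_card_le[OF t _ _ ind, of N "\<lambda>i. X ^ i" 1])
        fix L k :: nat assume "k < L"
        then show "\<exists>g. degree g \<le> L * 1 \<and> 1 ^ L * t ^ k = ev g t"
          by (intro exI[of _ "monom 1 k"]) (simp add: ev_monom degree_monom_eq)
      qed (use E_power[OF z] in auto)
      then show False by simp
    qed
    then obtain p where p: "(\<Sum>i\<le>N. ev (p i) t * z ^ i) = 0" "\<exists>i\<le>N. p i \<noteq> 0"
      by (auto simp: poly_indep_def)
    then obtain j where j: "p j \<noteq> 0" "ev (p j) t = z * (- (\<Sum>i\<in>{Suc j..N}. ev (p i) t * z ^ (i - Suc j)))"
      (is "_ = z * (- ?S)")
      using lowest_term_relation[OF False p(1), of "\<lambda>i. p i \<noteq> 0"] by auto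
    have "?S \<in> ?E" by (intro E_sum E_mult E_ev E_power z)
    then have "- ?S \<in> ?E" using E_diff[of 0 ?S] hom_E[of 0] by simp
    then obtain D where D: "D \<noteq> 0" "ev D t * (- ?S) \<in> poly_span t N X" by (auto simp: frac_span_iff)
    have "ev (D * p j) t * inverse z = ev D t * (- ?S)"
      unfolding ev_mult j(2) using False by (simp add: mult_ac)
    then show ?thesis using D j(1) unfolding frac_span_iff by (intro exI[of _ "D * p j"]) simp
  qed (use hom_E[of 0] in simp)
  show "intermediate_field \<iota> ?E"
    unfolding intermediate_field_def using hom_E E_diff E_mult E_inverse by blast
qed

end

end

section \<open>Automorphisms acting on spaces of integral elements\<close>

context function_field
begin

text \<open>The preimage of a valuation ring under \<open>\<phi>\<close> is again one, and it
  contains \<open>t\<close> exactly when the original does. The conditions on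
  \<open>\<phi> z\<close> at \<open>P\<close> are those on \<open>z\<close> at the preimage
  place.\<close>

lemma automorphism_L_int:
  assumes \<phi>: "field_homomorphism \<phi>" "\<And>k. \<phi> (\<iota> k) = \<iota> k" "\<phi> ` F = F" "\<phi> t = t"
    and z: "z \<in> L_int l"
  shows "\<phi> z \<in> L_int l"
proof -
  note hom = field_homomorphismD[OF \<phi>(1)]
  have zF: "z \<in> F" using z by (simp add: L_int_def)
  have \<phi>F: "\<phi> u \<in> F" if "u \<in> F" for u using \<phi>(3) that by blast
  have "(t \<in> \<O> P \<longrightarrow> \<phi> z \<in> \<O> P) \<and>
      (t \<notin> \<O> P \<longrightarrow> \<phi> z / t ^ l \<in> \<O> P)" if P: "P \<in> \<P>" for P
  proof -
    define R where "R = {u\<in>F. \<phi> u \<in> \<O> P}"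
    have V: "valuation_ring \<iota> F (\<O> P)" by (rule valuation_ring_place_ring[OF P])
    have "valuation_ring \<iota> F R"
      unfolding valuation_ring_def
    proof (intro conjI psubsetI)
      show "range \<iota> \<subseteq> R" using R_hom[OF P] \<phi>(2) by (auto simp: R_def)
      obtain u where u: "u \<in> \<O> P" "u \<notin> range \<iota>" using V by (auto simp: valuation_ring_def)
      then obtain v where v: "v \<in> F" "u = \<phi> v" using \<phi>(3) R_F[OF P] by blast
      then have "v \<in> R" "v \<notin> range \<iota>" using u \<phi>(2) by (auto simp: R_def)
      then show "range \<iota> \<noteq> R" by blast
      obtain u' where u': "u' \<in> F" "u' \<notin> \<O> P" using V by (auto simp: valuation_ring_def)
      then obtain v' where "v' \<in> F" "u' = \<phi> v'" using \<phi>(3) by blast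
      then show "R \<noteq> F" using u' by (auto simp: R_def)
      show "\<forall>u\<in>R. \<forall>v\<in>R. u - v \<in> R \<and> u * v \<in> R"
        using R_diff[OF P] R_mult[OF P] by (auto simp: R_def hom F_diff F_mult)
      show "\<forall>z\<in>F. z \<in> R \<or> inverse z \<in> R"
        using R_cases[OF P \<phi>F] by (auto simp: R_def hom F_inverse)
    qed (auto simp: R_def)
    define Q where "Q = {u\<in>R. u = 0 \<or> inverse u \<notin> R}"
    have Q: "Q \<in> \<P>" "\<O> Q = R"
      using \<open>valuation_ring \<iota> F R\<close> place_ring_nonunits by (auto simp: Q_def places_iff)
    have tR: "t \<in> R \<longleftrightarrow> t \<in> \<O> P" using \<phi>(4) t_F by (simp add: R_def)
    have "(t \<in> R \<longrightarrow> z \<in> R) \<and> (t \<notin> R \<longrightarrow> z / t ^ l \<in> R)" using z Q by (auto simp: L_int_def)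
    then show ?thesis unfolding tR by (auto simp: R_def hom \<phi>(4))
  qed
  then show ?thesis using \<phi>F[OF zF] by (simp add: L_int_def)
qed

lemma L_int_sum_scale: "(\<And>i. i \<in> I \<Longrightarrow> f i \<in> L_int l) \<Longrightarrow> (\<Sum>i\<in>I. \<iota> (c i) * f i) \<in> L_int l"
  unfolding L_int_eq by (rule subspace_sum_scale[OF L_subspace])

end

text \<open>\<open>N_neq_0\<close> permits averaging over powers of \<open>\<sigma>\<close>, and
  \<open>generators\<close> says that K(t, X) is the whole field. Independence of the powers of
  \<open>X\<close> is derived from their eigenvalues.\<close>

locale kummer_extension = field_extension +
  fixes \<sigma> :: "'b \<Rightarrow> 'b" and t X :: 'b and N :: nat and \<zeta> :: 'a and r :: "'a poly"
  assumes \<sigma>_bij: "bij \<sigma>" and \<sigma>_hom: "field_homomorphism \<sigma>" and \<sigma>_\<iota>: "\<sigma> (\<iota> k) = \<iota> k"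
    and t_transcendental: "transcendental_via \<iota> t" and \<sigma>_t: "\<sigma> t = t" and \<sigma>_X: "\<sigma> X = \<iota> \<zeta> * X"
    and primitive: "primitive_root_of_unity N \<zeta>" and N_pos: "N > 0" and N_neq_0: "of_nat N \<noteq> (0 :: 'a)"
    and X_neq_0: "X \<noteq> 0" and X_power: "X ^ N = ev r t"
    and generators: "intermediate_field \<iota> E \<Longrightarrow> t \<in> E \<Longrightarrow> X \<in> E \<Longrightarrow> E = UNIV"
begin

lemma frac_span_UNIV: "frac_span t N (\<lambda>i. X ^ i) = UNIV"
  using frac_span_intermediate_field[OF N_pos X_power t_transcendental] generators by blast

lemma ev_t_eq_0: "ev p t = 0 \<longleftrightarrow> p = 0"
  using t_transcendental by (auto simp: transcendental_iff)

lemma \<zeta>_neq_0: "\<zeta> \<noteq> 0"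
  using primitive N_pos by (auto simp: primitive_root_of_unity_def power_0_left)

lemmas \<zeta>_power_eq_1_iff = primitive_root_power_eq_1_iff[OF primitive N_pos]

lemma funpow_hom: "field_homomorphism (\<sigma> ^^ k)"
  by (rule field_homomorphism_funpow[OF \<sigma>_hom])

lemma funpow_\<iota>: "(\<sigma> ^^ k) (\<iota> a) = \<iota> a" and funpow_t: "(\<sigma> ^^ k) t = t"
  by (induction k) (simp_all add: \<sigma>_\<iota> \<sigma>_t)

lemma funpow_ev: "(\<sigma> ^^ k) (ev p t) = ev p t"
  by (induction p)
    (simp_all add: field_homomorphismD[OF funpow_hom] funpow_\<iota> funpow_t)

lemma funpow_X: "(\<sigma> ^^ k) X = \<iota> (\<zeta> ^ k) * X"
  by (induction k) (simp_all add: \<sigma>_X field_homomorphismD[OF \<sigma>_hom] \<sigma>_\<iota> hom_mult mult_ac)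

lemma funpow_term: "(\<sigma> ^^ k) (ev p t * X ^ i) = \<iota> ((\<zeta> ^ i) ^ k) * (ev p t * X ^ i)"
proof -
  have "(\<zeta> ^ k) ^ i = (\<zeta> ^ i) ^ k" by (simp flip: power_mult add: mult.commute)
  then show ?thesis
    by (simp add: field_homomorphismD[OF funpow_hom] funpow_ev funpow_X power_mult_distrib mult_ac flip: hom_power)
qed

text \<open>The projector onto the eigenspace of \<open>\<sigma>\<close> for the eigenvalue
  \<open>\<zeta> ^ j\<close>. Being a K-combination of powers of \<open>\<sigma>\<close>, it
  preserves every K-subspace stable under \<open>\<sigma>\<close>.\<close>

definition eigen_proj :: "nat \<Rightarrow> 'b \<Rightarrow> 'b" where
  "eigen_proj j z = (\<Sum>k<N. \<iota> (inverse (of_nat N) * inverse (\<zeta> ^ j) ^ k) * (\<sigma> ^^ k) z)"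

lemma eigen_proj_sum:
  assumes "J \<subseteq> {..<N}" "j \<in> J" "z = (\<Sum>i\<in>J. ev (c i) t * X ^ i)"
  shows "eigen_proj j z = ev (c j) t * X ^ j"
proof -
  define \<mu> where "\<mu> = (\<lambda>i. \<zeta> ^ i * inverse (\<zeta> ^ j))"
  have geo: "(\<Sum>k<N. \<mu> i ^ k) = (if i = j then of_nat N else 0)" if "i \<in> J" for i
  proof (cases "i = j")
    case True
    then show ?thesis using \<zeta>_neq_0 by (simp add: \<mu>_def)
  next
    case False
    have "\<zeta> ^ N = 1" using primitive by (simp add: primitive_root_of_unity_def)
    then have "(\<zeta> ^ i) ^ N = 1" for i by (metis mult.commute power_mult power_one)
    then have "\<mu> i ^ N = 1" by (simp add: \<mu>_def power_mult_distrib power_inverse)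
    moreover have "\<mu> i \<noteq> 1"
    proof
      assume "\<mu> i = 1"
      then have eq: "\<zeta> ^ i = \<zeta> ^ j" using \<zeta>_neq_0 by (simp add: \<mu>_def field_simps)
      have ij: "i < N" "j < N" using assms(1,2) that by auto
      have contra: False if kl: "k < l" "l < N" "\<zeta> ^ k = \<zeta> ^ l" for k l
      proof -
        have "\<zeta> ^ l = \<zeta> ^ k * \<zeta> ^ (l - k)" using kl(1) by (simp flip: power_add)
        then have "\<zeta> ^ k * \<zeta> ^ (l - k) = \<zeta> ^ k * 1" using kl(3) by simp
        then have "\<zeta> ^ (l - k) = 1" using \<zeta>_neq_0 by (subst (asm) mult_cancel_left) simp
        then have "N dvd l - k" by (simp add: \<zeta>_power_eq_1_iff)
        then show False using kl by (auto dest: dvd_imp_le)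
      qed
      show False using contra[of i j] contra[of j i] eq ij False by (cases i j rule: linorder_cases) auto
    qed
    ultimately show ?thesis using False by (simp add: sum_power_root_of_unity)
  qed
  have "eigen_proj j z = (\<Sum>k<N. \<Sum>i\<in>J. \<iota> (inverse (of_nat N) * \<mu> i ^ k) * (ev (c i) t * X ^ i))"
    unfolding eigen_proj_def assms(3)
  proof (rule sum.cong)
    fix k
    show "\<iota> (inverse (of_nat N) * inverse (\<zeta> ^ j) ^ k) * (\<sigma> ^^ k) (\<Sum>i\<in>J. ev (c i) t * X ^ i) =
        (\<Sum>i\<in>J. \<iota> (inverse (of_nat N) * \<mu> i ^ k) * (ev (c i) t * X ^ i))"
      unfolding field_homomorphismD(10)[OF funpow_hom] funpow_term sum_distrib_left
      by (rule sum.cong) (simp_all add: \<mu>_def hom_mult power_mult_distrib mult_ac)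
  qed simp
  also have "\<dots> = (\<Sum>i\<in>J. \<iota> (inverse (of_nat N) * (\<Sum>k<N. \<mu> i ^ k)) * (ev (c i) t * X ^ i))"
    by (subst sum.swap) (simp add: hom_mult hom_sum sum_distrib_left sum_distrib_right)
  also have "\<dots> = (\<Sum>i\<in>J. if i = j then ev (c i) t * X ^ i else 0)"
    by (rule sum.cong) (use geo N_neq_0 in auto)
  also have "\<dots> = ev (c j) t * X ^ j" using assms(1,2) by (simp add: finite_subset[OF assms(1)])
  finally show ?thesis .
qed

lemma eigen_proj_0: "eigen_proj j 0 = 0"
  by (simp add: eigen_proj_def field_homomorphismD[OF funpow_hom])

lemma eigen_proj_ev_mult: "eigen_proj j (ev p t * z) = ev p t * eigen_proj j z"
  by (simp add: eigen_proj_def field_homomorphismD[OF funpow_hom] funpow_ev sum_distrib_left mult.left_commute)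

text \<open>Projecting a relation isolates each term: the powers belong to different eigenvalues of
  \<open>\<sigma>\<close>, which fixes K(t).\<close>

lemma poly_indep_X_powers: "poly_indep t {..<N} (\<lambda>i. X ^ i)"
  unfolding poly_indep_def
proof (intro allI impI ballI)
  fix p i assume "(\<Sum>i<N. ev (p i) t * X ^ i) = 0" and i: "i \<in> {..<N}"
  then have "ev (p i) t * X ^ i = eigen_proj i 0"
    using eigen_proj_sum[of "{..<N}" i 0 p] by simp
  also have "\<dots> = 0" by (rule eigen_proj_0)
  finally show "p i = 0" using X_neq_0 by (simp add: ev_t_eq_0)
qed

text \<open>\<open>\<sigma> ^^ e\<close> multiplies the term with X^i by
  \<open>\<zeta> ^ (i * e)\<close>, which is 1 exactly if N = m e divides i e, that is, if m divides
  i.\<close>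

lemma fixed_expansion:
  assumes "m * e = N" and z: "(\<sigma> ^^ e) z = z"
  shows "\<exists>D c. D \<noteq> 0 \<and> ev D t * z = (\<Sum>j<e. ev (c j) t * X ^ (j * m))"
proof -
  have me: "m > 0" "e > 0" using assms(1) N_pos by auto
  have "z \<in> frac_span t N (\<lambda>i. X ^ i)" by (simp add: frac_span_UNIV)
  then obtain D c where D: "D \<noteq> 0" "ev D t * z = (\<Sum>i<N. ev (c i) t * X ^ i)"
    by (auto simp: frac_span_def)
  have c0: "c i = 0" if i: "i < N" "\<not> m dvd i" for i
  proof -
    have "(\<sigma> ^^ e) (ev D t * z) = ev D t * z"
      by (simp add: field_homomorphismD[OF funpow_hom] funpow_ev z)
    then have "(\<Sum>i<N. \<iota> ((\<zeta> ^ i) ^ e) * (ev (c i) t * X ^ i)) = (\<Sum>i<N. ev (c i) t * X ^ i)"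
      unfolding D(2) field_homomorphismD(10)[OF funpow_hom] funpow_term .
    then have "(\<Sum>i<N. ev (Polynomial.smult ((\<zeta> ^ i) ^ e - 1) (c i)) t * X ^ i) = 0"
      by (simp add: ev_smult hom_diff left_diff_distrib sum_subtractf mult.assoc)
    then have "Polynomial.smult ((\<zeta> ^ i) ^ e - 1) (c i) = 0"
      using poly_indep_X_powers i(1) unfolding poly_indep_def
      by (auto dest!: spec[of _ "\<lambda>i. Polynomial.smult ((\<zeta> ^ i) ^ e - 1) (c i)"])
    moreover have "(\<zeta> ^ i) ^ e \<noteq> 1"
      using \<zeta>_power_eq_1_iff[of "i * e"] i(2) assms(1) me by (auto simp flip: power_mult)
    ultimately show ?thesis by simp
  qed
  have img: "(\<lambda>j. j * m) ` {..<e} = {i\<in>{..<N}. m dvd i}"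
  proof (intro equalityI subsetI)
    fix i assume "i \<in> {i\<in>{..<N}. m dvd i}"
    then obtain j where "i = j * m" "j * m < e * m" using assms(1) by (auto simp: mult.commute dvd_def)
    then show "i \<in> (\<lambda>j. j * m) ` {..<e}" by auto
  next
    fix i assume "i \<in> (\<lambda>j. j * m) ` {..<e}"
    then obtain j where "j < e" "i = j * m" by auto
    have "N = e * m" using assms(1) by (simp add: mult.commute)
    then have "i < N" unfolding \<open>i = j * m\<close> using me \<open>j < e\<close> by simp
    then show "i \<in> {i\<in>{..<N}. m dvd i}" using \<open>i = j * m\<close> by simp
  qed
  have "(\<Sum>i<N. ev (c i) t * X ^ i) = (\<Sum>i\<in>{i\<in>{..<N}. m dvd i}. ev (c i) t * X ^ i)"
    by (rule sum.mono_neutral_right) (use c0 in auto)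
  also have "\<dots> = (\<Sum>j<e. ev (c (j * m)) t * X ^ (j * m))"
    unfolding img[symmetric] by (subst sum.reindex) (use me in \<open>auto simp: inj_on_def\<close>)
  finally show ?thesis using D by (intro exI[of _ D] exI[of _ "\<lambda>j. c (j * m)"]) auto
qed

end

section \<open>Fixed fields of the Hermitian function field\<close>

locale hermitian_kummer = kummer_extension \<iota> \<sigma> t X "2 * (q + 1)" \<zeta> "[:0, \<kappa>:] * (1 - monom 1 ((q - 1) div 2)) ^ 2"
  for \<iota> :: "'a::field \<Rightarrow> 'b::field" and \<sigma> t X \<zeta> and \<kappa> :: 'a and q :: nat +
  fixes m e :: nat
  assumes q_odd: "odd q" and q_gt_1: "q > 1" and half_neq_0: "of_nat ((q - 1) div 2) \<noteq> (0 :: 'a)"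
    and \<kappa>_neq_0: "\<kappa> \<noteq> 0" and me: "m * e = 2 * (q + 1)"
begin

abbreviation "N \<equiv> 2 * (q + 1)"

abbreviation "k \<equiv> (q - 1) div 2"

definition h :: "'a poly" where "h = 1 - monom 1 k"

text \<open>At a zero of \<open>h\<close>, N v(X^i) = 2 i v(h), because X^N contains h^2. One factor
  \<open>h\<close> can be divided out of X^i precisely when 2 i is at least N, so for i < N this is
  the floor of 2 i / N.\<close>

definition eps :: "nat \<Rightarrow> nat" where "eps i = (if i < q + 1 then 0 else 1)"

definition F :: "'b set" where "F = {z. (\<sigma> ^^ e) z = z}"

definition b :: "nat \<Rightarrow> 'b" where "b j = X ^ (j * m) / ev h t ^ eps (j * m)"

text \<open>
  With \<open>N = 2 (q + 1)\<close> this is \<open>\<lceil>i q / N\<rceil> - \<epsilon>\<^sub>i k\<close>, the least \<open>d\<close> for which \<open>X\<^sup>i / h(t)\<close>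
  (or \<open>X\<^sup>i\<close>, if \<open>\<epsilon>\<^sub>i = 0\<close>) has pole order at most \<open>d\<close> times that of \<open>t\<close> at infinity.
\<close>

definition d0 :: "nat \<Rightarrow> nat" where "d0 i = (if i < q + 1 then (i + 1) div 2 else i div 2 - k)"

definition d :: "nat \<Rightarrow> nat" where "d j = d0 (j * m)"

lemma q_eq: "q = 2 * k + 1" and k_pos: "k > 0"
  using q_odd q_gt_1 by presburger+

lemma pos: "m > 0" "e > 0"
  using me by (auto intro: Nat.gr0I)

lemma jm_less: "j < e \<Longrightarrow> j * m < N"
  using me pos by (metis mult.commute mult_less_cancel1)

lemma h_neq_0: "h \<noteq> 0" and degree_h: "degree h = k" and coeff_h_0: "coeff h 0 = 1"
proof -
  show "coeff h 0 = 1" using k_pos by (simp add: h_def)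
  then show "h \<noteq> 0" by auto
  have "h = monom (- 1) k + 1" by (simp add: h_def minus_monom)
  then show "degree h = k" using k_pos by (simp add: degree_add_eq_left degree_monom_eq)
qed

text \<open>The Bezout identity between \<open>h\<close> and its derivative: subtracting T h' / k
  removes the monomial T^k. It replaces a factorization of \<open>h\<close> into distinct linear
  factors.\<close>

lemma h_separable: "h - Polynomial.smult (inverse (of_nat k)) ([:0, 1:] * pderiv h) = 1"
proof -
  have "pderiv h = - monom (of_nat k) (k - 1)" by (simp add: h_def pderiv_diff pderiv_monom)
  then have "[:0, 1:] * pderiv h = - monom (of_nat k) k"
    using k_pos by (simp add: monom_Suc[symmetric])
  then show ?thesis using half_neq_0 by (simp add: h_def smult_monom)
qed

text \<open>The two inequalities characterize a ceiling. Since i q / N = i / 2 - i / N and i / N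
  reaches 1 / 2 at i = q + 1, the ceiling is (i + 1) div 2 below that point and i div 2 from there
  on.\<close>

lemma d0_bounds:
  assumes "i < N"
  shows "i * q \<le> N * (d0 i + eps i * k)" "N * (d0 i + eps i * k) < i * q + N"
proof -
  have k: "k \<le> i div 2" if "\<not> i < q + 1" using that by simp
  obtain a where a: "i = 2 * a \<or> i = 2 * a + 1" by (metis evenE oddE)
  have "i * q \<le> N * (d0 i + eps i * k) \<and> N * (d0 i + eps i * k) < i * q + N"
  proof (cases "i < q + 1")
    case True
    from a show ?thesis
    proof
      assume "i = 2 * a"
      then show ?thesis using True by (simp add: d0_def eps_def algebra_simps)
    next
      assume i: "i = 2 * a + 1"
      have "2 * a + 1 \<le> q" using True i by simp
      then show ?thesis using True i by (simp add: d0_def eps_def algebra_simps)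
    qed
  next
    case False
    then have dk: "d0 i + eps i * k = i div 2" using k by (simp add: d0_def eps_def)
    from a show ?thesis
    proof
      assume "i = 2 * a"
      then show ?thesis unfolding dk using assms by (simp add: algebra_simps)
    next
      assume i: "i = 2 * a + 1"
      then have "q \<le> 2 * a" using False q_odd by presburger
      then show ?thesis unfolding dk using assms i by (simp add: algebra_simps)
    qed
  qed
  then show "i * q \<le> N * (d0 i + eps i * k)" "N * (d0 i + eps i * k) < i * q + N" by auto
qed

lemma F_intermediate_field: "intermediate_field \<iota> F"
  using field_homomorphismD[OF funpow_hom]
  by (auto simp: intermediate_field_def F_def funpow_\<iota>)

lemma ev_h_neq_0: "ev h t \<noteq> 0"
  using h_neq_0 by (simp add: ev_t_eq_0)

lemma b_mem: "b j \<in> F"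
proof -
  have "N dvd j * m * e" unfolding mult.assoc me by (rule dvd_triv_right)
  then have "\<zeta> ^ (j * m * e) = 1" by (simp only: \<zeta>_power_eq_1_iff)
  then have "(\<zeta> ^ (j * m)) ^ e = 1" by (simp only: power_mult)
  then have "(\<sigma> ^^ e) (X ^ (j * m)) = X ^ (j * m)"
    using funpow_term[of e 1 "j * m"] by simp
  then show ?thesis
    by (simp add: F_def b_def field_homomorphismD[OF funpow_hom] funpow_ev)
qed

lemma X_b: "X ^ (j * m) = ev (h ^ eps (j * m)) t * b j"
  using ev_h_neq_0 by (simp add: b_def ev_power)

sublocale function_field \<iota> F t e b
proof
  show "intermediate_field \<iota> F" by (rule F_intermediate_field)
  show "t \<in> F" by (simp add: F_def funpow_t)
  show "transcendental_via \<iota> t" by (rule t_transcendental)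

  show "F \<subseteq> frac_span t e b"
  proof
    fix z assume "z \<in> F"
    then have "(\<sigma> ^^ e) z = z" by (simp add: F_def)
    from fixed_expansion[OF me this] obtain D c
      where D: "D \<noteq> 0" "ev D t * z = (\<Sum>j<e. ev (c j) t * X ^ (j * m))" by blast
    have "ev D t * z = (\<Sum>j<e. ev (c j * h ^ eps (j * m)) t * b j)"
      unfolding D(2) X_b ev_mult mult.assoc by (rule refl)
    with D(1) show "z \<in> frac_span t e b" unfolding frac_span_def by (intro CollectI exI conjI)
  qed
qed

section \<open>Valuations of the basis elements\<close>

lemma b_neq_0: "b j \<noteq> 0"
  using X_neq_0 ev_h_neq_0 by (simp add: b_def)

text \<open>The N-th power of \<open>b j\<close> is a constant times t^i h^(2 i - eps i N) with i =
  j m. Keeping the factor \<open>N\<close> avoids a discussion of ramification indices.\<close>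

lemma N_val_b:
  assumes P: "P \<in> \<P>" and j: "j < e"
  shows "int N * val P (b j) = int (j * m) * val P t + (2 * int (j * m) - int (eps (j * m)) * int N) * val P (ev h t)"
proof -
  let ?i = "j * m"
  have hF: "ev h t \<in> F" "ev h t \<noteq> 0" using F_ev[OF t_F] ev_h_neq_0 by auto
  have XN: "X ^ N = \<iota> \<kappa> * t * ev h t ^ 2"
    unfolding X_power h_def ev_mult ev_power by simp
  have "X ^ (?i * N) = (\<iota> \<kappa> * t * ev h t ^ 2) ^ ?i"
    unfolding XN[symmetric] by (metis mult.commute power_mult)
  also have "\<dots> = \<iota> (\<kappa> ^ ?i) * (t ^ ?i * ev h t ^ (2 * ?i))"
    by (simp only: power_mult_distrib hom_power power_mult mult.assoc)
  finally have X: "X ^ (?i * N) = \<iota> (\<kappa> ^ ?i) * (t ^ ?i * ev h t ^ (2 * ?i))" .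
  have "b j ^ N = X ^ (?i * N) / ev h t ^ (eps ?i * N)"
    by (simp only: b_def power_divide power_mult)
  then have "b j ^ N * ev h t ^ (eps ?i * N) = \<iota> (\<kappa> ^ ?i) * (t ^ ?i * ev h t ^ (2 * ?i))"
    unfolding X using hF(2) by (metis nonzero_eq_divide_eq power_not_zero)
  moreover define M where "M = N"
  ultimately have eq: "b j ^ M * ev h t ^ (eps ?i * M) = \<iota> (\<kappa> ^ ?i) * (t ^ ?i * ev h t ^ (2 * ?i))"
    by simp
  have bF': "b j \<in> F" "b j \<noteq> 0" using b_mem b_neq_0 by auto
  have "val P (b j ^ M * ev h t ^ (eps ?i * M)) = int M * val P (b j) + int (eps ?i * M) * val P (ev h t)"
    using val_mult[OF P F_power[OF bF'(1)] _ F_power[OF hF(1)], of M "eps ?i * M"] bF' hF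
      val_power[OF P bF'] val_power[OF P hF] by simp
  moreover have "val P (\<iota> (\<kappa> ^ ?i) * (t ^ ?i * ev h t ^ (2 * ?i))) = int ?i * val P t + int (2 * ?i) * val P (ev h t)"
    using val_mult[OF P F_hom _ F_mult[OF F_power[OF t_F] F_power[OF hF(1)]], of "\<kappa> ^ ?i" ?i "2 * ?i"]
      val_mult[OF P F_power[OF t_F] _ F_power[OF hF(1)], of ?i "2 * ?i"] \<kappa>_neq_0 hF
      val_power[OF P t_F] val_power[OF P hF] val_hom[OF P, of "\<kappa> ^ ?i"] by simp
  ultimately show ?thesis unfolding eq M_def[symmetric] by (simp add: algebra_simps)
qed

lemma eps_bounds:
  assumes "i < N"
  shows "0 \<le> 2 * int i - int (eps i) * int N" "2 * int i - int (eps i) * int N < int N"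
  using assms by (auto simp: eps_def)

text \<open>At a finite place containing D(t) the value of \<open>b j\<close> stays below that of
  D(t). If t vanishes there, T divides \<open>D\<close> while N v(b_j) = i v(t) < N v(t); if h(t)
  vanishes, v(D) is at least v(h) while the exponent of \<open>h\<close> in b_j^N is below
  \<open>N\<close>; otherwise \<open>b j\<close> is a unit.\<close>

lemma no_finite_pole:
  assumes P: "P \<in> \<P>" and tP: "t \<in> \<O> P" and j: "j < e"
    and D: "D \<noteq> 0" "ev D t \<in> P" and le: "val P (ev D t) \<le> val P (b j)"
  shows False
proof -
  let ?i = "j * m"
  let ?v = "\<lambda>f. val P (ev f t)"
  have evF: "ev f t \<in> F" for f by (rule F_ev[OF t_F])
  have evR: "ev f t \<in> \<O> P" for f by (rule R_ev[OF P tP])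
  have P_iff: "ev f t \<in> P \<longleftrightarrow> 1 \<le> ?v f" if "f \<noteq> 0" for f
    using P_iff_val(1)[OF P evF] that by simp
  have nonneg: "0 \<le> ?v f" if "f \<noteq> 0" for f by (rule val_ev_nonneg[OF P tP that])
  have v_mult: "?v (f * g) = ?v f + ?v g" if "f \<noteq> 0" "g \<noteq> 0" for f g
    unfolding ev_mult using that by (intro val_mult[OF P evF _ evF]) auto
  have t_eq: "ev [:0, 1:] t = t" by simp
  have t0: "0 \<le> val P t" using nonneg[of "[:0, 1:]"] by simp
  have D1: "1 \<le> ?v D" using P_iff[OF D(1)] D(2) by blast
  have i: "?i < N" by (rule jm_less[OF j])
  have "int N * ?v D \<le> int N * val P (b j)" using le by (rule mult_left_mono) simp
  then have main: "int N * ?v D \<le> int ?i * val P t + (2 * int ?i - int (eps ?i) * int N) * ?v h"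
    unfolding N_val_b[OF P j] .
  show False
  proof (cases "t \<in> P")
    case True
    have "ev h t \<notin> P"
    proof
      obtain a g where h: "h = pCons a g" by (cases h)
      assume "ev h t \<in> P"
      moreover have "t * ev g t \<in> P" by (rule P_mult'[OF P True evR])
      moreover have "a \<noteq> 0" using coeff_h_0 h by auto
      ultimately show False using unit_plus_P[OF P, of a] h by auto
    qed
    then have h: "?v h = 0" using P_iff[OF h_neq_0] nonneg[OF h_neq_0] by linarith
    obtain a g where g: "D = pCons a g" by (cases D)
    have "a = 0"
    proof (rule ccontr)
      assume "a \<noteq> 0"
      then show False using D(2) unit_plus_P[OF P, of a] P_mult'[OF P True evR] g by auto
    qed
    then have "D = [:0, 1:] * g" "g \<noteq> 0" using g D(1) by auto
    then have "?v D = val P t + ?v g" using v_mult[of "[:0, 1:]" g] by simp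
    then have "val P t \<le> ?v D" using nonneg[OF \<open>g \<noteq> 0\<close>] by linarith
    then have "int N * val P t \<le> int N * ?v D" by (rule mult_left_mono) simp
    also have "\<dots> \<le> int ?i * val P t" using main unfolding h by simp
    finally have "int N * val P t \<le> int ?i * val P t" .
    moreover have "0 < val P t" using True P_iff_val(1)[OF P t_F] by simp
    ultimately have "int N \<le> int ?i" by (rule mult_right_le_imp_le)
    then show False using i by linarith
  next
    case False
    then have tv: "val P t = 0" using t0 P_iff_val(1)[OF P t_F] by simp
    show False
    proof (cases "ev h t \<in> P")
      case True
      \<comment> \<open>The common divisor \<open>g\<close> of \<open>D\<close> and \<open>h\<close>
        vanishes at \<open>P\<close>; as \<open>h\<close> is squarefree, it carries the whole value
        of \<open>h\<close> there.\<close>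
      obtain g u v where g: "g = u * D + v * h" "g dvd D" "g dvd h" "g \<noteq> 0"
        by (rule poly_bezout[OF h_neq_0])
      obtain h2 where h2: "h = g * h2" using g(3) by (auto simp: dvd_def)
      obtain D2 where D2: "D = g * D2" using g(2) by (auto simp: dvd_def)
      have h20: "h2 \<noteq> 0" and D20: "D2 \<noteq> 0" using h2 D2 h_neq_0 D(1) by auto
      have gP: "ev g t \<in> P" unfolding g(1) ev_add ev_mult
        by (intro P_add[OF P] P_mult[OF P evR] D(2) True)
      have "ev h2 t \<notin> P"
      proof
        \<comment> \<open>If both cofactors vanished at \<open>P\<close>, so would the derivative of
          \<open>h\<close>, and the Bezout identity would put 1 into \<open>P\<close>.\<close>
        assume h2P: "ev h2 t \<in> P"
        have "ev (pderiv h) t = ev g t * ev (pderiv h2) t + ev h2 t * ev (pderiv g) t"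
          by (simp add: h2 pderiv_mult ev_add ev_mult)
        also have "\<dots> \<in> P" by (intro P_add[OF P] P_mult'[OF P _ evR] gP h2P)
        finally have dP: "ev (pderiv h) t \<in> P" .
        have "ev h t + - (ev [:- inverse (of_nat k):] t * - (ev [:0, 1:] t * ev (pderiv h) t)) \<in> P"
          by (intro P_add[OF P] P_minus[OF P] P_mult[OF P evR] True dP)
        also have "ev h t + - (ev [:- inverse (of_nat k):] t * - (ev [:0, 1:] t * ev (pderiv h) t)) =
            ev (h - Polynomial.smult (inverse (of_nat k)) ([:0, 1:] * pderiv h)) t"
          unfolding ev_diff ev_smult ev_mult by (simp add: hom_minus)
        finally show False using P_not_1[OF P] unfolding h_separable by simp
      qed
      then have "?v h2 = 0" using P_iff[OF h20] nonneg[OF h20] by linarith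
      then have "?v h = ?v g" using v_mult[OF g(4) h20] by (simp flip: h2)
      moreover have "?v D = ?v g + ?v D2" using v_mult[OF g(4) D20] by (simp flip: D2)
      ultimately have "?v h \<le> ?v D" using nonneg[OF D20] by linarith
      then have "int N * ?v h \<le> int N * ?v D" by (rule mult_left_mono) simp
      also have "\<dots> \<le> (2 * int ?i - int (eps ?i) * int N) * ?v h" using main unfolding tv by simp
      finally have "int N * ?v h \<le> (2 * int ?i - int (eps ?i) * int N) * ?v h" .
      moreover have "0 < ?v h" using P_iff[OF h_neq_0] True by simp
      ultimately have "int N \<le> 2 * int ?i - int (eps ?i) * int N" by (rule mult_right_le_imp_le)
      then show False using eps_bounds(2)[OF i] by linarith
    next
      case False
      then have "?v h = 0" using P_iff[OF h_neq_0] nonneg[OF h_neq_0] by linarith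
      then have "int N * ?v D \<le> 0" using main unfolding tv by simp
      moreover have "0 < int N * ?v D" using D1 by (intro mult_pos_pos) auto
      ultimately show False by linarith
    qed
  qed
qed

lemma coprime_fraction:
  fixes c D :: "'a poly"
  assumes "D \<noteq> 0"
  obtains c' D' g u v where "c = g * c'" "D = g * D'" "g \<noteq> 0" "u * c' + v * D' = 1"
proof -
  obtain g u v where g: "g = u * c + v * D" "g dvd c" "g dvd D" "g \<noteq> 0" by (rule poly_bezout[OF assms])
  obtain c' where c': "c = g * c'" using g(2) by (auto simp: dvd_def)
  obtain D' where D': "D = g * D'" using g(3) by (auto simp: dvd_def)
  have "g * (u * c' + v * D') = u * (g * c') + v * (g * D')" by (simp add: algebra_simps)
  also have "\<dots> = g" unfolding c'[symmetric] D'[symmetric] by (rule g(1)[symmetric])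
  finally have "g * (u * c' + v * D') = g * 1" by simp
  then have "u * c' + v * D' = 1" using g(4) by (subst (asm) mult_cancel_left) simp
  then show thesis by (rule that[OF c' D' g(4)])
qed

lemma N_val_infinite:
  assumes P: "P \<in> \<P>" "t \<notin> \<O> P" and j: "j < e" and p: "p \<noteq> 0"
  shows "int N * val P (ev p t * b j) =
    val P t * (int N * int (degree p) + int (j * m) * int q - int N * int (eps (j * m) * k))"
proof -
  have "val P (ev p t * b j) = int (degree p) * val P t + val P (b j)"
    using val_mult[OF P(1) F_ev[OF t_F] _ b_mem[of j] b_neq_0] p val_ev_infinite[OF P p] by simp
  then have "int N * val P (ev p t * b j) = int N * int (degree p) * val P t + int N * val P (b j)"
    by (simp add: algebra_simps)
  also have "\<dots> = val P t * (int N * int (degree p) + int (j * m) * (1 + 2 * int k) - int N * int (eps (j * m) * k))"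
    unfolding N_val_b[OF P(1) j] val_ev_infinite[OF P h_neq_0] degree_h by (simp add: algebra_simps)
  also have "1 + 2 * int k = int q" using q_eq by linarith
  finally show ?thesis .
qed

text \<open>At infinity v(h) = k v(t), and 1 + 2 k = q, so N v(b_j) = (i q - N eps i k) v(t) with i
  = j m. As v(t) is negative, the inequality is reversed; rounding up to \<open>d j\<close> loses
  nothing because the degree and \<open>l\<close> are integers.\<close>

lemma infinite_iff:
  assumes P: "P \<in> \<P>" "t \<notin> \<O> P" and j: "j < e" and p: "p \<noteq> 0"
  shows "ev p t * b j / t ^ l \<in> \<O> P \<longleftrightarrow> degree p + d j \<le> l"
proof -
  let ?i = "j * m"
  have t: "val P t < 0" using R_iff_val[OF P(1) t_F] P(2) by simp
  have w: "ev p t * b j \<in> F" "ev p t * b j \<noteq> 0" using F_mult[OF F_ev[OF t_F] b_mem] b_neq_0 p by auto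
  have tl: "t ^ l \<in> F" "t ^ l \<noteq> 0" using F_power[OF t_F] by auto
  have "ev p t * b j / t ^ l \<in> F" "ev p t * b j / t ^ l \<noteq> 0" using F_divide[OF w(1) tl(1)] w tl by auto
  then have "ev p t * b j / t ^ l \<in> \<O> P \<longleftrightarrow> int l * val P t \<le> val P (ev p t * b j)"
    using R_iff_val[OF P(1)] val_divide[OF P(1) w tl] val_power[OF P(1) t_F] by simp
  also have "\<dots> \<longleftrightarrow> int N * (int l * val P t) \<le> int N * val P (ev p t * b j)"
    by simp
  also have "\<dots> \<longleftrightarrow> val P t * (int N * int l) \<le>
      val P t * (int N * int (degree p) + int ?i * int q - int N * int (eps ?i * k))"
    unfolding N_val_infinite[OF assms] by (simp add: mult_ac)
  also have "\<dots> \<longleftrightarrow> int N * int (degree p) + int ?i * int q - int N * int (eps ?i * k) \<le> int N * int l"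
    using t by simp
  also have "\<dots> \<longleftrightarrow> degree p + d j \<le> l"
  proof -
    have b1: "int ?i * int q \<le> int N * (int (d j) + int (eps ?i * k))"
      and b2: "int N * (int (d j) + int (eps ?i * k)) < int ?i * int q + int N"
      using d0_bounds[OF jm_less[OF j]] unfolding d_def
      by (simp_all only: of_nat_mult[symmetric] of_nat_add[symmetric] of_nat_le_iff of_nat_less_iff)
    show ?thesis
    proof
      assume "degree p + d j \<le> l"
      then have "int N * (int (degree p) + int (d j)) \<le> int N * int l" by (intro mult_left_mono) auto
      then show "int N * int (degree p) + int ?i * int q - int N * int (eps ?i * k) \<le> int N * int l"
        using b1 by (simp only: distrib_left)
    next
      assume "int N * int (degree p) + int ?i * int q - int N * int (eps ?i * k) \<le> int N * int l"
      then have "int N * (int (degree p) + int (d j)) < int N * (int l + 1)"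
        using b2 by (simp only: distrib_left mult_1_right)
      then have "int (degree p) + int (d j) < int l + 1" by (rule mult_left_less_imp_less) simp
      then show "degree p + d j \<le> l" by simp
    qed
  qed
  finally show ?thesis .
qed

text \<open>In lowest terms the numerator is a unit at a place where the denominator vanishes, so
  \<open>b j\<close> would have to absorb the pole, which is excluded. The denominator is therefore
  constant, and a single infinite place bounds the degree.\<close>

lemma term_in_L_int_iff:
  assumes j: "j < e" and D: "D \<noteq> 0"
  shows "ev c t * b j / ev D t \<in> L_int l \<longleftrightarrow> (\<exists>p. c = D * p \<and> (p = 0 \<or> degree p + d j \<le> l))"
proof
  assume w: "ev c t * b j / ev D t \<in> L_int l"
  obtain c' D' g u v where g: "c = g * c'" "D = g * D'" "g \<noteq> 0" and uv: "u * c' + v * D' = 1"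
    by (rule coprime_fraction[OF D])
  have D'0: "D' \<noteq> 0" using g D by auto
  have w_eq: "ev c t * b j / ev D t = ev c' t * b j / ev D' t" using g(3) by (simp add: g ev_mult)
  show "\<exists>p. c = D * p \<and> (p = 0 \<or> degree p + d j \<le> l)"
  proof (cases "c' = 0")
    case True
    then show ?thesis using g by (intro exI[of _ 0]) simp
  next
    case c'0: False
    have "degree D' = 0"
    proof (rule ccontr)
      assume "degree D' \<noteq> 0"
      then obtain P where P: "P \<in> \<P>" "t \<in> \<O> P" "ev D' t \<in> P"
        using finite_place_exists[of D'] by auto
      have "ev c' t \<notin> P"
      proof
        assume "ev c' t \<in> P"
        then have "ev u t * ev c' t + ev v t * ev D' t \<in> P"
          using P(3) by (intro P_add[OF P(1)] P_mult[OF P(1)] R_ev[OF P(1,2)])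
        then show False using P_not_1[OF P(1)] uv by (metis ev_1 ev_add ev_mult)
      qed
      then have "val P (ev c' t) = 0" using R_ev[OF P(1,2)] val_unit[OF P(1)] by blast
      moreover have "ev c' t * b j / ev D' t \<in> \<O> P"
        using w P unfolding w_eq L_int_def by blast
      moreover have wF: "ev c' t * b j \<in> F" "ev c' t * b j \<noteq> 0"
        using F_mult[OF F_ev[OF t_F] b_mem] b_neq_0 c'0 by auto
      moreover have "ev c' t * b j / ev D' t \<in> F" "ev c' t * b j / ev D' t \<noteq> 0"
        using F_divide[OF wF(1) F_ev[OF t_F]] wF D'0 by auto
      ultimately have "val P (ev D' t) \<le> val P (b j)"
        using R_iff_val[OF P(1), of "ev c' t * b j / ev D' t"] val_divide[OF P(1) wF F_ev[OF t_F], of D'] D'0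
          val_mult[OF P(1) F_ev[OF t_F] _ b_mem b_neq_0, of c' j] c'0 by simp
      then show False by (rule no_finite_pole[OF P(1,2) j D'0 P(3)])
    qed
    then obtain a where a: "D' = [:a:]" by (rule degree_eq_zeroE)
    then have a0: "a \<noteq> 0" using D'0 by auto
    define p where "p = Polynomial.smult (inverse a) c'"
    have c: "c = D * p" using a0 by (simp add: g a p_def)
    have p0: "p \<noteq> 0" using a0 c'0 by (simp add: p_def)
    obtain P where P: "P \<in> \<P>" "t \<notin> \<O> P" by (rule infinite_place_exists)
    have "ev c t * b j / ev D t = ev p t * b j" using D by (simp add: c ev_mult)
    then have "ev p t * b j / t ^ l \<in> \<O> P" using w P by (auto simp: L_int_def)
    then show ?thesis using infinite_iff[OF P j p0] c by blast
  qed
next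
  assume "\<exists>p. c = D * p \<and> (p = 0 \<or> degree p + d j \<le> l)"
  then obtain p where c: "c = D * p" and p: "p = 0 \<or> degree p + d j \<le> l" by blast
  have w: "ev c t * b j / ev D t = ev p t * b j" using D by (simp add: c ev_mult)
  show "ev c t * b j / ev D t \<in> L_int l"
  proof (cases "p = 0")
    case True
    then show ?thesis unfolding w using R_0 by (simp add: L_int_def)
  next
    case False
    have "ev p t * b j \<in> \<O> P" if P: "P \<in> \<P>" "t \<in> \<O> P" for P
    proof -
      have "0 \<le> val P t" using R_iff_val[OF P(1) t_F] P(2) by simp
      moreover have "0 \<le> val P (ev h t)" by (rule val_ev_nonneg[OF P h_neq_0])
      ultimately have "0 \<le> int N * val P (b j)"
        unfolding N_val_b[OF P(1) j] using eps_bounds(1)[OF jm_less[OF j]] by (intro add_nonneg_nonneg mult_nonneg_nonneg) auto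
      then have "0 \<le> val P (b j)" by (simp add: zero_le_mult_iff)
      then have "b j \<in> \<O> P" using R_iff_val[OF P(1) b_mem b_neq_0] by simp
      then show ?thesis using R_mult[OF P(1) R_ev[OF P]] by blast
    qed
    then show ?thesis
      unfolding w L_int_def using infinite_iff[OF _ _ j False] p False F_mult[OF F_ev[OF t_F] b_mem] by auto
  qed
qed

lemma funpow_L_int:
  assumes "z \<in> L_int l"
  shows "(\<sigma> ^^ i) z \<in> L_int l"
proof (rule automorphism_L_int[OF funpow_hom funpow_\<iota> _ funpow_t assms])
  have comm: "(\<sigma> ^^ e) ((\<sigma> ^^ i) u) = (\<sigma> ^^ i) ((\<sigma> ^^ e) u)" for u
    by (metis add.commute comp_apply funpow_add)
  have bij: "bij (\<sigma> ^^ i)" using \<sigma>_bij by (rule bij_fn)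
  show "(\<sigma> ^^ i) ` F = F"
  proof
    show "(\<sigma> ^^ i) ` F \<subseteq> F" by (auto simp: F_def comm)
    show "F \<subseteq> (\<sigma> ^^ i) ` F"
    proof
      fix u assume u: "u \<in> F"
      obtain v where v: "u = (\<sigma> ^^ i) v" using bij by (metis bij_is_surj surjD)
      then have "(\<sigma> ^^ i) ((\<sigma> ^^ e) v) = (\<sigma> ^^ i) v" using u comm[of v] by (simp add: F_def)
      then have "(\<sigma> ^^ e) v = v" using bij by (metis bij_is_inj injD)
      then show "u \<in> (\<sigma> ^^ i) ` F" using v by (auto simp: F_def)
    qed
  qed
qed

text \<open>\<open>L_int l\<close> is stable under \<open>\<sigma>\<close>, hence under the
  eigenprojections. Membership of a sum thus passes to its individual terms, which are tested
  separately.\<close>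

sublocale integral_basis \<iota> F t e b d
proof
  show "poly_indep t {..<e} b"
    unfolding poly_indep_def
  proof (intro allI impI ballI)
    fix p j assume 0: "(\<Sum>j<e. ev (p j) t * b j) = 0" and j: "j \<in> {..<e}"
    \<comment> \<open>The exponent \<open>1 - eps i\<close> makes the coefficient times X^(j m)
      equal to p_j(t) b_j h(t), so one factor h(t) clears all denominators at once.\<close>
    define c where "c = (\<lambda>i. p (i div m) * h ^ (1 - eps i))"
    have "ev (p j) t * b j * ev h t = ev (c (j * m)) t * X ^ (j * m)" for j
      by (cases "j * m < q + 1") (use pos ev_h_neq_0 in \<open>simp_all add: c_def ev_mult ev_power b_def eps_def mult_ac\<close>)
    then have "(\<Sum>j<e. ev (c (j * m)) t * X ^ (j * m)) = (\<Sum>j<e. ev (p j) t * b j) * ev h t"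
      by (simp add: sum_distrib_right)
    then have "(\<Sum>j<e. ev (c (j * m)) t * X ^ (j * m)) = 0" using 0 by simp
    then have "(\<Sum>i\<in>(\<lambda>j. j * m) ` {..<e}. ev (c i) t * X ^ i) = 0"
      by (subst sum.reindex) (use pos in \<open>auto simp: inj_on_def\<close>)
    then have "eigen_proj (j * m) 0 = ev (c (j * m)) t * X ^ (j * m)"
      using j jm_less by (intro eigen_proj_sum[of "(\<lambda>j. j * m) ` {..<e}"]) auto
    then have "ev (c (j * m)) t * X ^ (j * m) = 0" unfolding eigen_proj_0 by (rule sym)
    then have "c (j * m) = 0" using X_neq_0 by (simp add: ev_t_eq_0)
    then show "p j = 0" using h_neq_0 pos by (simp add: c_def)
  qed
  fix l
  show "L_int l = {(\<Sum>j<e. ev (c j) t * b j) | c. \<forall>j<e. c j = 0 \<or> degree (c j) + d j \<le> l}"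
  proof (intro equalityI subsetI)
    fix z assume z: "z \<in> L_int l"
    then have "z \<in> F" by (simp add: L_int_def)
    then have "(\<sigma> ^^ e) z = z" by (simp add: F_def)
    from fixed_expansion[OF me this] obtain D c
      where D: "D \<noteq> 0" "ev D t * z = (\<Sum>j<e. ev (c j) t * X ^ (j * m))" by blast
    have "\<exists>p. c j * h ^ eps (j * m) = D * p \<and> (p = 0 \<or> degree p + d j \<le> l)" if j: "j < e" for j
    proof -
      have "(\<Sum>j<e. ev (c j) t * X ^ (j * m)) = (\<Sum>i\<in>(\<lambda>j. j * m) ` {..<e}. ev (c (i div m)) t * X ^ i)"
        by (subst sum.reindex) (use pos in \<open>auto simp: inj_on_def\<close>)
      then have "eigen_proj (j * m) (ev D t * z) = ev (c (j * m div m)) t * X ^ (j * m)"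
        using j jm_less D(2) by (intro eigen_proj_sum[of "(\<lambda>j. j * m) ` {..<e}"]) auto
      then have "ev D t * eigen_proj (j * m) z = ev (c j) t * X ^ (j * m)"
        unfolding eigen_proj_ev_mult using pos by simp
      also have "\<dots> = ev (c j * h ^ eps (j * m)) t * b j"
        unfolding X_b ev_mult mult.assoc by (rule refl)
      finally have eq: "ev (c j * h ^ eps (j * m)) t * b j / ev D t = eigen_proj (j * m) z"
        using D(1) by (metis ev_t_eq_0_iff nonzero_mult_div_cancel_left)
      have "eigen_proj (j * m) z \<in> L_int l"
        unfolding eigen_proj_def by (rule L_int_sum_scale) (rule funpow_L_int[OF z])
      then show ?thesis unfolding eq[symmetric] by (simp only: term_in_L_int_iff[OF j D(1)])
    qed
    then obtain p where p: "\<And>j. j < e \<Longrightarrow> c j * h ^ eps (j * m) = D * p j"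
      "\<And>j. j < e \<Longrightarrow> p j = 0 \<or> degree (p j) + d j \<le> l" by metis
    have "ev D t * z = (\<Sum>j<e. ev (D * p j) t * b j)"
      unfolding D(2) by (rule sum.cong) (simp_all add: X_b mult.assoc[symmetric] p(1) flip: ev_mult)
    then have "ev D t * z = ev D t * (\<Sum>j<e. ev (p j) t * b j)"
      by (simp add: ev_mult sum_distrib_left mult.assoc)
    then have "z = (\<Sum>j<e. ev (p j) t * b j)" using D(1) by simp
    then show "z \<in> {(\<Sum>j<e. ev (c j) t * b j) | c. \<forall>j<e. c j = 0 \<or> degree (c j) + d j \<le> l}"
      using p(2) by blast
  next
    fix z assume "z \<in> {(\<Sum>j<e. ev (c j) t * b j) | c. \<forall>j<e. c j = 0 \<or> degree (c j) + d j \<le> l}"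
    then obtain c where z: "z = (\<Sum>j<e. ev (c j) t * b j)" "\<And>j. j < e \<Longrightarrow> c j = 0 \<or> degree (c j) + d j \<le> l"
      by blast
    have "ev (c j) t * b j \<in> L_int l" if "j < e" for j
      using term_in_L_int_iff[OF that, of 1 "c j"] z(2)[OF that] by simp
    then have "(\<Sum>j<e. \<iota> 1 * (ev (c j) t * b j)) \<in> L_int l" by (intro L_int_sum_scale) simp
    then show "z \<in> L_int l" by (simp add: z(1))
  qed
qed

text \<open>Here e = 2 s, and j is paired with j + s, whose index is i + (q + 1) for i = j m and so
  lies beyond the threshold. The two contributions (i + 1) div 2 and i div 2 + 1 add up to i + 1
  regardless of parity.\<close>

lemma genus_fixed_field_dvd:
  assumes "m * s = q + 1"
  shows "genus \<iota> F = (int s - 1) * int k"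
proof -
  have e: "e = s + s" using me assms pos by (metis mult_2 mult.left_commute mult_left_cancel neq0_conv)
  have "int m * int s = int q + 1" using assms by (metis of_nat_1 of_nat_add of_nat_mult)
  then have k: "2 * int k = int m * int s - 2" using q_eq by linarith
  have pair: "int (d j) + int (d (j + s)) = int j * int m + 1" if j: "j < s" for j
  proof -
    have "j * m < s * m" using j pos by simp
    then have jm: "j * m < q + 1" using assms by (simp add: mult.commute)
    have "(j + s) * m = j * m + (q + 1)" unfolding distrib_right assms[symmetric] by (simp only: mult.commute)
    then have "d j + d (j + s) = (j * m + 1) div 2 + ((j * m + (q + 1)) div 2 - k)"
      using jm by (simp add: d_def d0_def)
    also have "(j * m + (q + 1)) div 2 = j * m div 2 + (k + 1)"
    proof -
      have "q + 1 = (k + 1) * 2" using q_eq by simp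
      then show ?thesis by (simp only: div_mult_self1)
    qed
    also have "(j * m + 1) div 2 + (j * m div 2 + (k + 1) - k) = (j * m + 1) div 2 + j * m div 2 + 1" by simp
    also have "(i + 1) div 2 + i div 2 = i" for i :: nat by presburger
    finally show ?thesis by (metis of_nat_1 of_nat_add of_nat_mult)
  qed
  have "(\<Sum>j<e. int (d j)) = (\<Sum>j<s. int (d j)) + (\<Sum>j<s. int (d (j + s)))"
    unfolding e by (simp add: sum.nat_group[symmetric] lessThan_atLeast0 sum.atLeastLessThan_concat[of 0 s "s + s", symmetric] sum.shift_bounds_nat_ivl[of _ 0 s s, simplified])
  also have "\<dots> = (\<Sum>j<s. int j * int m + 1)" by (simp add: pair flip: sum.distrib)
  finally have S: "(\<Sum>j<e. int (d j)) = (\<Sum>j<s. int j * int m + 1)" .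
  have G: "2 * (\<Sum>j<s. int j * int m + 1) = int m * int s * (int s - 1) + 2 * int s"
    by (induction s) (simp_all add: algebra_simps)
  have "2 * genus \<iota> F = 2 - 2 * int e + (int m * int s * (int s - 1) + 2 * int s)"
    unfolding genus_eq S using G by simp
  also have "\<dots> = (int s - 1) * (2 * int k)" unfolding k by (simp add: e algebra_simps)
  finally show ?thesis by simp
qed

text \<open>All indices j m are even, so d_j is j m' up to the correction by \<open>k\<close> beyond
  the threshold. As m' e = q + 1 and e = 2 f + 1, the correction affects exactly the f indices with
  f < j < e.\<close>

lemma genus_fixed_field_not_dvd:
  assumes m: "m = 2 * m'" and e: "e = 2 * f + 1"
  shows "genus \<iota> F = int f * int k"
proof -
  have m'e: "m' * e = q + 1" using me m by simp
  have d: "int (d j) = int j * int m' - (if j \<le> f then 0 else int k)" if "j < e" for j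
  proof -
    have "j * m < q + 1 \<longleftrightarrow> 2 * j < e"
      using m'e m pos by (metis mult.left_commute mult.commute mult_less_cancel2 nat_0_less_mult_iff)
    then have iff: "j * m < q + 1 \<longleftrightarrow> j \<le> f" using e by auto
    have jm: "j * m = 2 * (j * m')" using m by simp
    show ?thesis
    proof (cases "j \<le> f")
      case True
      then show ?thesis using iff by (simp add: d_def d0_def jm)
    next
      case False
      then have "k \<le> j * m'" using iff jm by simp
      then show ?thesis using False iff by (simp add: d_def d0_def jm of_nat_diff)
    qed
  qed
  have "(\<Sum>j<e. int (d j)) = (\<Sum>j<e. int j * int m' - (if j \<le> f then 0 else int k))"
    by (rule sum.cong) (simp_all add: d)
  also have "\<dots> = (\<Sum>j<e. int j * int m') - (\<Sum>j<e. if j \<le> f then 0 else int k)"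
    by (rule sum_subtractf)
  also have "(\<Sum>j<e. if j \<le> f then 0 else int k) = (\<Sum>j\<in>{f<..<e}. int k)"
    by (rule sum.mono_neutral_cong_right) auto
  also have "\<dots> = int f * int k" using e by simp
  finally have S: "(\<Sum>j<e. int (d j)) = (\<Sum>j<e. int j * int m') - int f * int k" .
  have "2 * (\<Sum>j<e. int j * int m') = int m' * int e * (int e - 1)"
    by (induction e) (simp_all add: algebra_simps)
  then have G: "(\<Sum>j<e. int j * int m') = (int m' * int e) * int f" using e by simp
  have "int m' * int e = int q + 1" using m'e by (metis of_nat_1 of_nat_add of_nat_mult)
  then have "int m' * int e = 2 * int k + 2" using q_eq by linarith
  then show ?thesis unfolding genus_eq S G by (simp add: e algebra_simps)
qed

end

text \<open>The translation z -> z + 1 permutes the field; comparing the sums of all elements gives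
  |K| = 0 in K.\<close>

lemma of_nat_prime_eq_0:
  assumes "CARD('k::field) = p ^ l" "p > 0"
  shows "of_nat p = (0 :: 'k)"
proof -
  have fin: "finite (UNIV :: 'k set)"
    using assms by (intro card_ge_0_finite) simp
  have "bij_betw (\<lambda>z::'k. z + 1) UNIV UNIV"
    by (rule bij_betwI[of _ _ _ "\<lambda>z. z - 1"]) auto
  then have "(\<Sum>z\<in>(UNIV :: 'k set). z + 1) = (\<Sum>z\<in>UNIV. z)"
    by (rule sum.reindex_bij_betw)
  then have "of_nat (p ^ l) = (0 :: 'k)" by (simp add: sum.distrib flip: assms(1))
  then show ?thesis by simp
qed

lemma CHAR_eq_prime:
  assumes "of_nat p = (0 :: 'k::field)" "prime p"
  shows "CHAR('k) = p"
proof -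
  have "CHAR('k) dvd p" using assms(1) by (simp add: of_nat_eq_0_iff_char_dvd)
  moreover have "CHAR('k) \<noteq> 1" using of_nat_CHAR[where 'a = 'k] by (intro notI) simp
  ultimately show ?thesis using assms(2) by (auto simp: prime_nat_iff)
qed

section \<open>The Hermitian function field in Kummer coordinates\<close>

locale hermitian_automorphism = field_extension \<iota>
  for \<iota> :: "'a::field \<Rightarrow> 'b::field" +
  fixes p n q :: nat and x y :: 'b and a \<delta> :: 'a and \<sigma> :: "'b \<Rightarrow> 'b"
  assumes prime: "prime p" and odd_p: "odd p" and n_pos: "n \<ge> 1" and q: "q = p ^ n"
    and card: "CARD('a) = q ^ 2" and x_trans: "transcendental_via \<iota> x"
    and curve: "y ^ q + y = x ^ (q + 1)" and adjoin_xy: "adjoin \<iota> {x, y} = UNIV"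
    and a_primitive: "primitive_root_of_unity (q ^ 2 - 1) a" and \<delta>: "\<delta> = a ^ ((q + 1) div 2)"
    and \<sigma>_bij: "bij \<sigma>" and \<sigma>_hom: "field_homomorphism \<sigma>" and \<sigma>_\<iota>: "\<sigma> (\<iota> k) = \<iota> k"
    and \<sigma>_x: "\<sigma> x = \<iota> a * x / (\<iota> (a ^ (q + 1)) * y)" and \<sigma>_y: "\<sigma> y = 1 / (\<iota> (a ^ (q + 1)) * y)"
begin

definition w :: 'b where "w = \<iota> \<delta> * y"
definition u :: 'b where "u = (w - 1) / (w + 1)"
text \<open>The denominator absorbs the non-constant factor: since \<sigma> x = a x / (\<delta> w)
  and \<sigma> (w + 1) = (w + 1) / w, the quotient is multiplied by the constant a /
  \<delta>.\<close>

definition X :: 'b where "X = x / (w + 1)"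
definition t :: 'b where "t = u ^ 2"

abbreviation "K \<equiv> (q - 1) div 2"

lemma odd_q: "odd q" and q_gt_1: "q > 1"
proof -
  show "odd q" using odd_p q by simp
  show "q > 1" unfolding q by (rule one_less_power) (use prime_gt_1_nat[OF prime] n_pos in auto)
qed

lemma q_eq: "q = 2 * K + 1" and K_pos: "K > 0"
  using odd_q q_gt_1 by presburger+

lemma q_square: "q ^ 2 - 1 = K * (2 * (q + 1))"
proof -
  obtain r where r: "q = 2 * r + 1" using odd_q by (rule oddE)
  then have "K = r" by simp
  then show ?thesis unfolding r by (simp add: power2_eq_square algebra_simps)
qed

lemma p_eq_0: "of_nat p = (0 :: 'a)"
proof (rule of_nat_prime_eq_0)
  show "CARD('a) = p ^ (n * 2)" using card q by (simp add: power_mult)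
  show "p > 0" using prime by (rule prime_gt_0_nat)
qed

lemma finite_a: "finite (UNIV :: 'a set)"
  using card q_gt_1 by (intro card_ge_0_finite) simp

lemma of_nat_eq_0: "of_nat l = (0 :: 'a) \<longleftrightarrow> p dvd l"
  by (simp add: of_nat_eq_0_iff_char_dvd CHAR_eq_prime[OF p_eq_0 prime])

lemma p_dvd_q: "p dvd q"
  using q n_pos by (simp add: dvd_power)

lemma not_dvd_2: "\<not> p dvd 2"
  using prime odd_p two_is_prime_nat by (metis even_numeral primes_dvd_imp_eq)

lemma two_neq_0: "(2 :: 'a) \<noteq> 0"
proof -
  have "of_nat 2 \<noteq> (0 :: 'a)" using not_dvd_2 by (simp only: of_nat_eq_0 not_False_eq_True)
  then show ?thesis by simp
qed

lemma two_neq_0': "(2 :: 'b) \<noteq> 0"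
  using two_neq_0 hom_of_nat[of 2] by (metis hom_eq_0_iff of_nat_numeral)

lemma not_dvd: "\<not> p dvd 2 * (q + 1)" "\<not> p dvd K"
proof -
  have "\<not> p dvd q + 1" using p_dvd_q prime by (metis dvd_add_right_iff not_prime_unit)
  then show "\<not> p dvd 2 * (q + 1)" using prime not_dvd_2 by (simp only: prime_dvd_mult_iff) simp
  show "\<not> p dvd K"
  proof
    assume "p dvd K"
    then have "p dvd 2 * K" by (rule dvd_mult)
    moreover have "p dvd 2 * K + 1" using p_dvd_q q_eq by simp
    ultimately have "p dvd 1" by (metis dvd_add_right_iff)
    then show False using prime by simp
  qed
qed

lemma frobenius: "(z + z') ^ q = z ^ q + z' ^ q" for z z' :: 'b
proof -
  have "of_nat p = (0 :: 'b)" using hom_of_nat[of p] p_eq_0 by simp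
  then have "CHAR('b) = p" using prime by (rule CHAR_eq_prime)
  then show ?thesis using freshmans_dream'[of q n z z'] prime q by simp
qed

lemma a_neq_0: "a \<noteq> 0"
  using a_primitive q_square K_pos by (auto simp: primitive_root_of_unity_def power_0_left)

lemma \<delta>_eq: "\<delta> = a * a ^ K"
proof -
  have "(q + 1) div 2 = Suc K" using q_eq by presburger
  then show ?thesis by (simp add: \<delta>)
qed

lemma \<delta>_neq_0: "\<delta> \<noteq> 0"
  using a_neq_0 by (simp add: \<delta>)

lemma \<delta>_square: "\<delta> ^ 2 = a ^ (q + 1)"
proof -
  have "(q + 1) div 2 * 2 = q + 1" using odd_q by presburger
  then show ?thesis by (simp only: \<delta> flip: power_mult)
qed

lemma a_power_eq_1_iff: "a ^ l = 1 \<longleftrightarrow> K * (2 * (q + 1)) dvd l"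
proof -
  have "q ^ 2 - 1 > 0" unfolding q_square using K_pos by simp
  then show ?thesis
    unfolding q_square[symmetric] by (rule primitive_root_power_eq_1_iff[OF a_primitive])
qed

text \<open>\<open>\<delta> ^ (q - 1)\<close> squares to 1. It is not 1, because its exponent as a
  power of \<open>a\<close> is (q^2 - 1) / 2, half the order of \<open>a\<close>.\<close>

lemma \<delta>_power_q: "\<delta> ^ q = - \<delta>"
proof -
  define \<epsilon> where "\<epsilon> = \<delta> ^ (q - 1)"
  have "\<epsilon> ^ 2 = (\<delta> ^ 2) ^ (q - 1)" by (simp add: \<epsilon>_def mult.commute flip: power_mult)
  also have "\<dots> = a ^ ((q + 1) * (q - 1))" by (simp only: \<delta>_square flip: power_mult)
  also have "(q + 1) * (q - 1) = K * (2 * (q + 1))"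
    using q_eq by (metis add_diff_cancel_right' mult.assoc mult.commute)
  also have "a ^ (K * (2 * (q + 1))) = 1" by (simp only: a_power_eq_1_iff dvd_refl)
  finally have "\<epsilon> = 1 \<or> \<epsilon> = - 1" by (simp add: power2_eq_1_iff)
  moreover have "\<epsilon> \<noteq> 1"
  proof
    assume "\<epsilon> = 1"
    then have "a ^ ((q + 1) div 2 * (q - 1)) = 1" by (simp add: \<epsilon>_def \<delta> power_mult)
    then have "K * (2 * (q + 1)) dvd (q + 1) div 2 * (q - 1)" by (simp only: a_power_eq_1_iff)
    also have "(q + 1) div 2 * (q - 1) = K * (q + 1)"
    proof -
      obtain r where r: "q = 2 * r + 1" using odd_q by (rule oddE)
      then show ?thesis by simp
    qed
    finally have "2 * (q + 1) dvd q + 1" using K_pos by (simp only: nat_mult_dvd_cancel1)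
    then have "2 * (q + 1) \<le> q + 1" by (rule dvd_imp_le) simp
    then show False by simp
  qed
  ultimately have "\<epsilon> = - 1" by blast
  moreover have "\<delta> ^ q = \<delta> * \<epsilon>" using q_gt_1 by (simp add: \<epsilon>_def flip: power_Suc)
  ultimately show ?thesis by simp
qed

text \<open>Division with remainder by \<open>g\<close> leaves only polynomials of bounded degree,
  of which there are finitely many over a finite field.\<close>

lemma finite_range_ev:
  assumes "ev g z = 0" "g \<noteq> 0"
  shows "finite (range (\<lambda>r. ev r z))"
proof (rule finite_subset)
  let ?B = "Poly ` {xs :: 'a list. set xs \<subseteq> UNIV \<and> length xs \<le> Suc (degree g)}"
  show "finite ((\<lambda>r. ev r z) ` ?B)"
    using finite_lists_length_le[OF finite_a, of "Suc (degree g)"] by simp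
  show "range (\<lambda>r. ev r z) \<subseteq> (\<lambda>r. ev r z) ` ?B"
  proof (rule image_subsetI)
    fix r :: "'a poly"
    have "ev r z = ev (r div g * g + r mod g) z" by simp
    then have eq: "ev r z = ev (r mod g) z" using assms(1) by (simp only: ev_add ev_mult) simp
    have "length (coeffs (r mod g)) \<le> Suc (degree g)"
      using degree_mod_less[OF assms(2), of r] by (cases "r mod g = 0") (auto simp: length_coeffs_degree)
    then have "r mod g \<in> ?B" by (intro image_eqI[of _ _ "coeffs (r mod g)"]) auto
    then show "ev r z \<in> (\<lambda>r. ev r z) ` ?B" unfolding eq by (rule imageI)
  qed
qed

text \<open>
  If \<open>y\<close> were algebraic over the finite field \<open>K\<close>, then \<open>K[y]\<close> would be finite, but it contains
  all powers of \<open>y\<^sup>q + y = x\<^sup>q\<^sup>+\<^sup>1\<close>.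
\<close>

lemma y_trans: "transcendental_via \<iota> y"
  unfolding transcendental_iff
proof (intro allI impI, rule ccontr)
  fix g assume g: "ev g y = 0" "g \<noteq> 0"
  have "x ^ ((q + 1) * i) \<in> range (\<lambda>r. ev r y)" for i
  proof -
    have "x ^ ((q + 1) * i) = ev ((monom 1 q + [:0, 1:]) ^ i) y"
      unfolding ev_power ev_add ev_monom power_mult curve[symmetric] by simp
    then show ?thesis by blast
  qed
  then have "finite (range (\<lambda>i. x ^ ((q + 1) * i)))"
    using finite_range_ev[OF g] by (auto intro: finite_subset)
  then have "\<not> inj (\<lambda>i. x ^ ((q + 1) * i))" using finite_imageD infinite_UNIV_nat by blast
  then obtain i j where ij: "i \<noteq> j" "x ^ ((q + 1) * i) = x ^ ((q + 1) * j)" by (auto simp: inj_def)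
  have "ev (monom 1 ((q + 1) * i) - monom 1 ((q + 1) * j)) x = 0"
    unfolding ev_diff ev_monom ij(2) by simp
  then have "monom (1::'a) ((q + 1) * i) = monom 1 ((q + 1) * j)"
    using x_trans unfolding transcendental_iff by (metis eq_iff_diff_eq_0)
  then have "(q + 1) * i = (q + 1) * j" by (metis degree_monom_eq one_neq_zero)
  then have "i = j" by (simp only: mult_cancel1) simp
  with ij(1) show False ..
qed

lemma y_neq_0: "y \<noteq> 0" and w_neq: "w \<noteq> 0" "w + 1 \<noteq> 0" "w - 1 \<noteq> 0"
proof -
  have *: "ev [:b, c:] y \<noteq> 0" if "c \<noteq> 0" for b c
    using y_trans[unfolded transcendental_iff, rule_format, of "[:b, c:]"] that by auto
  show "y \<noteq> 0" using *[of 1 0] by simp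
  then show "w \<noteq> 0" using \<delta>_neq_0 by (simp add: w_def)
  show "w + 1 \<noteq> 0" using *[of \<delta> 1] \<delta>_neq_0 by (simp add: w_def add.commute mult.commute)
  show "w - 1 \<noteq> 0" using *[of \<delta> "- 1"] \<delta>_neq_0 by (simp add: w_def hom_minus add.commute mult.commute)
qed

lemma x_neq_0: "x \<noteq> 0"
  using x_trans[unfolded transcendental_iff, rule_format, of "[:0, 1:]"] by auto

text \<open>Multiplying f(t) by (w + 1)^(2 deg f) clears its denominators and produces a polynomial
  \<open>g\<close> in \<open>y\<close>, which is transcendental. It remains to see that
  \<open>g\<close> is nonzero.\<close>

lemma t_trans: "transcendental_via \<iota> t"
  unfolding transcendental_iff
proof (intro allI impI, rule ccontr)
  fix f assume f: "ev f t = 0" "f \<noteq> 0"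
  define g where "g = (\<Sum>i\<le>degree f. Polynomial.smult (coeff f i)
      ([:- 1, \<delta>:] ^ (2 * i) * [:1, \<delta>:] ^ (2 * (degree f - i))))"
  have w1: "ev [:- 1, \<delta>:] y = w - 1" "ev [:1, \<delta>:] y = w + 1"
    by (simp_all add: w_def hom_minus mult.commute)
  have "ev g y = (\<Sum>i\<le>degree f. \<iota> (coeff f i) * ((w - 1) ^ (2 * i) * (w + 1) ^ (2 * (degree f - i))))"
    unfolding g_def ev_sum ev_smult ev_mult ev_power w1 ..
  also have "\<dots> = (\<Sum>i\<le>degree f. (w + 1) ^ (2 * degree f) * (\<iota> (coeff f i) * t ^ i))"
  proof (rule sum.cong)
    fix i assume "i \<in> {..degree f}"
    then have "2 * degree f = 2 * i + 2 * (degree f - i)" by simp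
    then have e1: "(w + 1) ^ (2 * degree f) = (w + 1) ^ (2 * i) * (w + 1) ^ (2 * (degree f - i))"
      by (simp only: power_add)
    have e2: "(w - 1) ^ (2 * i) = (w + 1) ^ (2 * i) * t ^ i"
      using w_neq(2) by (simp add: t_def u_def power_divide flip: power_mult)
    show "\<iota> (coeff f i) * ((w - 1) ^ (2 * i) * (w + 1) ^ (2 * (degree f - i))) =
        (w + 1) ^ (2 * degree f) * (\<iota> (coeff f i) * t ^ i)"
      unfolding e1 e2 by (simp only: mult_ac)
  qed simp
  also have "\<dots> = (w + 1) ^ (2 * degree f) * ev f t"
    by (simp add: ev_altdef[OF order.refl] sum_distrib_left)
  finally have "ev g y = 0" using f by simp
  then have "g = 0" using y_trans by (simp add: transcendental_iff)
  \<comment> \<open>At y = - 1 / \<delta>, that is w = - 1, every term with a factor w + 1 vanishes;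
    only the leading one survives, with a power of w - 1 = - 2.\<close>
  moreover have "poly g (- inverse \<delta>) = coeff f (degree f) * (- 2) ^ (2 * degree f)"
  proof -
    have "poly g (- inverse \<delta>) = (\<Sum>i\<le>degree f. coeff f i * ((- 2) ^ (2 * i) * 0 ^ (2 * (degree f - i))))"
      using \<delta>_neq_0 by (simp add: g_def poly_sum)
    also have "\<dots> = (\<Sum>i\<le>degree f. if i = degree f then coeff f i * (- 2) ^ (2 * i) else 0)"
      by (rule sum.cong) (auto simp: power_0_left)
    finally show ?thesis by simp
  qed
  ultimately show False using f(2) two_neq_0 by simp
qed

text \<open>This is a / \<delta>, because \<delta> = a^(K + 1). Its order is the order of
  \<open>a\<close> divided by \<open>K\<close>.\<close>

definition \<zeta> :: 'a where "\<zeta> = inverse (a ^ K)"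

lemma \<zeta>_primitive: "primitive_root_of_unity (2 * (q + 1)) \<zeta>"
proof -
  have iff: "\<zeta> ^ l = 1 \<longleftrightarrow> 2 * (q + 1) dvd l" for l
  proof -
    have "\<zeta> ^ l = inverse (a ^ (K * l))" by (simp add: \<zeta>_def power_inverse power_mult)
    then have "\<zeta> ^ l = 1 \<longleftrightarrow> a ^ (K * l) = 1" by (simp only: inverse_eq_1_iff)
    then show ?thesis using K_pos by (simp only: a_power_eq_1_iff nat_mult_dvd_cancel1)
  qed
  show ?thesis
    unfolding primitive_root_of_unity_def iff by (meson dvd_refl dvd_imp_le leD)
qed

lemma \<sigma>_w: "\<sigma> w = inverse w"
proof -
  have "\<sigma> w = \<iota> \<delta> * (1 / (\<iota> (\<delta> ^ 2) * y))"
    by (simp only: w_def field_homomorphismD[OF \<sigma>_hom] \<sigma>_\<iota> \<sigma>_y \<delta>_square)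
  also have "\<dots> = inverse w"
    using \<delta>_neq_0 y_neq_0 by (simp add: w_def hom_mult power2_eq_square field_simps)
  finally show ?thesis .
qed

lemma \<sigma>_u: "\<sigma> u = - u"
proof -
  have "\<sigma> u = (inverse w - 1) / (inverse w + 1)"
    by (simp add: u_def field_homomorphismD[OF \<sigma>_hom] \<sigma>_w)
  also have "\<dots> = (1 - w) / (1 + w)"
    using w_neq by (simp add: divide_simps add.commute)
  also have "\<dots> = - u" unfolding u_def minus_divide_left by (simp add: add.commute)
  finally show ?thesis .
qed

lemma \<sigma>_t: "\<sigma> t = t"
  by (simp add: t_def field_homomorphismD[OF \<sigma>_hom] \<sigma>_u)

lemma \<sigma>_X: "\<sigma> X = \<iota> \<zeta> * X"
proof -
  have "\<sigma> X = (\<iota> a * x / (\<iota> (\<delta> ^ 2) * y)) / (inverse w + 1)"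
    by (simp only: X_def field_homomorphismD[OF \<sigma>_hom] \<sigma>_w \<sigma>_x \<delta>_square)
  also have "\<dots> = \<iota> a * inverse (\<iota> \<delta>) * X"
    using w_neq y_neq_0 \<delta>_neq_0 unfolding X_def
    by (simp add: w_def hom_mult power2_eq_square divide_simps) (simp add: algebra_simps)
  also have "\<iota> a * inverse (\<iota> \<delta>) = \<iota> \<zeta>"
  proof -
    have "a * inverse \<delta> = \<zeta>"
      using a_neq_0 by (simp add: \<zeta>_def \<delta>_eq flip: mult.assoc)
    then show ?thesis by (simp flip: hom_inverse hom_mult)
  qed
  finally show ?thesis .
qed

text \<open>With W = w^q, the Frobenius map gives u - u^q = 2 (w - W) / ((w + 1) (W + 1)). Since
  \<delta>^q = - \<delta>, the curve equation says that \<delta> x^(q+1) = w - W, and (w + 1) (W +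
  1) is (w + 1)^(q+1).\<close>

lemma X_power: "X ^ (q + 1) = \<iota> (inverse (2 * \<delta>)) * (u * (1 - t ^ K))"
proof -
  define W where "W = w ^ q"
  have wq: "(w + 1) ^ q = W + 1" using frobenius[of w 1] by (simp add: W_def)
  have wq': "(w - 1) ^ q = W - 1" using frobenius[of "w - 1" 1] by (simp add: W_def)
  have W1: "W + 1 \<noteq> 0" using wq w_neq(2) by (metis power_not_zero)
  have "W = - \<iota> \<delta> * y ^ q"
    by (simp add: W_def w_def power_mult_distrib hom_minus \<delta>_power_q flip: hom_power)
  then have x: "\<iota> \<delta> * x ^ (q + 1) = w - W"
    unfolding curve[symmetric] by (simp add: w_def distrib_left)
  have uq: "u ^ q = (W - 1) / (W + 1)" by (simp add: u_def power_divide wq wq')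
  have "t ^ K * u = u ^ q"
    by (subst (2) q_eq) (simp add: t_def mult.commute flip: power_mult)
  then have "u * (1 - t ^ K) = u - u ^ q" by (simp add: algebra_simps)
  also have "\<dots> = 2 * (w - W) / ((w + 1) * (W + 1))"
    using w_neq(2) W1 unfolding uq by (simp add: u_def divide_simps) (simp add: algebra_simps)
  also have "\<dots> = 2 * \<iota> \<delta> * X ^ (q + 1)"
  proof -
    have "(w + 1) ^ (q + 1) = (w + 1) * (W + 1)" by (simp add: wq)
    then have "X ^ (q + 1) = x ^ (q + 1) / ((w + 1) * (W + 1))" by (simp only: X_def power_divide)
    then show ?thesis by (simp only: x[symmetric] times_divide_eq_right mult.assoc)
  qed
  finally have eq: "u * (1 - t ^ K) = \<iota> (2 * \<delta>) * X ^ (q + 1)"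
    using hom_of_nat[of 2] by (simp add: hom_mult)
  have "\<iota> (2 * \<delta>) \<noteq> 0" using two_neq_0 \<delta>_neq_0 by simp
  then show ?thesis unfolding hom_inverse eq by (simp flip: mult.assoc)
qed

definition \<kappa> :: 'a where "\<kappa> = inverse (2 * \<delta>) ^ 2"

lemma X_power': "X ^ (2 * (q + 1)) = ev ([:0, \<kappa>:] * (1 - monom 1 K) ^ 2) t"
proof -
  have "X ^ (2 * (q + 1)) = (X ^ (q + 1)) ^ 2" by (simp only: mult.commute[of 2] power_mult)
  also have "\<dots> = \<iota> \<kappa> * (t * (1 - t ^ K) ^ 2)"
    unfolding X_power \<kappa>_def power_mult_distrib hom_power by (simp only: t_def)
  also have "\<dots> = ev ([:0, \<kappa>:] * (1 - monom 1 K) ^ 2) t"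
    unfolding ev_mult ev_power ev_diff ev_monom by simp
  finally show ?thesis .
qed

text \<open>The formula for X^(q+1) is linear in \<open>u\<close>, apart from powers of
  \<open>t\<close>, so it recovers \<open>u\<close> itself and not just its square; inverting the
  Cayley transform yields \<open>w\<close>, then \<open>y\<close> and \<open>x\<close>.\<close>

lemma generated:
  assumes E: "intermediate_field \<iota> E" and tE: "t \<in> E" and XE: "X \<in> E"
  shows "E = UNIV"
proof -
  interpret E: field_between \<iota> E by unfold_locales (rule E)
  have "1 - monom 1 K \<noteq> (0 :: 'a poly)"
  proof
    assume "1 - monom 1 K = (0 :: 'a poly)"
    then have "coeff (1 - monom 1 K) 0 = (0 :: 'a)" by simp
    then show False using K_pos by simp
  qed
  then have "1 - t ^ K \<noteq> 0"
    using t_trans[unfolded transcendental_iff, rule_format, of "1 - monom 1 K"]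
    by (auto simp: ev_diff ev_monom)
  then have "u = X ^ (q + 1) / (\<iota> (inverse (2 * \<delta>)) * (1 - t ^ K))"
    unfolding X_power using two_neq_0 \<delta>_neq_0 by (simp add: divide_simps)
  also have "\<dots> \<in> E" by (intro E.F_divide E.F_mult E.F_power E.F_diff XE tE E.F_hom E.F_1)
  finally have uE: "u \<in> E" .
  have "1 - u = 2 / (w + 1)" using w_neq(2) by (simp add: u_def field_simps)
  then have "1 - u \<noteq> 0" using w_neq(2) two_neq_0' by simp
  moreover have "w * (1 - u) = 1 + u" using w_neq(2) by (simp add: u_def divide_simps)
  ultimately have "w = (1 + u) / (1 - u)" by (simp add: field_simps)
  also have "\<dots> \<in> E" by (intro E.F_divide E.F_add E.F_diff uE E.F_1)
  finally have wE: "w \<in> E" .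
  have "y = w / \<iota> \<delta>" using \<delta>_neq_0 by (simp add: w_def)
  then have "y \<in> E" using E.F_divide[OF wE E.F_hom[of \<delta>]] by simp
  moreover have "x = X * (w + 1)" using w_neq(2) by (simp add: X_def)
  then have "x \<in> E" using E.F_mult[OF XE E.F_add[OF wE E.F_1]] by simp
  ultimately have "adjoin \<iota> {x, y} \<subseteq> E" using E by (auto simp: adjoin_def)
  then show ?thesis using adjoin_xy by auto
qed

lemma hermitian_kummer:
  assumes "m * e = 2 * (q + 1)"
  shows "hermitian_kummer \<iota> \<sigma> t X \<zeta> \<kappa> q m e"
proof unfold_locales
  show "of_nat (2 * (q + 1)) \<noteq> (0 :: 'a)" "of_nat K \<noteq> (0 :: 'a)" using not_dvd by (simp_all only: of_nat_eq_0 not_False_eq_True)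
  show "X \<noteq> 0" using x_neq_0 w_neq by (simp add: X_def)
  show "\<kappa> \<noteq> 0" using two_neq_0 \<delta>_neq_0 by (simp add: \<kappa>_def)
qed (use \<sigma>_bij \<sigma>_hom \<sigma>_\<iota> t_trans \<sigma>_t \<sigma>_X \<zeta>_primitive X_power' generated odd_q q_gt_1 assms in auto)

theorem genus_fixed:
  assumes "m * e = 2 * (q + 1)"
  shows "m dvd q + 1 \<Longrightarrow> real_of_int (genus \<iota> {z. (\<sigma> ^^ e) z = z}) = (real q - 1) * (real q + 1 - real m) / (2 * real m)"
    and "\<not> m dvd q + 1 \<Longrightarrow> real_of_int (genus \<iota> {z. (\<sigma> ^^ e) z = z}) = (real q - 1) * (real q + 1 - real m / 2) / (2 * real m)"
proof -
  interpret hk: hermitian_kummer \<iota> \<sigma> t X \<zeta> \<kappa> q m e by (rule hermitian_kummer[OF assms])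
  have q: "real q - 1 = 2 * real K" by (subst q_eq) simp
  have m0: "real m > 0" using hk.pos by simp
  {
    assume "m dvd q + 1"
    then obtain s where s: "q + 1 = m * s" by (rule dvdE)
    have "real q + 1 = real m * real s" using s by (metis of_nat_1 of_nat_add of_nat_mult)
    then have "real q + 1 - real m = real m * (real s - 1)" by (simp add: algebra_simps)
    then have "(real q - 1) * (real q + 1 - real m) / (2 * real m) = (real s - 1) * real K"
      unfolding q using m0 by (simp add: field_simps)
    moreover have "genus \<iota> {z. (\<sigma> ^^ e) z = z} = (int s - 1) * int K"
      using hk.genus_fixed_field_dvd[OF s[symmetric]] by (simp only: hk.F_def)
    ultimately show "real_of_int (genus \<iota> {z. (\<sigma> ^^ e) z = z}) = (real q - 1) * (real q + 1 - real m) / (2 * real m)"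
      by simp
  next
    assume not: "\<not> m dvd q + 1"
    \<comment> \<open>An even \<open>e\<close> would give m (e / 2) = q + 1. With \<open>e\<close>
      odd, the factor 2 of m e must divide \<open>m\<close>.\<close>
    have "odd e"
    proof
      assume "even e"
      then obtain e' where "e = 2 * e'" by (rule evenE)
      then have "2 * (m * e') = 2 * (q + 1)" using assms by simp
      then have "m * e' = q + 1" by (rule nat_mult_eq_cancel1[THEN iffD1, rotated]) simp
      then show False using not by (metis dvd_triv_left)
    qed
    then obtain f where f: "e = 2 * f + 1" by (rule oddE)
    have "even (m * e)" unfolding assms by simp
    then have "even m" using \<open>odd e\<close> by simp
    then obtain m' where m': "m = 2 * m'" by (rule evenE)
    have "m' * e = q + 1" using assms m' by simp
    then have "real q + 1 = real m' * (2 * real f + 1)" using f by (metis of_nat_1 of_nat_add of_nat_mult of_nat_numeral)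
    then have "real q + 1 - real m / 2 = real m * real f" by (simp add: m' algebra_simps)
    then have "(real q - 1) * (real q + 1 - real m / 2) / (2 * real m) = real f * real K"
      unfolding q using m0 by simp
    moreover have "genus \<iota> {z. (\<sigma> ^^ e) z = z} = int f * int K"
      using hk.genus_fixed_field_not_dvd[OF m' f] by (simp only: hk.F_def)
    ultimately show "real_of_int (genus \<iota> {z. (\<sigma> ^^ e) z = z}) = (real q - 1) * (real q + 1 - real m / 2) / (2 * real m)"
      by simp
  }
qed

end

section \<open>Fixed fields of cyclic automorphism groups\<close>

lemma group_aut_group: "group (aut_group \<iota>)"
proof (rule groupI)
  fix f assume f: "f \<in> carrier (aut_group \<iota>)"
  then have bij: "bij f" and hom: "field_homomorphism f" and fix_\<iota>: "\<And>k. f (\<iota> k) = \<iota> k"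
    by (auto simp: aut_group_def)
  define g where "g = inv_into UNIV f"
  have fg: "f (g z) = z" for z unfolding g_def by (rule surj_f_inv_f[OF bij_is_surj[OF bij]])
  have gf: "g z = z'" if "f z' = z" for z z'
    unfolding g_def that[symmetric] by (rule inv_f_f[OF bij_is_inj[OF bij]])
  have "field_homomorphism g"
    unfolding field_homomorphism_def by (intro conjI allI gf) (simp_all add: field_homomorphismD[OF hom] fg)
  moreover have "bij g" unfolding g_def by (rule bij_imp_bij_inv[OF bij])
  ultimately have "g \<in> carrier (aut_group \<iota>)" using gf[OF fix_\<iota>] by (simp add: aut_group_def)
  moreover have "g \<circ> f = id" using gf by auto
  ultimately show "\<exists>g\<in>carrier (aut_group \<iota>). g \<otimes>\<^bsub>aut_group \<iota>\<^esub> f = \<one>\<^bsub>aut_group \<iota>\<^esub>"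
    by (auto simp: aut_group_def)
qed (auto simp: aut_group_def bij_comp comp_assoc field_homomorphism_def)

lemma funpow_in_aut_group:
  "\<sigma> \<in> carrier (aut_group \<iota>) \<Longrightarrow> \<sigma> ^^ k \<in> carrier (aut_group \<iota>)"
  by (induction k) (auto simp: aut_group_def bij_comp field_homomorphism_def)

lemma fixed_field_generate:
  assumes \<tau>: "\<tau> \<in> carrier (aut_group \<iota>)"
  shows "fixed_field (generate (aut_group \<iota>) {\<tau>}) = {z. \<tau> z = z}"
proof (intro equalityI subsetI)
  fix z assume "z \<in> fixed_field (generate (aut_group \<iota>) {\<tau>})"
  then show "z \<in> {z. \<tau> z = z}" by (auto simp: fixed_field_def intro: generate.incl)
next
  fix z assume z: "z \<in> {z. \<tau> z = z}"
  have "f z = z" if "f \<in> generate (aut_group \<iota>) {\<tau>}" for f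
    using that
  proof induction
    case (inv g)
    then have g: "g = \<tau>" by simp
    have "inv\<^bsub>aut_group \<iota>\<^esub> \<tau> \<otimes>\<^bsub>aut_group \<iota>\<^esub> \<tau> = \<one>\<^bsub>aut_group \<iota>\<^esub>"
      by (rule group.l_inv[OF group_aut_group \<tau>])
    then have "(inv\<^bsub>aut_group \<iota>\<^esub> \<tau>) (\<tau> z) = z" by (simp add: aut_group_def fun_eq_iff)
    then show ?case using z g by simp
  qed (use z in \<open>auto simp: aut_group_def\<close>)
  then show "z \<in> fixed_field (generate (aut_group \<iota>) {\<tau>})" by (simp add: fixed_field_def)
qed

theorem theorem5p3:
  fixes p n q m :: nat
    and \<iota> :: "'k::field \<Rightarrow> 'h::field"
    and x y :: 'h
    and a \<delta> c :: 'k
    and \<sigma> :: "'h \<Rightarrow> 'h"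
    and G :: "('h \<Rightarrow> 'h) set"
  assumes "prime p" and "odd p" and "n \<ge> 1" and "q = p ^ n"
    and "hermitian_function_field q \<iota> x y"
    and "primitive_root_of_unity (q ^ 2 - 1) a"
    and "\<delta> = a ^ ((q + 1) div 2)"
    and "c = \<delta> - a ^ (q + 1) * inverse \<delta>"
    and "\<sigma> \<in> carrier (aut_group \<iota>)"
    and "\<sigma> x = \<iota> a * x / (\<iota> (a ^ (q + 1)) * y + \<iota> c)"
    and "\<sigma> y = 1 / (\<iota> (a ^ (q + 1)) * y + \<iota> c)"
    and "m > 0" and "m dvd 2 * (q + 1)"
    and "G = generate (aut_group \<iota>) {\<sigma> ^^ (2 * (q + 1) div m)}"
  shows "(m dvd q + 1 \<longrightarrow>
            real_of_int (genus \<iota> (fixed_field G)) =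
              (real q - 1) * (real q + 1 - real m) / (2 * real m)) \<and>
         (\<not> m dvd q + 1 \<longrightarrow>
            real_of_int (genus \<iota> (fixed_field G)) =
              (real q - 1) * (real q + 1 - real m / 2) / (2 * real m))"
proof -
  have "odd q" using assms(2,4) by simp
  then have "(q + 1) div 2 * 2 = q + 1" by presburger
  then have "a ^ (q + 1) = \<delta> * \<delta>" unfolding assms(7) by (simp only: flip: power_add mult_2_right)
  \<comment> \<open>For \<delta> = 0 both sides are 0, because \<open>inverse 0 = 0\<close>.\<close>
  then have "a ^ (q + 1) * inverse \<delta> = \<delta>" by (simp only: mult.assoc) (cases "\<delta> = 0"; simp)
  then have "c = 0" using assms(8) by simp
  have herm: "CARD('k) = q ^ 2" "field_homomorphism \<iota>" "transcendental_via \<iota> x"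
    "y ^ q + y = x ^ (q + 1)" "adjoin \<iota> {x, y} = UNIV"
    using assms(5) by (auto simp: hermitian_function_field_def)
  interpret field_extension \<iota> by unfold_locales (rule herm(2))
  have \<sigma>: "bij \<sigma>" "field_homomorphism \<sigma>" "\<And>k. \<sigma> (\<iota> k) = \<iota> k"
    using assms(9) by (auto simp: aut_group_def)
  interpret hermitian_automorphism \<iota> p n q x y a \<delta> \<sigma>
    by unfold_locales (use assms(1-4,6,7,10,11) herm \<sigma> \<open>c = 0\<close> in \<open>simp_all\<close>)
  define e where "e = 2 * (q + 1) div m"
  have "m * e = 2 * (q + 1)" using assms(13) by (simp add: e_def)
  moreover have "fixed_field G = {z. (\<sigma> ^^ e) z = z}"
    unfolding assms(14) e_def[symmetric] by (rule fixed_field_generate[OF funpow_in_aut_group[OF assms(9)]])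
  ultimately show ?thesis using genus_fixed by simp
qed



end
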